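(* Let $k$ be an algebraically closed field with $\mathrm{char}\,k\neq 3$. If $\Lambda=kQ/I$ is a gentle $k$-algebra which is $2$-Calabi-Yau tilted, then $\Lambda$ is a Jacobian algebra, i.e. there is a quiver with potential whose Jacobian algebra is isomorphic to $\Lambda$.
   Context: All algebras are finite-dimensional basic $k$-algebras $kQ/I$, where $Q$ is a finite quiver with source and target maps $s,t$ and $I$ is an admissible ideal. The path $\alpha\beta$ means $\alpha$ followed by $\beta$ ($t(\alpha)=s(\beta)$). Gentle algebra: $\Lambda=kQ/I$ is gentle if (G1) each vertex is the source of at most two arrows and the target of at most two arrows; (G2) $I$ is generated by paths of length $2$; (G3) for each arrow $\beta$ there is at most one arrow $\alpha$ with $t(\alpha)=s(\beta)$ and $\alpha\beta\in I$, and at most one arrow $\gamma$ with $t(\beta)=s(\gamma)$ and $\beta\gamma\in I$; (G4) for each arrow $\beta$ there is at most one arrow $\alpha$ with $t(\alpha)=s(\beta)$ and $\alpha\beta\notin I$, and at most one arrow $\gamma$ with $t(\beta)=s(\gamma)$ and $\beta\gamma\notin I$. $2$-Calabi-Yau tilted algebra: a $\mathrm{Hom}$-finite triangulated $k$-category $\mathcal C$ with split idempotents is $2$-Calabi-Yau if there is a bifunctorial isomorphism $\mathrm{Hom}_{\mathcal C}(X,Y)\simeq D\,\mathrm{Hom}_{\mathcal C}(Y,X[2])$ for all $X,Y\in\mathcal C$, where $D=\mathrm{Hom}_k(-,k)$. An object $T$ of such a $\mathcal C$ is cluster-tilting if it is basic and $\mathrm{add}\,T=\{X\in\mathcal C:\mathrm{Hom}_{\mathcal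 C}(X,T[1])=0\}$. A $2$-Calabi-Yau tilted algebra is an algebra of the form $\mathrm{End}_{\mathcal C}(T)$ with $\mathcal C$ $2$-Calabi-Yau and $T$ cluster-tilting. Jacobian algebra: for a finite quiver $Q'$, let $k\langle\langle Q'\rangle\rangle$ be the complete path algebra, consisting of all possibly infinite $k$-linear combinations of paths. A potential $W$ is a possibly infinite linear combination of cycles of $Q'$, up to cyclic equivalence. For an arrow $\alpha$, the cyclic derivative is $\partial_\alpha(\alpha_1\cdots\alpha_l)=\sum_{r=1}^{l}\delta_{\alpha\alpha_r}\,\alpha_{r+1}\cdots\alpha_l\alpha_1\cdots\alpha_{r-1}$ on cycles ($\delta$ the Kronecker delta), extended linearly. The Jacobian algebra is $\mathrm{Jac}(Q',W)=k\langle\langle Q'\rangle\rangle/\langle\partial_\alpha W:\alpha\in Q'_1\rangle$. *)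

theory Defs
  imports
    "HOL-Computational_Algebra.Polynomial"
    "Graph_Theory.Arc_Walk"
    "HOL-Algebra.QuotRing"
    "HOL-Algebra.Module"
begin

section \<open>Vector spaces and algebras over a field\<close>

text \<open>The ground field is a type \<open>'k\<close>. A vector space over it is a module in the sense of
  HOL-Algebra over the ring record below. An algebra is a record of the same type whose
  multiplicative part is meaningful as well; for mere vector spaces that part is ignored.\<close>

definition ground_ring :: "'k::field ring" where
  "ground_ring = \<lparr>carrier = UNIV, monoid.mult = (*), one = 1, zero = 0, add = (+)\<rparr>"

definition linear_maps :: "('k, 'a) module \<Rightarrow> ('k, 'b) module \<Rightarrow> ('a \<Rightarrow> 'b) set" where
  "linear_maps V W = {h \<in> carrier V \<rightarrow> carrier W.
     (\<forall>x\<in>carrier V. \<forall>y\<in>carrier V. h (x \<oplus>\<^bsub>V\<^esub> y) = h x \<oplus>\<^bsub>W\<^esub> h y) \<and>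
     (\<forall>c. \<forall>x\<in>carrier V. h (c \<odot>\<^bsub>V\<^esub> x) = c \<odot>\<^bsub>W\<^esub> h x)}"

definition linear_isos :: "('k, 'a) module \<Rightarrow> ('k, 'b) module \<Rightarrow> ('a \<Rightarrow> 'b) set" where
  "linear_isos V W = {h \<in> linear_maps V W. bij_betw h (carrier V) (carrier W)}"

definition finite_dimensional :: "('k, 'a) module \<Rightarrow> bool" where
  "finite_dimensional V \<longleftrightarrow> (\<exists>B. finite B \<and> B \<subseteq> carrier V \<and>
     (\<forall>x\<in>carrier V. \<exists>c. x = (\<Oplus>\<^bsub>V\<^esub>b\<in>B. c b \<odot>\<^bsub>V\<^esub> b)))"

text \<open>Functionals are normalised to be \<open>0\<close> outside the carrier, so that equality of
  functionals is equality of functions.\<close>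

definition dual_space :: "('k::field, 'a) module \<Rightarrow> ('k, 'a \<Rightarrow> 'k) module" where
  "dual_space V = \<lparr>carrier = {l. (\<forall>x. x \<notin> carrier V \<longrightarrow> l x = 0) \<and>
       (\<forall>x\<in>carrier V. \<forall>y\<in>carrier V. l (x \<oplus>\<^bsub>V\<^esub> y) = l x + l y) \<and>
       (\<forall>c. \<forall>x\<in>carrier V. l (c \<odot>\<^bsub>V\<^esub> x) = c * l x)},
     monoid.mult = undefined, one = undefined,
     zero = (\<lambda>x. 0), add = (\<lambda>l l' x. l x + l' x), smult = (\<lambda>c l x. c * l x)\<rparr>"

definition algebra_isomorphic :: "('k, 'a) module \<Rightarrow> ('k, 'b) module \<Rightarrow> bool" where
  "algebra_isomorphic A B \<longleftrightarrow> (\<exists>h. h \<in> ring_iso A B \<and> h \<in> linear_maps A B)"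

definition quotient_algebra :: "('k, 'a) module \<Rightarrow> 'a set \<Rightarrow> ('k, 'a set) module" where
  "quotient_algebra A I = ring.extend (A Quot I)
     (module.fields (\<lambda>c X. \<Union>x\<in>X. I +>\<^bsub>A\<^esub> (c \<odot>\<^bsub>A\<^esub> x)))"


section \<open>Path algebras\<close>

text \<open>A finite quiver is a finite directed multigraph (\<^locale>\<open>fin_digraph\<close>), loops allowed;
  source and target of an arrow are its \<^const>\<open>tail\<close> and \<^const>\<open>head\<close>. A path is a pair of
  its starting vertex and its list of arrows in order of traversal, so \<open>(v, [])\<close> is the trivial
  path at \<open>v\<close> and the list \<open>[\<alpha>, \<beta>]\<close> is \<open>\<alpha>\<close> followed by \<open>\<beta>\<close>.\<close>

definition quiver_paths :: "('v, 'a) pre_digraph \<Rightarrow> ('v \<times> 'a list) set" where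
  "quiver_paths Q = {(u, p). \<exists>v. pre_digraph.awalk Q u p v}"

definition quiver_cycles :: "('v, 'a) pre_digraph \<Rightarrow> ('v \<times> 'a list) set" where
  "quiver_cycles Q = {(u, p). p \<noteq> [] \<and> pre_digraph.awalk Q u p u}"

text \<open>A possibly infinite linear combination of paths is its coefficient function. In the product,
  the coefficient at a path sums over all ways to cut this path in two.\<close>

definition complete_path_algebra :: "('v, 'a) pre_digraph \<Rightarrow> ('k::field, 'v \<times> 'a list \<Rightarrow> 'k) module" where
  "complete_path_algebra Q = \<lparr>carrier = {f. \<forall>x. f x \<noteq> 0 \<longrightarrow> x \<in> quiver_paths Q},
     monoid.mult = (\<lambda>f g (u, p). \<Sum>i\<le>length p.
       f (u, take i p) * g (pre_digraph.awlast Q u (take i p), drop i p)),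
     one = (\<lambda>(u, p). if u \<in> verts Q \<and> p = [] then 1 else 0),
     zero = (\<lambda>x. 0), add = (\<lambda>f g x. f x + g x), smult = (\<lambda>c f x. c * f x)\<rparr>"

definition path_algebra :: "('v, 'a) pre_digraph \<Rightarrow> ('k::field, 'v \<times> 'a list \<Rightarrow> 'k) module" where
  "path_algebra Q = (complete_path_algebra Q)
     \<lparr>carrier := {f \<in> carrier (complete_path_algebra Q). finite {x. f x \<noteq> 0}}\<rparr>"

definition path_elem :: "'v \<times> 'a list \<Rightarrow> ('v \<times> 'a list \<Rightarrow> 'k::field)" where
  "path_elem x = (\<lambda>y. if y = x then 1 else 0)"

text \<open>The \<open>m\<close>-th power of the arrow ideal: the span of the paths of length at least \<open>m\<close>.\<close>

definition arrow_ideal_power :: "('v, 'a) pre_digraph \<Rightarrow> nat \<Rightarrow> ('v \<times> 'a list \<Rightarrow> 'k::field) set" where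
  "arrow_ideal_power Q m =
     {f \<in> carrier (path_algebra Q). \<forall>x. f x \<noteq> 0 \<longrightarrow> m \<le> length (snd x)}"

definition admissible_ideal :: "('v, 'a) pre_digraph \<Rightarrow> ('v \<times> 'a list \<Rightarrow> 'k::field) set \<Rightarrow> bool" where
  "admissible_ideal Q I \<longleftrightarrow> ideal I (path_algebra Q) \<and>
     (\<exists>m\<ge>2. arrow_ideal_power Q m \<subseteq> I) \<and> I \<subseteq> arrow_ideal_power Q 2"


section \<open>Gentle algebras\<close>

definition arrow_prod :: "('v, 'a) pre_digraph \<Rightarrow> 'a \<Rightarrow> 'a \<Rightarrow> ('v \<times> 'a list \<Rightarrow> 'k::field)" where
  "arrow_prod Q \<alpha> \<beta> = path_elem (tail Q \<alpha>, [\<alpha>, \<beta>])"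

definition gentle :: "('v, 'a) pre_digraph \<Rightarrow> ('v \<times> 'a list \<Rightarrow> 'k::field) set \<Rightarrow> bool" where
  "gentle Q I \<longleftrightarrow> fin_digraph Q \<and> admissible_ideal Q I \<and>
     (\<forall>v\<in>verts Q. out_degree Q v \<le> 2 \<and> in_degree Q v \<le> 2) \<and>
     (\<exists>R \<subseteq> {x \<in> quiver_paths Q. length (snd x) = 2}. I = Idl\<^bsub>path_algebra Q\<^esub> (path_elem ` R)) \<and>
     (\<forall>\<beta>\<in>arcs Q.
        (\<exists>\<^sub>\<le>\<^sub>1 \<alpha>. \<alpha> \<in> arcs Q \<and> head Q \<alpha> = tail Q \<beta> \<and> arrow_prod Q \<alpha> \<beta> \<in> I) \<and>
        (\<exists>\<^sub>\<le>\<^sub>1 \<gamma>. \<gamma> \<in> arcs Q \<and> head Q \<beta> = tail Q \<gamma> \<and> arrow_prod Q \<beta> \<gamma> \<in> I)) \<and>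
     (\<forall>\<beta>\<in>arcs Q.
        (\<exists>\<^sub>\<le>\<^sub>1 \<alpha>. \<alpha> \<in> arcs Q \<and> head Q \<alpha> = tail Q \<beta> \<and> arrow_prod Q \<alpha> \<beta> \<notin> I) \<and>
        (\<exists>\<^sub>\<le>\<^sub>1 \<gamma>. \<gamma> \<in> arcs Q \<and> head Q \<beta> = tail Q \<gamma> \<and> arrow_prod Q \<beta> \<gamma> \<notin> I))"


section \<open>Jacobian algebras\<close>

text \<open>A potential is given by a representative of its class under cyclic equivalence. The
  derivative below takes the same value on cyclically equivalent representatives.\<close>

definition potential :: "('v, 'a) pre_digraph \<Rightarrow> ('v \<times> 'a list \<Rightarrow> 'k::field) \<Rightarrow> bool" where
  "potential Q W \<longleftrightarrow> (\<forall>x. W x \<noteq> 0 \<longrightarrow> x \<in> quiver_cycles Q)"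

text \<open>The coefficient of a path \<open>y\<close> in the derivative collects the coefficients \<open>W x\<close> of all
  cycles \<open>x\<close>, once for each position \<open>r\<close> (counted from 0) at which \<open>x\<close> passes through \<open>\<alpha>\<close> such that
  cutting out this \<open>\<alpha>\<close> and rotating leaves \<open>y\<close>. Such \<open>x\<close> are one arrow longer than \<open>y\<close>, hence
  finite in number if the quiver is finite.\<close>

definition cyclic_derivative ::
    "('v, 'a) pre_digraph \<Rightarrow> 'a \<Rightarrow> ('v \<times> 'a list \<Rightarrow> 'k::field) \<Rightarrow> ('v \<times> 'a list \<Rightarrow> 'k)" where
  "cyclic_derivative Q \<alpha> W = (\<lambda>y. \<Sum>(x, r) | x \<in> quiver_cycles Q \<and> r < length (snd x) \<and>
     snd x ! r = \<alpha> \<and> (head Q \<alpha>, drop (Suc r) (snd x) @ take r (snd x)) = y. W x)"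

text \<open>The ideal need not be closed for the arrow-adic topology in general, but it contains a power
  of the arrow ideal, and thus is closed, as soon as the quotient by it, or by its closure, is
  finite-dimensional.\<close>

definition jacobian_algebra ::
    "('v, 'a) pre_digraph \<Rightarrow> ('v \<times> 'a list \<Rightarrow> 'k::field) \<Rightarrow> ('k, ('v \<times> 'a list \<Rightarrow> 'k) set) module" where
  "jacobian_algebra Q W = quotient_algebra (complete_path_algebra Q)
     (Idl\<^bsub>complete_path_algebra Q\<^esub> ((\<lambda>\<alpha>. cyclic_derivative Q \<alpha> W) ` arcs Q))"


section \<open>Linear categories\<close>

text \<open>The composite \<open>g \<cdot> f\<close> is \<open>g\<close> after \<open>f\<close>. Composition carries no object indices; this is no
  restriction since morphisms may be taken to contain their source and target.\<close>

record ('o, 'm, 'k) linear_cat =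
  Ob :: "'o set"
  Hom :: "'o \<Rightarrow> 'o \<Rightarrow> ('k, 'm) module"
  Ident :: "'o \<Rightarrow> 'm"
  Comp :: "'m \<Rightarrow> 'm \<Rightarrow> 'm" (infixl \<open>\<cdot>\<index>\<close> 70)

abbreviation mor :: "('o, 'm, 'k, 'z) linear_cat_scheme \<Rightarrow> 'o \<Rightarrow> 'o \<Rightarrow> 'm set" where
  "mor C X Y \<equiv> carrier (Hom C X Y)"

abbreviation zero_mor :: "('o, 'm, 'k, 'z) linear_cat_scheme \<Rightarrow> 'o \<Rightarrow> 'o \<Rightarrow> 'm" where
  "zero_mor C X Y \<equiv> \<zero>\<^bsub>Hom C X Y\<^esub>"

definition iso_mor :: "('o, 'm, 'k, 'z) linear_cat_scheme \<Rightarrow> 'o \<Rightarrow> 'o \<Rightarrow> 'm \<Rightarrow> bool" where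
  "iso_mor C X Y f \<longleftrightarrow> f \<in> mor C X Y \<and>
     (\<exists>g\<in>mor C Y X. g \<cdot>\<^bsub>C\<^esub> f = Ident C X \<and> f \<cdot>\<^bsub>C\<^esub> g = Ident C Y)"

definition iso_obj :: "('o, 'm, 'k, 'z) linear_cat_scheme \<Rightarrow> 'o \<Rightarrow> 'o \<Rightarrow> bool" where
  "iso_obj C X Y \<longleftrightarrow> (\<exists>f. iso_mor C X Y f)"

definition zero_obj :: "('o, 'm, 'k, 'z) linear_cat_scheme \<Rightarrow> 'o \<Rightarrow> bool" where
  "zero_obj C Z \<longleftrightarrow> Z \<in> Ob C \<and>
     (\<forall>X\<in>Ob C. mor C X Z = {zero_mor C X Z} \<and> mor C Z X = {zero_mor C Z X})"

definition direct_sum :: "('o, 'm, 'k, 'z) linear_cat_scheme \<Rightarrow> 'o \<Rightarrow> 'o list \<Rightarrow> bool" where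
  "direct_sum C S Xs \<longleftrightarrow> S \<in> Ob C \<and> set Xs \<subseteq> Ob C \<and>
     (\<exists>\<iota> \<pi>. (\<forall>i<length Xs. \<iota> i \<in> mor C (Xs ! i) S \<and> \<pi> i \<in> mor C S (Xs ! i)) \<and>
       (\<forall>i<length Xs. \<forall>j<length Xs. \<pi> i \<cdot>\<^bsub>C\<^esub> \<iota> j =
          (if i = j then Ident C (Xs ! i) else zero_mor C (Xs ! j) (Xs ! i))) \<and>
       Ident C S = (\<Oplus>\<^bsub>Hom C S S\<^esub>i\<in>{..<length Xs}. \<iota> i \<cdot>\<^bsub>C\<^esub> \<pi> i))"

definition indecomposable_obj :: "('o, 'm, 'k, 'z) linear_cat_scheme \<Rightarrow> 'o \<Rightarrow> bool" where
  "indecomposable_obj C X \<longleftrightarrow> X \<in> Ob C \<and> \<not> zero_obj C X \<and>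
     (\<forall>Y Z. direct_sum C X [Y, Z] \<longrightarrow> zero_obj C Y \<or> zero_obj C Z)"

definition basic_obj :: "('o, 'm, 'k, 'z) linear_cat_scheme \<Rightarrow> 'o \<Rightarrow> bool" where
  "basic_obj C X \<longleftrightarrow> (\<exists>Xs. direct_sum C X Xs \<and> (\<forall>Y\<in>set Xs. indecomposable_obj C Y) \<and>
     (\<forall>i<length Xs. \<forall>j<length Xs. iso_obj C (Xs ! i) (Xs ! j) \<longrightarrow> i = j))"

text \<open>\<open>add T\<close>: the direct summands of finite direct sums of copies of \<open>T\<close>.\<close>

definition add_closure :: "('o, 'm, 'k, 'z) linear_cat_scheme \<Rightarrow> 'o \<Rightarrow> 'o set" where
  "add_closure C T = {X. \<exists>n S Y. direct_sum C S (replicate n T) \<and> direct_sum C S [X, Y]}"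

definition End_algebra :: "('o, 'm, 'k, 'z) linear_cat_scheme \<Rightarrow> 'o \<Rightarrow> ('k, 'm) module" where
  "End_algebra C X = (Hom C X X)\<lparr>monoid.mult := Comp C, one := Ident C X\<rparr>"

locale linear_category =
  fixes C :: "('o, 'm, 'k::field, 'z) linear_cat_scheme" (structure)
  assumes Hom_module: "\<lbrakk>X \<in> Ob C; Y \<in> Ob C\<rbrakk> \<Longrightarrow> Module.module ground_ring (Hom C X Y)"
    and Ident_closed: "X \<in> Ob C \<Longrightarrow> Ident C X \<in> mor C X X"
    and Comp_closed: "\<lbrakk>X \<in> Ob C; Y \<in> Ob C; Z \<in> Ob C; f \<in> mor C X Y; g \<in> mor C Y Z\<rbrakk>
      \<Longrightarrow> g \<cdot> f \<in> mor C X Z"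
    and Comp_Ident_right: "\<lbrakk>X \<in> Ob C; Y \<in> Ob C; f \<in> mor C X Y\<rbrakk> \<Longrightarrow> f \<cdot> Ident C X = f"
    and Comp_Ident_left: "\<lbrakk>X \<in> Ob C; Y \<in> Ob C; f \<in> mor C X Y\<rbrakk> \<Longrightarrow> Ident C Y \<cdot> f = f"
    and Comp_assoc: "\<lbrakk>W \<in> Ob C; X \<in> Ob C; Y \<in> Ob C; Z \<in> Ob C;
        f \<in> mor C W X; g \<in> mor C X Y; h \<in> mor C Y Z\<rbrakk> \<Longrightarrow> (h \<cdot> g) \<cdot> f = h \<cdot> (g \<cdot> f)"
    and Comp_linear_right: "\<lbrakk>X \<in> Ob C; Y \<in> Ob C; Z \<in> Ob C; g \<in> mor C Y Z\<rbrakk>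
      \<Longrightarrow> (\<lambda>f. g \<cdot> f) \<in> linear_maps (Hom C X Y) (Hom C X Z)"
    and Comp_linear_left: "\<lbrakk>X \<in> Ob C; Y \<in> Ob C; Z \<in> Ob C; f \<in> mor C X Y\<rbrakk>
      \<Longrightarrow> (\<lambda>g. g \<cdot> f) \<in> linear_maps (Hom C Y Z) (Hom C X Z)"


section \<open>Triangulated categories\<close>

type_synonym ('o, 'm) triangle = "'o \<times> 'o \<times> 'o \<times> 'm \<times> 'm \<times> 'm"

record ('o, 'm, 'k) triangulated_cat = "('o, 'm, 'k) linear_cat" +
  Shift :: "'o \<Rightarrow> 'o"
  Shift_mor :: "'m \<Rightarrow> 'm"
  Distinguished :: "('o, 'm) triangle set"

fun triangle_shape :: "('o, 'm, 'k, 'z) triangulated_cat_scheme \<Rightarrow> ('o, 'm) triangle \<Rightarrow> bool" where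
  "triangle_shape C (X, Y, Z, f, g, h) \<longleftrightarrow> X \<in> Ob C \<and> Y \<in> Ob C \<and> Z \<in> Ob C \<and>
     f \<in> mor C X Y \<and> g \<in> mor C Y Z \<and> h \<in> mor C Z (Shift C X)"

fun triangle_mor :: "('o, 'm, 'k, 'z) triangulated_cat_scheme \<Rightarrow> ('o, 'm) triangle \<Rightarrow> ('o, 'm) triangle
    \<Rightarrow> 'm \<Rightarrow> 'm \<Rightarrow> 'm \<Rightarrow> bool" where
  "triangle_mor C (X, Y, Z, f, g, h) (X', Y', Z', f', g', h') u v w \<longleftrightarrow>
     u \<in> mor C X X' \<and> v \<in> mor C Y Y' \<and> w \<in> mor C Z Z' \<and>
     v \<cdot>\<^bsub>C\<^esub> f = f' \<cdot>\<^bsub>C\<^esub> u \<and> w \<cdot>\<^bsub>C\<^esub> g = g' \<cdot>\<^bsub>C\<^esub> v \<and> Shift_mor C u \<cdot>\<^bsub>C\<^esub> h = h' \<cdot>\<^bsub>C\<^esub> w"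

text \<open>The shift is only required to be an autoequivalence.\<close>

locale triangulated_category = linear_category C
  for C :: "('o, 'm, 'k::field, 'z) triangulated_cat_scheme" (structure) +
  assumes direct_sums: "set Xs \<subseteq> Ob C \<Longrightarrow> \<exists>S. direct_sum C S Xs"
    and Shift_closed: "X \<in> Ob C \<Longrightarrow> Shift C X \<in> Ob C"
    and Shift_Ident: "X \<in> Ob C \<Longrightarrow> Shift_mor C (Ident C X) = Ident C (Shift C X)"
    and Shift_Comp: "\<lbrakk>X \<in> Ob C; Y \<in> Ob C; Z \<in> Ob C; f \<in> mor C X Y; g \<in> mor C Y Z\<rbrakk>
      \<Longrightarrow> Shift_mor C (g \<cdot> f) = Shift_mor C g \<cdot> Shift_mor C f"
    and Shift_linear_iso: "\<lbrakk>X \<in> Ob C; Y \<in> Ob C\<rbrakk>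
      \<Longrightarrow> Shift_mor C \<in> linear_isos (Hom C X Y) (Hom C (Shift C X) (Shift C Y))"
    and Shift_ess_surj: "Y \<in> Ob C \<Longrightarrow> \<exists>X\<in>Ob C. iso_obj C (Shift C X) Y"
    and Distinguished_shape: "t \<in> Distinguished C \<Longrightarrow> triangle_shape C t"
    and TR1_iso: "\<lbrakk>(X, Y, Z, f, g, h) \<in> Distinguished C; triangle_shape C (X', Y', Z', f', g', h');
        triangle_mor C (X, Y, Z, f, g, h) (X', Y', Z', f', g', h') u v w;
        iso_mor C X X' u; iso_mor C Y Y' v; iso_mor C Z Z' w\<rbrakk>
      \<Longrightarrow> (X', Y', Z', f', g', h') \<in> Distinguished C"
    and TR1_Ident: "\<lbrakk>X \<in> Ob C; zero_obj C Z\<rbrakk>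
      \<Longrightarrow> (X, X, Z, Ident C X, zero_mor C X Z, zero_mor C Z (Shift C X)) \<in> Distinguished C"
    and TR1_ex: "\<lbrakk>X \<in> Ob C; Y \<in> Ob C; f \<in> mor C X Y\<rbrakk>
      \<Longrightarrow> \<exists>Z g h. (X, Y, Z, f, g, h) \<in> Distinguished C"
    and TR2: "triangle_shape C (X, Y, Z, f, g, h)
      \<Longrightarrow> (X, Y, Z, f, g, h) \<in> Distinguished C \<longleftrightarrow>
        (Y, Z, Shift C X, g, h, \<ominus>\<^bsub>Hom C (Shift C X) (Shift C Y)\<^esub> Shift_mor C f) \<in> Distinguished C"
    and TR3: "\<lbrakk>(X, Y, Z, f, g, h) \<in> Distinguished C; (X', Y', Z', f', g', h') \<in> Distinguished C;
        u \<in> mor C X X'; v \<in> mor C Y Y'; v \<cdot> f = f' \<cdot> u\<rbrakk>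
      \<Longrightarrow> \<exists>w. triangle_mor C (X, Y, Z, f, g, h) (X', Y', Z', f', g', h') u v w"
    and TR4: "\<lbrakk>(X, Y, Z', f, i, i') \<in> Distinguished C; (Y, Z, X', g, j, j') \<in> Distinguished C;
        (X, Z, Y', g \<cdot> f, k, k') \<in> Distinguished C\<rbrakk>
      \<Longrightarrow> \<exists>a b. (Z', Y', X', a, b, Shift_mor C i \<cdot> j') \<in> Distinguished C \<and>
        triangle_mor C (X, Y, Z', f, i, i') (X, Z, Y', g \<cdot> f, k, k') (Ident C X) g a \<and>
        triangle_mor C (X, Z, Y', g \<cdot> f, k, k') (Y, Z, X', g, j, j') f (Ident C Z) b"


section \<open>2-Calabi-Yau categories and cluster-tilting objects\<close>

text \<open>In the naturality condition below, \<open>\<phi> X Y\<close> is the component of the bifunctorial isomorphism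
  at \<open>X\<close> and \<open>Y\<close>.\<close>

locale two_calabi_yau = triangulated_category C
  for C :: "('o, 'm, 'k::field, 'z) triangulated_cat_scheme" (structure) +
  assumes Hom_finite: "\<lbrakk>X \<in> Ob C; Y \<in> Ob C\<rbrakk> \<Longrightarrow> finite_dimensional (Hom C X Y)"
    and split_idempotents: "\<lbrakk>X \<in> Ob C; e \<in> mor C X X; e \<cdot> e = e\<rbrakk>
      \<Longrightarrow> \<exists>Y\<in>Ob C. \<exists>p\<in>mor C X Y. \<exists>i\<in>mor C Y X. i \<cdot> p = e \<and> p \<cdot> i = Ident C Y"
    and calabi_yau: "\<exists>\<phi>.
        (\<forall>X\<in>Ob C. \<forall>Y\<in>Ob C.
           \<phi> X Y \<in> linear_isos (Hom C X Y) (dual_space (Hom C Y (Shift C (Shift C X))))) \<and>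
        (\<forall>X\<in>Ob C. \<forall>X'\<in>Ob C. \<forall>Y\<in>Ob C. \<forall>Y'\<in>Ob C.
           \<forall>u\<in>mor C X' X. \<forall>f\<in>mor C X Y. \<forall>v\<in>mor C Y Y'. \<forall>g\<in>mor C Y' (Shift C (Shift C X')).
             \<phi> X' Y' (v \<cdot> f \<cdot> u) g = \<phi> X Y f (Shift_mor C (Shift_mor C u) \<cdot> g \<cdot> v))"

definition cluster_tilting :: "('o, 'm, 'k, 'z) triangulated_cat_scheme \<Rightarrow> 'o \<Rightarrow> bool" where
  "cluster_tilting C T \<longleftrightarrow> T \<in> Ob C \<and> basic_obj C T \<and>
     add_closure C T = {X \<in> Ob C. mor C X (Shift C T) = {zero_mor C X (Shift C T)}}"

end

theory Submission
  imports Defs "Graph_Theory.Digraph_Isomorphism"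
begin

text \<open>
  Write \<open>\<Lambda> = End T\<close>, and let \<open>\<alpha>\<beta> \<in> I\<close> be a relation of the gentle algebra. The point is that the two
  arrows lie on a 3-cycle \<open>\<alpha>\<beta>\<gamma>\<close> with \<open>\<alpha>\<beta>, \<beta>\<gamma>, \<gamma>\<alpha> \<in> I\<close>. Then \<open>I\<close> is generated by the cyclic derivatives
  of the sum \<open>W\<close> of all such cycles with all their rotations: the derivative of \<open>W\<close> with respect to
  \<open>\<gamma>\<close> is \<open>3\<alpha>\<beta>\<close>, also when the cycle is the cube of a loop, and \<open>3\<close> is invertible.

  To find the 3-cycle, let \<open>b : T \<rightarrow> V\<close> and \<open>a : V \<rightarrow> T\<close> be the morphisms given by \<open>\<beta>\<close> and \<open>\<alpha>\<close>, let \<open>X\<close> be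
  the cone of \<open>b\<close>, factor \<open>a\<close> through \<open>a' : X \<rightarrow> T\<close>, and let \<open>u : T \<rightarrow> Y\<close> be the cone of \<open>a'\<close>. Serre
  duality turns the functional on \<open>\<Lambda>\<close> that reads off the coefficient of the idempotent at the end of
  \<open>\<beta>\<close> into a morphism \<open>t : T \<rightarrow> T[2]\<close> that vanishes on the radical, and \<open>t\<close> lifts to \<open>s : T \<rightarrow> Y\<close>. For
  radical elements \<open>r\<close> this gives \<open>s r = u (\<rho> r)\<close> for some \<open>\<rho> r \<in> \<Lambda>\<close>, so \<open>\<rho>\<close> is a cocycle with values in
  \<open>\<Lambda>\<close> modulo \<open>\<alpha>\<Lambda>\<close>. Approximation by \<open>add T\<close> and duality show that on the kernel of \<open>b\<close> it is not given
  by left multiplication with an element. If there were no \<open>\<gamma>\<close> with \<open>\<beta>\<gamma> \<in> I\<close>, that kernel would be zero;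
  and if \<open>\<beta>\<gamma>, \<gamma>\<delta> \<in> I\<close> with \<open>\<delta> \<noteq> \<alpha>\<close>, then \<open>\<rho>(\<gamma>)\<delta> \<in> \<alpha>\<Lambda>\<close> would force \<open>\<rho>(\<gamma>) \<in> \<Lambda>\<gamma> + \<alpha>\<Lambda>\<close>, so \<open>\<rho>\<close> would be
  such a multiplication.
\<close>

text \<open>A product of paths goes to the composite written in the same order, so \<alpha>\<beta> =
  0 says that \<open>a\<close> after \<open>b\<close> vanishes, and \<rho> is linear for
  multiplication from the right. Why it is not a left multiplication on the kernel of
  \<open>b\<close>: subtracting such a multiplication from \<open>s\<close> leaves a morphism
  \<open>s'\<close> with the same composite with v : Y -> X[1], but zero on the kernel of
  \<open>b\<close>. Desuspending \<open>v\<close> gives y : Y[-1] -> X with a' y = 0. As the kernel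
  of \<open>a\<close> is the image of \<open>b\<close>, \<open>a'\<close> is injective on Hom(T, X);
  hence \<open>y\<close> kills every map from \<open>T\<close> and factors through some N[1] with
  \<open>N\<close> in add T. Followed by h : X -> T[1], this becomes the shift of a map N -> T
  killed by \<open>b\<close>, so by \<open>s'\<close>, and s'[1] h y = 0. Yet naturality of Serre
  duality expresses the value of the functional at the identity of \<open>T\<close> through exactly
  this composite, and that value is 1.\<close>

section \<open>Linear categories\<close>

text \<open>The index set may be infinite: its sum is \<zero> by convention, which the first premise
  covers. In the finite case membership in the carrier is carried along with \<open>P\<close>, since
  \<open>finsum_insert\<close> asks for it.\<close>

lemma (in abelian_monoid) finsum_induct_closed:
  assumes "P \<zero>" "\<And>x y. \<lbrakk>x \<in> carrier G; y \<in> carrier G; P x; P y\<rbrakk> \<Longrightarrow> P (x \<oplus> y)"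
    and "\<And>i. i \<in> A \<Longrightarrow> f i \<in> carrier G \<and> P (f i)"
  shows "P (\<Oplus>i\<in>A. f i)"
proof (cases "finite A")
  case True
  have "B \<subseteq> A \<Longrightarrow> (\<Oplus>i\<in>B. f i) \<in> carrier G \<and> P (\<Oplus>i\<in>B. f i)" if "finite B" for B
    using that
  proof (induction B rule: finite_induct)
    case (insert b B)
    have "f \<in> B \<rightarrow> carrier G" "f b \<in> carrier G" "P (f b)" using assms(3) insert.prems by auto
    then show ?case using insert assms(2) by (auto simp: finsum_insert)
  qed (use assms(1) in auto)
  with True show ?thesis by blast
qed (simp add: assms(1))

context linear_category
begin

lemma Hom_group: "\<lbrakk>X \<in> Ob C; Y \<in> Ob C\<rbrakk> \<Longrightarrow> abelian_group (Hom C X Y)"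
  using Hom_module unfolding module_def by blast

lemma zero_mor_closed: "\<lbrakk>X \<in> Ob C; Y \<in> Ob C\<rbrakk> \<Longrightarrow> zero_mor C X Y \<in> mor C X Y"
  using Hom_group[of X Y] by (simp add: abelian_group.axioms(1) abelian_monoid.zero_closed)

lemma additive_zero:
  assumes "abelian_group G" "abelian_group H" "h \<in> carrier G \<rightarrow> carrier H"
    and "\<And>x y. \<lbrakk>x \<in> carrier G; y \<in> carrier G\<rbrakk> \<Longrightarrow> h (x \<oplus>\<^bsub>G\<^esub> y) = h x \<oplus>\<^bsub>H\<^esub> h y"
  shows "h \<zero>\<^bsub>G\<^esub> = \<zero>\<^bsub>H\<^esub>"
proof -
  interpret G: abelian_group G by fact
  interpret H: abelian_group H by fact
  have "h \<zero>\<^bsub>G\<^esub> \<in> carrier H" using assms(3) by auto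
  moreover have "h \<zero>\<^bsub>G\<^esub> \<oplus>\<^bsub>H\<^esub> h \<zero>\<^bsub>G\<^esub> = h \<zero>\<^bsub>G\<^esub>" using assms(4)[of "\<zero>\<^bsub>G\<^esub>" "\<zero>\<^bsub>G\<^esub>"] by simp
  ultimately show ?thesis using H.add.l_cancel_one by blast
qed

lemma additive_minus:
  assumes "abelian_group G" "abelian_group H" "h \<in> carrier G \<rightarrow> carrier H"
    and "\<And>x y. \<lbrakk>x \<in> carrier G; y \<in> carrier G\<rbrakk> \<Longrightarrow> h (x \<oplus>\<^bsub>G\<^esub> y) = h x \<oplus>\<^bsub>H\<^esub> h y"
    and "x \<in> carrier G"
  shows "h (\<ominus>\<^bsub>G\<^esub> x) = \<ominus>\<^bsub>H\<^esub> h x"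
proof -
  interpret G: abelian_group G by fact
  interpret H: abelian_group H by fact
  have c: "h x \<in> carrier H" "h (\<ominus>\<^bsub>G\<^esub> x) \<in> carrier H" using assms(3,5) by auto
  have "h (\<ominus>\<^bsub>G\<^esub> x) \<oplus>\<^bsub>H\<^esub> h x = \<zero>\<^bsub>H\<^esub>"
    using assms(4)[of "\<ominus>\<^bsub>G\<^esub> x" x] additive_zero[OF assms(1-4)] assms(5) by (simp add: G.l_neg)
  then show ?thesis using H.minus_equality[OF _ c] by simp
qed

lemma Comp_add_right:
  "\<lbrakk>X \<in> Ob C; Y \<in> Ob C; Z \<in> Ob C; f \<in> mor C X Y; f' \<in> mor C X Y; g \<in> mor C Y Z\<rbrakk>
    \<Longrightarrow> g \<cdot> (f \<oplus>\<^bsub>Hom C X Y\<^esub> f') = g \<cdot> f \<oplus>\<^bsub>Hom C X Z\<^esub> g \<cdot> f'"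
  using Comp_linear_right[of X Y Z g] by (auto simp: linear_maps_def)

lemma Comp_add_left:
  "\<lbrakk>X \<in> Ob C; Y \<in> Ob C; Z \<in> Ob C; f \<in> mor C X Y; g \<in> mor C Y Z; g' \<in> mor C Y Z\<rbrakk>
    \<Longrightarrow> (g \<oplus>\<^bsub>Hom C Y Z\<^esub> g') \<cdot> f = g \<cdot> f \<oplus>\<^bsub>Hom C X Z\<^esub> g' \<cdot> f"
  using Comp_linear_left[of X Y Z f] by (auto simp: linear_maps_def)

lemma Comp_smult_right:
  "\<lbrakk>X \<in> Ob C; Y \<in> Ob C; Z \<in> Ob C; f \<in> mor C X Y; g \<in> mor C Y Z\<rbrakk>
    \<Longrightarrow> g \<cdot> (c \<odot>\<^bsub>Hom C X Y\<^esub> f) = c \<odot>\<^bsub>Hom C X Z\<^esub> (g \<cdot> f)"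
  using Comp_linear_right[of X Y Z g] by (auto simp: linear_maps_def)

lemma Comp_zero_right:
  assumes "X \<in> Ob C" "Y \<in> Ob C" "Z \<in> Ob C" "g \<in> mor C Y Z"
  shows "g \<cdot> zero_mor C X Y = zero_mor C X Z"
  by (rule additive_zero[of "Hom C X Y" "Hom C X Z" "\<lambda>f. g \<cdot> f"])
    (intro Pi_I Hom_group Comp_closed[OF assms(1-3)] Comp_add_right[OF assms(1-3)] assms | assumption)+

lemma Comp_zero_left:
  assumes "X \<in> Ob C" "Y \<in> Ob C" "Z \<in> Ob C" "f \<in> mor C X Y"
  shows "zero_mor C Y Z \<cdot> f = zero_mor C X Z"
  by (rule additive_zero[of "Hom C Y Z" "Hom C X Z" "\<lambda>g. g \<cdot> f"])
    (intro Pi_I Hom_group Comp_closed[OF assms(1-3)] Comp_add_left[OF assms(1-3)] assms | assumption)+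

lemma Comp_minus_right:
  assumes "X \<in> Ob C" "Y \<in> Ob C" "Z \<in> Ob C" "f \<in> mor C X Y" "g \<in> mor C Y Z"
  shows "g \<cdot> (\<ominus>\<^bsub>Hom C X Y\<^esub> f) = \<ominus>\<^bsub>Hom C X Z\<^esub> (g \<cdot> f)"
  by (rule additive_minus[of "Hom C X Y" "Hom C X Z" "\<lambda>f. g \<cdot> f"])
    (intro Pi_I Hom_group Comp_closed[OF assms(1-3)] Comp_add_right[OF assms(1-3)] assms | assumption)+

lemma Comp_minus_left:
  assumes "X \<in> Ob C" "Y \<in> Ob C" "Z \<in> Ob C" "f \<in> mor C X Y" "g \<in> mor C Y Z"
  shows "(\<ominus>\<^bsub>Hom C Y Z\<^esub> g) \<cdot> f = \<ominus>\<^bsub>Hom C X Z\<^esub> (g \<cdot> f)"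
  by (rule additive_minus[of "Hom C Y Z" "Hom C X Z" "\<lambda>g. g \<cdot> f"])
    (intro Pi_I Hom_group Comp_closed[OF assms(1-3)] Comp_add_left[OF assms(1-3)] assms | assumption)+

lemma mor_minus_closed:
  "\<lbrakk>X \<in> Ob C; Y \<in> Ob C; f \<in> mor C X Y\<rbrakk> \<Longrightarrow> \<ominus>\<^bsub>Hom C X Y\<^esub> f \<in> mor C X Y"
  by (rule abelian_group.a_inv_closed[OF Hom_group])

lemma mor_add_closed:
  "\<lbrakk>X \<in> Ob C; Y \<in> Ob C; f \<in> mor C X Y; g \<in> mor C X Y\<rbrakk> \<Longrightarrow> f \<oplus>\<^bsub>Hom C X Y\<^esub> g \<in> mor C X Y"
  by (rule abelian_monoid.a_closed[OF abelian_group.axioms(1)[OF Hom_group]])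

lemma Comp_minus_minus:
  assumes "X \<in> Ob C" "Y \<in> Ob C" "Z \<in> Ob C" "f \<in> mor C X Y" "g \<in> mor C Y Z"
  shows "(\<ominus>\<^bsub>Hom C Y Z\<^esub> g) \<cdot> f = g \<cdot> (\<ominus>\<^bsub>Hom C X Y\<^esub> f)"
  using Comp_minus_left[OF assms] Comp_minus_right[OF assms] by simp

lemma minus_zero_iff:
  assumes "X \<in> Ob C" "Y \<in> Ob C" "f \<in> mor C X Y"
  shows "\<ominus>\<^bsub>Hom C X Y\<^esub> f = zero_mor C X Y \<longleftrightarrow> f = zero_mor C X Y"
proof -
  interpret abelian_group "Hom C X Y" using Hom_group assms by blast
  show ?thesis using assms(3) by (simp add: add.inv_eq_1_iff)
qed

lemma zero_objI:
  assumes S: "S \<in> Ob C" and i: "Ident C S = zero_mor C S S"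
  shows "zero_obj C S"
  unfolding zero_obj_def
proof (intro conjI ballI S)
  fix X assume X: "X \<in> Ob C"
  have "f = zero_mor C X S" if f: "f \<in> mor C X S" for f
    using Comp_Ident_left[OF X S f] Comp_zero_left[OF X S S f] i by simp
  then show "mor C X S = {zero_mor C X S}" using zero_mor_closed[OF X S] by blast
  have "f = zero_mor C S X" if f: "f \<in> mor C S X" for f
    using Comp_Ident_right[OF S X f] Comp_zero_right[OF S S X f] i by simp
  then show "mor C S X = {zero_mor C S X}" using zero_mor_closed[OF S X] by blast
qed

lemma direct_sumE:
  assumes "direct_sum C S Xs"
  obtains \<iota> \<pi> where "S \<in> Ob C" "set Xs \<subseteq> Ob C"
    "\<And>i. i < length Xs \<Longrightarrow> \<iota> i \<in> mor C (Xs ! i) S" "\<And>i. i < length Xs \<Longrightarrow> \<pi> i \<in> mor C S (Xs ! i)"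
    "\<And>i j. \<lbrakk>i < length Xs; j < length Xs\<rbrakk> \<Longrightarrow>
        \<pi> i \<cdot> \<iota> j = (if i = j then Ident C (Xs ! i) else zero_mor C (Xs ! j) (Xs ! i))"
    "Ident C S = (\<Oplus>\<^bsub>Hom C S S\<^esub>i\<in>{..<length Xs}. \<iota> i \<cdot> \<pi> i)"
proof -
  from assms obtain \<iota> \<pi> where *: "S \<in> Ob C \<and> set Xs \<subseteq> Ob C \<and>
       (\<forall>i<length Xs. \<iota> i \<in> mor C (Xs ! i) S \<and> \<pi> i \<in> mor C S (Xs ! i)) \<and>
       (\<forall>i<length Xs. \<forall>j<length Xs. \<pi> i \<cdot> \<iota> j =
          (if i = j then Ident C (Xs ! i) else zero_mor C (Xs ! j) (Xs ! i))) \<and>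
       Ident C S = (\<Oplus>\<^bsub>Hom C S S\<^esub>i\<in>{..<length Xs}. \<iota> i \<cdot> \<pi> i)"
    unfolding direct_sum_def by blast
  show thesis by (rule that[of \<iota> \<pi>]) (use * in blast)+
qed

lemma direct_sumI:
  assumes "S \<in> Ob C" "set Xs \<subseteq> Ob C"
    "\<And>i. i < length Xs \<Longrightarrow> \<iota> i \<in> mor C (Xs ! i) S \<and> \<pi> i \<in> mor C S (Xs ! i)"
    "\<And>i j. \<lbrakk>i < length Xs; j < length Xs\<rbrakk> \<Longrightarrow>
        \<pi> i \<cdot> \<iota> j = (if i = j then Ident C (Xs ! i) else zero_mor C (Xs ! j) (Xs ! i))"
    "Ident C S = (\<Oplus>\<^bsub>Hom C S S\<^esub>i\<in>{..<length Xs}. \<iota> i \<cdot> \<pi> i)"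
  shows "direct_sum C S Xs"
  unfolding direct_sum_def using assms by blast

text \<open>The identity of \<open>S\<close> is the sum of the
  \<open>\<iota> i \<cdot> \<pi> i\<close>, so \<open>k\<close> is determined by its composites with
  the injections. The premise ranges over all maps from a summand, which keeps the choice of
  injections out of the statement.\<close>

lemma direct_sum_zero_right:
  assumes ds: "direct_sum C S Xs" and W: "W \<in> Ob C" and k: "k \<in> mor C S W"
    and z: "\<And>i x. \<lbrakk>i < length Xs; x \<in> mor C (Xs ! i) S\<rbrakk> \<Longrightarrow> k \<cdot> x = zero_mor C (Xs ! i) W"
  shows "k = zero_mor C S W"
proof -
  obtain \<iota> \<pi> where S: "S \<in> Ob C" and Xs: "set Xs \<subseteq> Ob C"
    and io1: "\<And>i. i < length Xs \<Longrightarrow> \<iota> i \<in> mor C (Xs ! i) S"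
    and io2: "\<And>i. i < length Xs \<Longrightarrow> \<pi> i \<in> mor C S (Xs ! i)"
    and id: "Ident C S = (\<Oplus>\<^bsub>Hom C S S\<^esub>i\<in>{..<length Xs}. \<iota> i \<cdot> \<pi> i)"
    by (rule direct_sumE[OF ds]) blast
  have io: "\<iota> i \<in> mor C (Xs ! i) S \<and> \<pi> i \<in> mor C S (Xs ! i)" if "i < length Xs" for i
    using io1[OF that] io2[OF that] by blast
  have Xi: "Xs ! i \<in> Ob C" if "i < length Xs" for i using Xs that by auto
  interpret abelian_group "Hom C S S" using Hom_group S by blast
  interpret W: abelian_group "Hom C S W" using Hom_group S W by blast
  have "k \<cdot> Ident C S = zero_mor C S W" unfolding id
  proof (rule finsum_induct_closed[where P = "\<lambda>x. k \<cdot> x = zero_mor C S W"])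
    show "k \<cdot> zero_mor C S S = zero_mor C S W" using Comp_zero_right S W k by blast
    show "k \<cdot> (x \<oplus>\<^bsub>Hom C S S\<^esub> y) = zero_mor C S W"
      if "x \<in> mor C S S" "y \<in> mor C S S" "k \<cdot> x = zero_mor C S W" "k \<cdot> y = zero_mor C S W" for x y
      using Comp_add_right[OF S S W that(1,2) k] that(3,4) by simp
    fix i assume i: "i \<in> {..<length Xs}"
    then have i': "i < length Xs" by simp
    have "k \<cdot> (\<iota> i \<cdot> \<pi> i) = (k \<cdot> \<iota> i) \<cdot> \<pi> i"
      using Comp_assoc[OF S Xi[OF i'] S W] io[OF i'] k by auto
    also have "\<dots> = zero_mor C S W"
      using z[OF i'] io[OF i'] Comp_zero_left[OF S Xi[OF i'] W] by auto
    finally show "\<iota> i \<cdot> \<pi> i \<in> mor C S S \<and> k \<cdot> (\<iota> i \<cdot> \<pi> i) = zero_mor C S W"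
      using Comp_closed[OF S Xi[OF i'] S] io[OF i'] by auto
  qed
  then show ?thesis using Comp_Ident_right[OF S W k] by simp
qed

text \<open>The copairing is the sum of the \<open>f i \<cdot> \<pi> i\<close>, built up one summand
  at a time. The injections stay hidden behind the existential: only the factorisation of each
  \<open>f i\<close> through \<open>p\<close> is used later.\<close>

lemma direct_sum_copair:
  assumes ds: "direct_sum C S Xs" and W: "W \<in> Ob C"
    and f: "\<And>i. i < length Xs \<Longrightarrow> f i \<in> mor C (Xs ! i) W"
  shows "\<exists>p\<in>mor C S W. \<forall>i<length Xs. \<exists>x\<in>mor C (Xs ! i) S. p \<cdot> x = f i"
proof -
  obtain \<iota> \<pi> where S: "S \<in> Ob C" and Xs: "set Xs \<subseteq> Ob C"
    and io1: "\<And>i. i < length Xs \<Longrightarrow> \<iota> i \<in> mor C (Xs ! i) S"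
    and io2: "\<And>i. i < length Xs \<Longrightarrow> \<pi> i \<in> mor C S (Xs ! i)"
    and d: "\<And>i j. \<lbrakk>i < length Xs; j < length Xs\<rbrakk> \<Longrightarrow>
        \<pi> i \<cdot> \<iota> j = (if i = j then Ident C (Xs ! i) else zero_mor C (Xs ! j) (Xs ! i))"
    by (rule direct_sumE[OF ds]) blast
  have io: "\<iota> i \<in> mor C (Xs ! i) S \<and> \<pi> i \<in> mor C S (Xs ! i)" if "i < length Xs" for i
    using io1[OF that] io2[OF that] by blast
  have Xi: "Xs ! i \<in> Ob C" if "i < length Xs" for i using Xs that by auto
  interpret W: abelian_group "Hom C S W" using Hom_group S W by blast
  have "n \<le> length Xs \<Longrightarrow> \<exists>p\<in>mor C S W. \<forall>i<length Xs. p \<cdot> \<iota> i = (if i < n then f i else zero_mor C (Xs ! i) W)" for n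
  proof (induction n)
    case 0
    then show ?case using Comp_zero_left[OF Xi S W] io by (intro bexI[of _ "zero_mor C S W"]) auto
  next
    case (Suc n)
    then have n: "n < length Xs" by simp
    with Suc obtain p where p: "p \<in> mor C S W"
      "\<And>i. i < length Xs \<Longrightarrow> p \<cdot> \<iota> i = (if i < n then f i else zero_mor C (Xs ! i) W)"
      by auto
    have fp: "f n \<cdot> \<pi> n \<in> mor C S W" using Comp_closed[OF S Xi[OF n] W] io[OF n] f[OF n] by blast
    have "(p \<oplus>\<^bsub>Hom C S W\<^esub> f n \<cdot> \<pi> n) \<cdot> \<iota> i = (if i < Suc n then f i else zero_mor C (Xs ! i) W)"
      if i: "i < length Xs" for i
    proof -
      interpret Xi: abelian_group "Hom C (Xs ! i) W" using Hom_group Xi[OF i] W by blast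
      have "(p \<oplus>\<^bsub>Hom C S W\<^esub> f n \<cdot> \<pi> n) \<cdot> \<iota> i = p \<cdot> \<iota> i \<oplus>\<^bsub>Hom C (Xs ! i) W\<^esub> f n \<cdot> (\<pi> n \<cdot> \<iota> i)"
        using Comp_add_left[OF Xi[OF i] S W _ p(1) fp] Comp_assoc[OF Xi[OF i] S Xi[OF n] W] io[OF i] io[OF n] f[OF n]
        by auto
      then show ?thesis
        using p(2)[OF i] d[OF n i] f[OF i] Comp_Ident_right[OF Xi[OF n] W f[OF n]] Xi.l_zero[OF f[OF i]]
          Xi.r_zero[OF f[OF i]] Comp_zero_right[OF Xi[OF i] Xi[OF n] W f[OF n]] Xi.r_zero[OF Xi.zero_closed]
        by (cases "i = n") (simp_all add: less_Suc_eq split: if_splits)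
    qed
    then show ?case using W.a_closed[OF p(1) fp] by blast
  qed
  then obtain p where p: "p \<in> mor C S W"
    "\<And>i. i < length Xs \<Longrightarrow> p \<cdot> \<iota> i = (if i < length Xs then f i else zero_mor C (Xs ! i) W)"
    by blast
  have "\<forall>i<length Xs. \<exists>x\<in>mor C (Xs ! i) S. p \<cdot> x = f i"
    using p(2) io1 by (metis (no_types, lifting))
  then show ?thesis using p(1) by blast
qed

text \<open>A right approximation of \<open>Y\<close> by copies of \<open>T\<close>: one copy for
  each member of a spanning list of Hom(T, Y), mapped to \<open>Y\<close> by that member. Linear
  combinations lift term by term.\<close>

lemma direct_sum_factor_span:
  assumes T: "T \<in> Ob C" and Y: "Y \<in> Ob C" and B: "set bs \<subseteq> mor C T Y"
    and span: "\<And>x. x \<in> mor C T Y \<Longrightarrow> \<exists>c. x = (\<Oplus>\<^bsub>Hom C T Y\<^esub>b\<in>set bs. c b \<odot>\<^bsub>Hom C T Y\<^esub> b)"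
    and ds: "direct_sum C S (replicate (length bs) T)"
  shows "\<exists>p\<in>mor C S Y. \<forall>v\<in>mor C T Y. \<exists>v'\<in>mor C T S. v = p \<cdot> v'"
proof -
  have S: "S \<in> Ob C" using ds unfolding direct_sum_def by auto
  obtain p where p: "p \<in> mor C S Y" "\<And>i. i < length bs \<Longrightarrow> \<exists>x\<in>mor C T S. p \<cdot> x = bs ! i"
    using direct_sum_copair[OF ds Y, of "\<lambda>i. bs ! i"] B by fastforce
  interpret TY: module ground_ring "Hom C T Y" using Hom_module T Y by blast
  interpret TS: module ground_ring "Hom C T S" using Hom_module T S by blast
  have cg: "c \<in> carrier ground_ring" for c by (simp add: ground_ring_def)
  have "\<exists>v'\<in>mor C T S. v = p \<cdot> v'" if v: "v \<in> mor C T Y" for v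
  proof -
    obtain c where c: "v = (\<Oplus>\<^bsub>Hom C T Y\<^esub>b\<in>set bs. c b \<odot>\<^bsub>Hom C T Y\<^esub> b)" using span[OF v] by blast
    show ?thesis unfolding c
    proof (rule TY.finsum_induct_closed[where P = "\<lambda>v. \<exists>v'\<in>mor C T S. v = p \<cdot> v'"])
      show "\<exists>v'\<in>mor C T S. zero_mor C T Y = p \<cdot> v'"
        using Comp_zero_right[OF T S Y p(1)] zero_mor_closed[OF T S] by metis
      show "\<exists>v'\<in>mor C T S. x \<oplus>\<^bsub>Hom C T Y\<^esub> y = p \<cdot> v'"
        if "\<exists>v'\<in>mor C T S. x = p \<cdot> v'" "\<exists>v'\<in>mor C T S. y = p \<cdot> v'" for x y
        using that Comp_add_right[OF T S Y _ _ p(1)] TS.a_closed by metis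
      fix b assume b: "b \<in> set bs"
      then obtain x where "x \<in> mor C T S" "p \<cdot> x = b" using p(2) by (auto simp: in_set_conv_nth)
      then have "c b \<odot>\<^bsub>Hom C T Y\<^esub> b = p \<cdot> (c b \<odot>\<^bsub>Hom C T S\<^esub> x)" "c b \<odot>\<^bsub>Hom C T S\<^esub> x \<in> mor C T S"
        using Comp_smult_right[OF T S Y _ p(1)] cg by auto
      moreover have "c b \<odot>\<^bsub>Hom C T Y\<^esub> b \<in> mor C T Y" using b B cg by auto
      ultimately show "c b \<odot>\<^bsub>Hom C T Y\<^esub> b \<in> mor C T Y \<and> (\<exists>v'\<in>mor C T S. c b \<odot>\<^bsub>Hom C T Y\<^esub> b = p \<cdot> v')"
        by blast
    qed
  qed
  with p(1) show ?thesis by blast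
qed

text \<open>Maps out of an object of add T are detected by \<open>T\<close>: extend \<open>f\<close>
  along the projection of a power of \<open>T\<close> onto its summand \<open>N\<close>, test there
  on the copies of \<open>T\<close>, and restrict back.\<close>

lemma add_closure_zero:
  assumes N: "N \<in> add_closure C T" and W: "W \<in> Ob C" and T: "T \<in> Ob C" and f: "f \<in> mor C N W"
    and z: "\<And>x. x \<in> mor C T N \<Longrightarrow> f \<cdot> x = zero_mor C T W"
  shows "f = zero_mor C N W"
proof -
  obtain n S Y where S: "direct_sum C S (replicate n T)" and S2: "direct_sum C S [N, Y]"
    using N unfolding add_closure_def by blast
  from S2 have SO: "S \<in> Ob C" and NO: "N \<in> Ob C" unfolding direct_sum_def by auto
  obtain \<iota> \<pi> where i: "\<And>i. i < length [N, Y] \<Longrightarrow> \<iota> i \<in> mor C ([N, Y] ! i) S"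
      "\<And>i. i < length [N, Y] \<Longrightarrow> \<pi> i \<in> mor C S ([N, Y] ! i)"
    and d: "\<And>i j. \<lbrakk>i < length [N, Y]; j < length [N, Y]\<rbrakk> \<Longrightarrow>
      \<pi> i \<cdot> \<iota> j = (if i = j then Ident C ([N, Y] ! i) else zero_mor C ([N, Y] ! j) ([N, Y] ! i))"
    by (rule direct_sumE[OF S2]) blast
  have ip: "\<iota> (0::nat) \<in> mor C N S" "\<pi> 0 \<in> mor C S N" "\<pi> 0 \<cdot> \<iota> 0 = Ident C N"
    using i(1)[of 0] i(2)[of 0] d[of 0 0] by simp_all
  have "f \<cdot> \<pi> 0 = zero_mor C S W"
  proof (rule direct_sum_zero_right[OF S W])
    show "f \<cdot> \<pi> 0 \<in> mor C S W" using Comp_closed[OF SO NO W ip(2) f] .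
    fix i x assume "i < length (replicate n T)" "x \<in> mor C (replicate n T ! i) S"
    then have "x \<in> mor C T S" "replicate n T ! i = T" by auto
    then show "f \<cdot> \<pi> 0 \<cdot> x = zero_mor C (replicate n T ! i) W"
      using Comp_assoc[OF T SO NO W _ ip(2) f] z Comp_closed[OF T SO NO _ ip(2)] by auto
  qed
  then have "f \<cdot> \<pi> 0 \<cdot> \<iota> 0 = zero_mor C N W" using Comp_zero_left[OF NO SO W ip(1)] by simp
  then show ?thesis using Comp_assoc[OF NO SO NO W ip(1,2) f] ip(3) Comp_Ident_right[OF NO W f] by simp
qed

lemma add_closure_self:
  assumes T: "T \<in> Ob C" and Z: "zero_obj C Z"
  shows "T \<in> add_closure C T"
proof -
  have ZO: "Z \<in> Ob C" using Z unfolding zero_obj_def by blast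
  interpret abelian_group "Hom C T T" using Hom_group T by blast
  have iz: "Ident C Z = zero_mor C Z Z"
    using Z Ident_closed[OF ZO] unfolding zero_obj_def by blast
  note I = Ident_closed[OF T] and II = Comp_Ident_left[OF T T Ident_closed[OF T]]
  have s1: "Ident C T = (\<Oplus>\<^bsub>Hom C T T\<^esub>i\<in>{..<Suc 0}. Ident C T \<cdot> Ident C T)"
    using I II by (simp add: lessThan_Suc finsum_insert)
  have "direct_sum C T (replicate 1 T)"
    unfolding direct_sum_def
  proof (intro conjI exI[of _ "\<lambda>_. Ident C T"])
    show "Ident C T = (\<Oplus>\<^bsub>Hom C T T\<^esub>i\<in>{..<length (replicate 1 T)}. Ident C T \<cdot> Ident C T)"
      using s1 by simp
  qed (use T I II in auto)
  moreover have "direct_sum C T [T, Z]"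
  proof -
    let ?i = "\<lambda>i::nat. if i = 0 then Ident C T else zero_mor C Z T"
    let ?p = "\<lambda>i::nat. if i = 0 then Ident C T else zero_mor C T Z"
    have z: "zero_mor C Z T \<in> mor C Z T" "zero_mor C T Z \<in> mor C T Z"
      "zero_mor C Z T \<cdot> zero_mor C T Z = zero_mor C T T"
      "zero_mor C T Z \<cdot> zero_mor C Z T = zero_mor C Z Z"
      "Ident C T \<cdot> zero_mor C Z T = zero_mor C Z T"
      "zero_mor C T Z \<cdot> Ident C T = zero_mor C T Z"
      using zero_mor_closed[OF ZO T] zero_mor_closed[OF T ZO] Comp_zero_right[OF ZO T T I]
        Comp_zero_left[OF T T ZO I] Comp_zero_left[OF ZO T ZO zero_mor_closed[OF ZO T]]
        Comp_zero_left[OF T ZO T zero_mor_closed[OF T ZO]] by simp_all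
    have "{..<length [T, Z]} = {0, 1}" by auto
    moreover have "(\<Oplus>\<^bsub>Hom C T T\<^esub>i\<in>{0::nat, 1}. ?i i \<cdot> ?p i) = Ident C T"
      using I II z by (simp add: finsum_insert)
    ultimately have "Ident C T = (\<Oplus>\<^bsub>Hom C T T\<^esub>i\<in>{..<length [T, Z]}. ?i i \<cdot> ?p i)" by simp
    moreover have "?i i \<in> mor C ([T, Z] ! i) T \<and> ?p i \<in> mor C T ([T, Z] ! i)" if "i < length [T, Z]" for i
      using that I z by (auto simp: less_Suc_eq)
    moreover have "?p i \<cdot> ?i j = (if i = j then Ident C ([T, Z] ! i) else zero_mor C ([T, Z] ! j) ([T, Z] ! i))"
      if "i < length [T, Z]" "j < length [T, Z]" for i j
      using that II z iz by (auto simp: less_Suc_eq)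
    ultimately show ?thesis
      using T ZO by (intro direct_sumI[of T "[T, Z]" ?i ?p]) simp_all
  qed
  ultimately show ?thesis unfolding add_closure_def by blast
qed

end

section \<open>Triangulated categories\<close>

context triangulated_category
begin

lemma zero_obj_exists: obtains Z where "zero_obj C Z" "Z \<in> Ob C"
proof -
  obtain S where S: "direct_sum C S []" using direct_sums[of "[]"] by auto
  obtain \<iota> \<pi> where SO: "S \<in> Ob C" and i: "Ident C S = (\<Oplus>\<^bsub>Hom C S S\<^esub>i\<in>{..<length ([]::'o list)}. \<iota> i \<cdot> \<pi> i)"
    by (rule direct_sumE[OF S]) blast
  interpret abelian_group "Hom C S S" using Hom_group SO by blast
  have "Ident C S = zero_mor C S S" using i by simp
  from that[OF zero_objI[OF SO this] SO] show thesis .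
qed

lemma Shift_mor_closed: "\<lbrakk>X \<in> Ob C; Y \<in> Ob C; f \<in> mor C X Y\<rbrakk> \<Longrightarrow> Shift_mor C f \<in> mor C (Shift C X) (Shift C Y)"
  using Shift_linear_iso[of X Y] by (auto simp: linear_isos_def linear_maps_def)

lemma Shift_mor_add:
  "\<lbrakk>X \<in> Ob C; Y \<in> Ob C; f \<in> mor C X Y; g \<in> mor C X Y\<rbrakk>
    \<Longrightarrow> Shift_mor C (f \<oplus>\<^bsub>Hom C X Y\<^esub> g) = Shift_mor C f \<oplus>\<^bsub>Hom C (Shift C X) (Shift C Y)\<^esub> Shift_mor C g"
  using Shift_linear_iso[of X Y] by (auto simp: linear_isos_def linear_maps_def)

lemma Shift_mor_smult:
  "\<lbrakk>X \<in> Ob C; Y \<in> Ob C; f \<in> mor C X Y\<rbrakk>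
    \<Longrightarrow> Shift_mor C (c \<odot>\<^bsub>Hom C X Y\<^esub> f) = c \<odot>\<^bsub>Hom C (Shift C X) (Shift C Y)\<^esub> Shift_mor C f"
  using Shift_linear_iso[of X Y] by (auto simp: linear_isos_def linear_maps_def)

lemma Shift_mor_eq_iff:
  "\<lbrakk>X \<in> Ob C; Y \<in> Ob C; f \<in> mor C X Y; g \<in> mor C X Y\<rbrakk> \<Longrightarrow> Shift_mor C f = Shift_mor C g \<longleftrightarrow> f = g"
  using Shift_linear_iso[of X Y] by (auto simp: linear_isos_def bij_betw_def dest: inj_onD)

lemma Shift_mor_surj:
  assumes "X \<in> Ob C" "Y \<in> Ob C" "g \<in> mor C (Shift C X) (Shift C Y)"
  obtains f where "f \<in> mor C X Y" "g = Shift_mor C f"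
  using Shift_linear_iso[of X Y] assms by (auto simp: linear_isos_def bij_betw_def)

lemma Shift_mor_zero:
  assumes "X \<in> Ob C" "Y \<in> Ob C"
  shows "Shift_mor C (zero_mor C X Y) = zero_mor C (Shift C X) (Shift C Y)"
  by (rule additive_zero[of "Hom C X Y" "Hom C (Shift C X) (Shift C Y)" "Shift_mor C"])
    (intro Pi_I Hom_group Shift_closed Shift_mor_closed Shift_mor_add assms | assumption)+

lemma Shift_mor_minus:
  assumes "X \<in> Ob C" "Y \<in> Ob C" "f \<in> mor C X Y"
  shows "Shift_mor C (\<ominus>\<^bsub>Hom C X Y\<^esub> f) = \<ominus>\<^bsub>Hom C (Shift C X) (Shift C Y)\<^esub> Shift_mor C f"
  by (rule additive_minus[of "Hom C X Y" "Hom C (Shift C X) (Shift C Y)" "Shift_mor C"])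
    (intro Pi_I Hom_group Shift_closed Shift_mor_closed Shift_mor_add assms | assumption)+

lemma Shift_mor_eq_zero:
  assumes "X \<in> Ob C" "Y \<in> Ob C" "f \<in> mor C X Y"
    "Shift_mor C f = zero_mor C (Shift C X) (Shift C Y)"
  shows "f = zero_mor C X Y"
  using Shift_mor_eq_iff[OF assms(1-3) zero_mor_closed[OF assms(1,2)]] Shift_mor_zero[OF assms(1,2)] assms(4)
  by simp

lemma zero_obj_Shift:
  assumes "zero_obj C Z"
  shows "zero_obj C (Shift C Z)"
proof -
  have Z: "Z \<in> Ob C" using assms unfolding zero_obj_def by blast
  have "Ident C Z = zero_mor C Z Z" using assms Ident_closed[OF Z] unfolding zero_obj_def by blast
  then have "Ident C (Shift C Z) = zero_mor C (Shift C Z) (Shift C Z)"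
    using Shift_Ident[OF Z] Shift_mor_zero[OF Z Z] by simp
  then show ?thesis by (rule zero_objI[OF Shift_closed[OF Z]])
qed

lemma DistinguishedD:
  assumes "(X, Y, Z, f, g, h) \<in> Distinguished C"
  shows "X \<in> Ob C" "Y \<in> Ob C" "Z \<in> Ob C" "f \<in> mor C X Y" "g \<in> mor C Y Z" "h \<in> mor C Z (Shift C X)"
  using Distinguished_shape[OF assms] by simp_all

lemma rotate_triangle:
  assumes "(X, Y, Z, f, g, h) \<in> Distinguished C"
  shows "(Y, Z, Shift C X, g, h, \<ominus>\<^bsub>Hom C (Shift C X) (Shift C Y)\<^esub> Shift_mor C f) \<in> Distinguished C"
  using TR2[OF Distinguished_shape[OF assms]] assms by blast

text \<open>TR3 maps the trivial triangle on \<open>X\<close> to the given one, with components the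
  identity and \<open>f\<close>. The third component starts at a zero object, and
  \<open>g \<cdot> f\<close> factors through it.\<close>

lemma triangle_comp_zero:
  assumes t: "(X, Y, Z, f, g, h) \<in> Distinguished C"
  shows "g \<cdot> f = zero_mor C X Z"
proof -
  note d = DistinguishedD[OF t]
  obtain Z0 where Z0: "zero_obj C Z0" "Z0 \<in> Ob C" by (rule zero_obj_exists)
  have "f \<cdot> Ident C X = f \<cdot> Ident C X" ..
  from TR3[OF TR1_Ident[OF d(1) Z0(1)] t Ident_closed[OF d(1)] d(4) this]
  obtain w where w: "w \<in> mor C Z0 Z" "w \<cdot> zero_mor C X Z0 = g \<cdot> f" by auto
  then show ?thesis using Comp_zero_right[OF d(1) Z0(2) d(3) w(1)] by simp
qed

lemma triangle_comp_zero2: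
  assumes t: "(X, Y, Z, f, g, h) \<in> Distinguished C"
  shows "h \<cdot> g = zero_mor C Y (Shift C X)"
  using triangle_comp_zero[OF rotate_triangle[OF t]] .

lemma triangle_comp_zero3:
  assumes t: "(X, Y, Z, f, g, h) \<in> Distinguished C"
  shows "Shift_mor C f \<cdot> h = zero_mor C Z (Shift C Y)"
proof -
  note d = DistinguishedD[OF t]
  note S = Shift_closed[OF d(1)] Shift_closed[OF d(2)] Shift_mor_closed[OF d(1,2,4)]
  have "(\<ominus>\<^bsub>Hom C (Shift C X) (Shift C Y)\<^esub> Shift_mor C f) \<cdot> h = zero_mor C Z (Shift C Y)"
    using triangle_comp_zero2[OF rotate_triangle[OF t]] .
  then show ?thesis
    using Comp_minus_left[OF d(3) S(1,2) d(6) S(3)] minus_zero_iff[OF d(3) S(2) Comp_closed[OF d(3) S(1,2) d(6) S(3)]]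
    by simp
qed

text \<open>Exactness of Hom(W, -) at \<open>Y\<close>. TR3 supplies only the third component of a
  map of triangles, so both triangles are rotated first; the missing component then is a map W[1] ->
  X[1], which the fully faithful shift brings down to \<open>k'\<close>. Each rotation introduces a
  sign, and the two signs cancel.\<close>

lemma weak_kernel:
  assumes t: "(X, Y, Z, f, g, h) \<in> Distinguished C" and W: "W \<in> Ob C" and k: "k \<in> mor C W Y"
    and gk: "g \<cdot> k = zero_mor C W Z"
  obtains k' where "k' \<in> mor C W X" "k = f \<cdot> k'"
proof -
  note d = DistinguishedD[OF t]
  note S = Shift_closed[OF d(1)] Shift_closed[OF d(2)] Shift_mor_closed[OF d(1,2,4)]
  note SW = Shift_closed[OF W]
  note sk = Shift_mor_closed[OF W d(2) k]
  obtain Z0 where Z0: "zero_obj C Z0" "Z0 \<in> Ob C" by (rule zero_obj_exists)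
  note z = zero_mor_closed[OF Z0(2) d(3)]
  have e: "zero_mor C Z0 Z \<cdot> zero_mor C W Z0 = g \<cdot> k"
    using gk Comp_zero_right[OF W Z0(2) d(3) z] by simp
  from TR3[OF rotate_triangle[OF TR1_Ident[OF W Z0(1)]] rotate_triangle[OF t] k z e]
  obtain w where w: "w \<in> mor C (Shift C W) (Shift C X)"
    "Shift_mor C k \<cdot> (\<ominus>\<^bsub>Hom C (Shift C W) (Shift C W)\<^esub> Shift_mor C (Ident C W))
      = (\<ominus>\<^bsub>Hom C (Shift C X) (Shift C Y)\<^esub> Shift_mor C f) \<cdot> w" by auto
  then obtain k' where k': "k' \<in> mor C W X" "w = Shift_mor C k'" using Shift_mor_surj[OF W d(1)] by blast
  note fw = Comp_closed[OF SW S(1,2) w(1) S(3)]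
  have "\<ominus>\<^bsub>Hom C (Shift C W) (Shift C Y)\<^esub> Shift_mor C k = \<ominus>\<^bsub>Hom C (Shift C W) (Shift C Y)\<^esub> (Shift_mor C f \<cdot> w)"
    using w(2) Shift_Ident[OF W] Comp_minus_right[OF SW SW S(2) Ident_closed[OF SW] sk]
      Comp_minus_left[OF SW S(1,2) w(1) S(3)] Comp_Ident_right[OF SW S(2) sk] by simp
  then have "Shift_mor C k = Shift_mor C f \<cdot> w"
    using abelian_group.minus_minus[OF Hom_group[OF SW S(2)]] sk fw by metis
  also have "\<dots> = Shift_mor C (f \<cdot> k')" using Shift_Comp[OF W d(1,2) k'(1) d(4)] k'(2) by simp
  finally have "k = f \<cdot> k'"
    using Shift_mor_eq_iff[OF W d(2) k Comp_closed[OF W d(1,2) k'(1) d(4)]] by simp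
  with k'(1) that show thesis by blast
qed

lemma weak_kernel2:
  assumes t: "(X, Y, Z, f, g, h) \<in> Distinguished C" and W: "W \<in> Ob C" and k: "k \<in> mor C W Z"
    and gk: "h \<cdot> k = zero_mor C W (Shift C X)"
  obtains k' where "k' \<in> mor C W Y" "k = g \<cdot> k'"
  using weak_kernel[OF rotate_triangle[OF t] W k gk] by blast

lemma weak_kernel3:
  assumes t: "(X, Y, Z, f, g, h) \<in> Distinguished C" and W: "W \<in> Ob C" and k: "k \<in> mor C W (Shift C X)"
    and gk: "Shift_mor C f \<cdot> k = zero_mor C W (Shift C Y)"
  obtains k' where "k' \<in> mor C W Z" "k = h \<cdot> k'"
proof -
  note d = DistinguishedD[OF t]
  note S = Shift_closed[OF d(1)] Shift_closed[OF d(2)] Shift_mor_closed[OF d(1,2,4)]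
  have "(\<ominus>\<^bsub>Hom C (Shift C X) (Shift C Y)\<^esub> Shift_mor C f) \<cdot> k = zero_mor C W (Shift C Y)"
    using gk Comp_minus_left[OF W S(1,2) k S(3)] minus_zero_iff[OF W S(2) zero_mor_closed[OF W S(2)]] by simp
  from weak_kernel2[OF rotate_triangle[OF t] W k this] that show thesis by blast
qed

lemma rotate_triangle3:
  assumes t: "(X, Y, Z, f, g, h) \<in> Distinguished C"
  shows "(Shift C X, Shift C Y, Shift C Z, \<ominus>\<^bsub>Hom C (Shift C X) (Shift C Y)\<^esub> Shift_mor C f,
    \<ominus>\<^bsub>Hom C (Shift C Y) (Shift C Z)\<^esub> Shift_mor C g, \<ominus>\<^bsub>Hom C (Shift C Z) (Shift C (Shift C X))\<^esub> Shift_mor C h)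
    \<in> Distinguished C"
  using rotate_triangle[OF rotate_triangle[OF rotate_triangle[OF t]]] .

text \<open>Exactness of Hom(W, -) for the shifted triangle. Three rotations put a sign on each of
  its morphisms; here and in \<open>weak_kernel_Shift3\<close> the sign is absorbed into
  \<open>k'\<close>.\<close>

lemma weak_kernel_Shift2:
  assumes t: "(X, Y, Z, f, g, h) \<in> Distinguished C" and W: "W \<in> Ob C" and k: "k \<in> mor C W (Shift C Z)"
    and gk: "Shift_mor C h \<cdot> k = zero_mor C W (Shift C (Shift C X))"
  obtains k' where "k' \<in> mor C W (Shift C Y)" "k = Shift_mor C g \<cdot> k'"
proof -
  note d = DistinguishedD[OF t]
  note S = Shift_closed[OF d(1)] Shift_closed[OF d(2)] Shift_closed[OF d(3)]
  note SS = Shift_closed[OF S(1)]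
  note sg = Shift_mor_closed[OF d(2,3,5)] and sh = Shift_mor_closed[OF d(3) S(1) d(6)]
  have "(\<ominus>\<^bsub>Hom C (Shift C Z) (Shift C (Shift C X))\<^esub> Shift_mor C h) \<cdot> k = zero_mor C W (Shift C (Shift C X))"
    using gk Comp_minus_left[OF W S(3) SS k sh] minus_zero_iff[OF W SS zero_mor_closed[OF W SS]] by simp
  from weak_kernel2[OF rotate_triangle3[OF t] W k this]
  obtain k' where k': "k' \<in> mor C W (Shift C Y)"
    "k = (\<ominus>\<^bsub>Hom C (Shift C Y) (Shift C Z)\<^esub> Shift_mor C g) \<cdot> k'" by blast
  then have "k = Shift_mor C g \<cdot> (\<ominus>\<^bsub>Hom C W (Shift C Y)\<^esub> k')"
    using Comp_minus_minus[OF W S(2,3) k'(1) sg] by simp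
  with mor_minus_closed[OF W S(2) k'(1)] that show thesis by blast
qed

lemma weak_kernel_Shift3:
  assumes t: "(X, Y, Z, f, g, h) \<in> Distinguished C" and W: "W \<in> Ob C"
    and k: "k \<in> mor C W (Shift C (Shift C X))"
    and gk: "Shift_mor C (Shift_mor C f) \<cdot> k = zero_mor C W (Shift C (Shift C Y))"
  obtains k' where "k' \<in> mor C W (Shift C Z)" "k = Shift_mor C h \<cdot> k'"
proof -
  note d = DistinguishedD[OF t]
  note S = Shift_closed[OF d(1)] Shift_closed[OF d(2)] Shift_closed[OF d(3)]
  note SS = Shift_closed[OF S(1)] Shift_closed[OF S(2)]
  note sf = Shift_mor_closed[OF d(1,2,4)] and sh = Shift_mor_closed[OF d(3) S(1) d(6)]
  note ssf = Shift_mor_closed[OF S(1,2) sf]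
  have "Shift_mor C (\<ominus>\<^bsub>Hom C (Shift C X) (Shift C Y)\<^esub> Shift_mor C f) \<cdot> k = zero_mor C W (Shift C (Shift C Y))"
    using gk Shift_mor_minus[OF S(1,2) sf] Comp_minus_left[OF W SS k ssf]
      minus_zero_iff[OF W SS(2) zero_mor_closed[OF W SS(2)]] by simp
  from weak_kernel3[OF rotate_triangle3[OF t] W k this]
  obtain k' where k': "k' \<in> mor C W (Shift C Z)"
    "k = (\<ominus>\<^bsub>Hom C (Shift C Z) (Shift C (Shift C X))\<^esub> Shift_mor C h) \<cdot> k'" by blast
  then have "k = Shift_mor C h \<cdot> (\<ominus>\<^bsub>Hom C W (Shift C Z)\<^esub> k')"
    using Comp_minus_minus[OF W S(3) SS(1) k'(1) sh] by simp
  with mor_minus_closed[OF W S(3) k'(1)] that show thesis by blast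
qed

text \<open>TR3 maps the given triangle to the one with terms 0, W, W. The latter is distinguished
  by rotating backwards: its rotation is the trivial triangle on \<open>W\<close>, because the shift
  of a zero object is again zero.\<close>

lemma weak_cokernel:
  assumes t: "(X, Y, Z, f, g, h) \<in> Distinguished C" and W: "W \<in> Ob C" and k: "k \<in> mor C Y W"
    and kf: "k \<cdot> f = zero_mor C X W"
  obtains k' where "k' \<in> mor C Z W" "k = k' \<cdot> g"
proof -
  note d = DistinguishedD[OF t]
  obtain Z0 where Z0: "zero_obj C Z0" "Z0 \<in> Ob C" by (rule zero_obj_exists)
  note SZ = Shift_closed[OF Z0(2)] and SW = Shift_closed[OF W]
  have shape: "triangle_shape C (Z0, W, W, zero_mor C Z0 W, Ident C W, zero_mor C W (Shift C Z0))"
    using Z0(2) W zero_mor_closed[OF Z0(2) W] Ident_closed[OF W] zero_mor_closed[OF W SZ] by simp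
  have "\<ominus>\<^bsub>Hom C (Shift C Z0) (Shift C W)\<^esub> Shift_mor C (zero_mor C Z0 W) = zero_mor C (Shift C Z0) (Shift C W)"
    using Shift_mor_zero[OF Z0(2) W] minus_zero_iff[OF SZ SW zero_mor_closed[OF SZ SW]] by simp
  then have t': "(Z0, W, W, zero_mor C Z0 W, Ident C W, zero_mor C W (Shift C Z0)) \<in> Distinguished C"
    using TR2[OF shape] TR1_Ident[OF W zero_obj_Shift[OF Z0(1)]] by simp
  have "k \<cdot> f = zero_mor C Z0 W \<cdot> zero_mor C X Z0"
    using kf Comp_zero_right[OF d(1) Z0(2) W zero_mor_closed[OF Z0(2) W]] by simp
  from TR3[OF t t' zero_mor_closed[OF d(1) Z0(2)] k this]
  obtain w where "w \<in> mor C Z W" "w \<cdot> g = Ident C W \<cdot> k" by auto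
  then show thesis using Comp_Ident_left[OF d(2) W k] that by metis
qed

end

section \<open>Serre duality as a natural pairing\<close>

definition (in triangulated_category) serre_pairing :: "('o \<Rightarrow> 'o \<Rightarrow> 'm \<Rightarrow> 'm \<Rightarrow> 'k) \<Rightarrow> bool" where
  "serre_pairing \<phi> \<longleftrightarrow>
    (\<forall>X\<in>Ob C. \<forall>Y\<in>Ob C.
       \<phi> X Y \<in> linear_isos (Hom C X Y) (dual_space (Hom C Y (Shift C (Shift C X))))) \<and>
    (\<forall>X\<in>Ob C. \<forall>X'\<in>Ob C. \<forall>Y\<in>Ob C. \<forall>Y'\<in>Ob C.
       \<forall>u\<in>mor C X' X. \<forall>f\<in>mor C X Y. \<forall>v\<in>mor C Y Y'. \<forall>g\<in>mor C Y' (Shift C (Shift C X')).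
         \<phi> X' Y' (v \<cdot> f \<cdot> u) g = \<phi> X Y f (Shift_mor C (Shift_mor C u) \<cdot> g \<cdot> v))"

lemma (in two_calabi_yau) serre_pairing_exists: "\<exists>\<phi>. serre_pairing \<phi>"
  unfolding serre_pairing_def by (rule calabi_yau)

context triangulated_category
begin

context
  fixes \<phi> X Y
  assumes \<phi>: "serre_pairing \<phi>" and XY: "X \<in> Ob C" "Y \<in> Ob C"
begin

lemma serre_iso: "\<phi> X Y \<in> linear_isos (Hom C X Y) (dual_space (Hom C Y (Shift C (Shift C X))))"
  using \<phi> XY unfolding serre_pairing_def by blast

lemma serre_bij: "bij_betw (\<phi> X Y) (mor C X Y) (carrier (dual_space (Hom C Y (Shift C (Shift C X)))))"
  using serre_iso unfolding linear_isos_def by blast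

lemma serre_dual: "x \<in> mor C X Y \<Longrightarrow> \<phi> X Y x \<in> carrier (dual_space (Hom C Y (Shift C (Shift C X))))"
  using bij_betwE[OF serre_bij] by blast

text \<open>Functionals in \<open>dual_space\<close> are 0 off the carrier, so agreement on the
  carrier is equality of functions and the bijectivity of \<open>\<phi> X Y\<close> applies.\<close>

lemma serre_eqI:
  assumes x: "x \<in> mor C X Y" and y: "y \<in> mor C X Y"
    and eq: "\<And>g. g \<in> mor C Y (Shift C (Shift C X)) \<Longrightarrow> \<phi> X Y x g = \<phi> X Y y g"
  shows "x = y"
proof -
  have "\<phi> X Y x = \<phi> X Y y"
  proof
    fix g
    show "\<phi> X Y x g = \<phi> X Y y g"
    proof (cases "g \<in> mor C Y (Shift C (Shift C X))")
      case False
      then show ?thesis using serre_dual[OF x] serre_dual[OF y] by (simp add: dual_space_def)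
    qed (rule eq)
  qed
  then show ?thesis using inj_onD[OF bij_betw_imp_inj_on[OF serre_bij]] x y by blast
qed

lemma serre_zero: "\<phi> X Y (zero_mor C X Y) g = 0"
proof -
  interpret module ground_ring "Hom C X Y" using Hom_module[OF XY] .
  have "zero_mor C X Y = 0 \<odot>\<^bsub>Hom C X Y\<^esub> zero_mor C X Y"
    using smult_r_null[of 0] by (simp add: ground_ring_def)
  moreover have "\<phi> X Y (0 \<odot>\<^bsub>Hom C X Y\<^esub> zero_mor C X Y)
      = 0 \<odot>\<^bsub>dual_space (Hom C Y (Shift C (Shift C X)))\<^esub> \<phi> X Y (zero_mor C X Y)"
    using serre_iso zero_mor_closed[OF XY] unfolding linear_isos_def linear_maps_def by blast
  ultimately have "\<phi> X Y (zero_mor C X Y) = (\<lambda>x. 0)" by (simp add: dual_space_def)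
  then show ?thesis by simp
qed

lemma serre_surj:
  "l \<in> carrier (dual_space (Hom C Y (Shift C (Shift C X)))) \<Longrightarrow> \<exists>x\<in>mor C X Y. \<phi> X Y x = l"
  using bij_betw_imp_surj_on[OF serre_bij] by (metis imageE)

end

text \<open>Bifunctoriality with an identity in the other slot. The later computations move one
  factor at a time from one side of the pairing to the other, here and with
  \<open>serre_natural_right\<close>.\<close>

lemma serre_natural_left:
  assumes \<phi>: "serre_pairing \<phi>"
    and a: "X \<in> Ob C" "X' \<in> Ob C" "Y \<in> Ob C" "u \<in> mor C X' X" "f \<in> mor C X Y"
      "g \<in> mor C Y (Shift C (Shift C X'))"
  shows "\<phi> X' Y (f \<cdot> u) g = \<phi> X Y f (Shift_mor C (Shift_mor C u) \<cdot> g)"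
proof -
  note S = Shift_closed[OF Shift_closed[OF a(1)]] Shift_closed[OF Shift_closed[OF a(2)]]
  have su: "Shift_mor C (Shift_mor C u) \<in> mor C (Shift C (Shift C X')) (Shift C (Shift C X))"
    using a Shift_mor_closed Shift_closed by simp
  have "\<phi> X' Y (Ident C Y \<cdot> f \<cdot> u) g = \<phi> X Y f (Shift_mor C (Shift_mor C u) \<cdot> g \<cdot> Ident C Y)"
    using \<phi> a Ident_closed[OF a(3)] unfolding serre_pairing_def by blast
  then show ?thesis
    using Comp_Ident_left[OF a(1,3,5)] Comp_Ident_right[OF a(3) S(1) Comp_closed[OF a(3) S(2,1) a(6) su]] by simp
qed

lemma serre_natural_right:
  assumes \<phi>: "serre_pairing \<phi>"
    and a: "X \<in> Ob C" "Y \<in> Ob C" "Y' \<in> Ob C" "v \<in> mor C Y Y'" "f \<in> mor C X Y"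
      "g \<in> mor C Y' (Shift C (Shift C X))"
  shows "\<phi> X Y' (v \<cdot> f) g = \<phi> X Y f (g \<cdot> v)"
proof -
  note S = Shift_closed[OF a(1)] Shift_closed[OF Shift_closed[OF a(1)]]
  have "\<phi> X Y' (v \<cdot> f \<cdot> Ident C X) g = \<phi> X Y f (Shift_mor C (Shift_mor C (Ident C X)) \<cdot> g \<cdot> v)"
    using \<phi> a Ident_closed[OF a(1)] unfolding serre_pairing_def by blast
  then show ?thesis
    using Comp_Ident_right[OF a(1,3) Comp_closed[OF a(1-3,5,4)]] Shift_Ident[OF a(1)] Shift_Ident[OF S(1)]
      Comp_Ident_left[OF a(3) S(2) a(6)] by simp
qed

end

section \<open>The obstruction cocycle of a relation\<close>

context two_calabi_yau
begin

text \<open>\<open>T\<close> lies in its own additive closure, and this closure is cut out by the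
  vanishing of Hom(-, T[1]).\<close>

lemma cluster_tilting_rigid:
  assumes "cluster_tilting C T"
  shows "mor C T (Shift C T) = {zero_mor C T (Shift C T)}"
proof -
  obtain Z where "zero_obj C Z" by (rule zero_obj_exists)
  then have "T \<in> add_closure C T" using add_closure_self assms unfolding cluster_tilting_def by blast
  then show ?thesis using assms unfolding cluster_tilting_def by blast
qed

text \<open>\<open>Z\<close> is the cone of an approximation p : S -> Y by a power \<open>S\<close>
  of \<open>T\<close>. As p is onto on Hom(T, -) and Hom(T, S[1]) = 0, also Hom(T, Z) = 0. With Z
  isomorphic to N[1], duality carries this to Hom(N, T[1]) = 0, so \<open>N\<close> is in add T. A
  map that kills all maps from \<open>T\<close> kills p and so factors through the cone. The
  isomorphism is passed on as \<open>\<kappa>\<close>, \<open>\<kappa>'\<close>, because the shift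
  is surjective only up to isomorphism.\<close>

lemma cluster_tilting_approximation:
  assumes T: "cluster_tilting C T" and Y: "Y \<in> Ob C"
  obtains N Z q \<kappa> \<kappa>' where "N \<in> add_closure C T" "N \<in> Ob C" "Z \<in> Ob C" "q \<in> mor C Y Z"
    "\<kappa> \<in> mor C (Shift C N) Z" "\<kappa>' \<in> mor C Z (Shift C N)" "\<kappa> \<cdot> \<kappa>' = Ident C Z"
    "\<And>W k. \<lbrakk>W \<in> Ob C; k \<in> mor C Y W; \<And>v. v \<in> mor C T Y \<Longrightarrow> k \<cdot> v = zero_mor C T W\<rbrakk>
      \<Longrightarrow> \<exists>k'\<in>mor C Z W. k = k' \<cdot> q"
proof -
  have TO: "T \<in> Ob C" using T unfolding cluster_tilting_def by blast
  note ST = Shift_closed[OF TO]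
  note rigid = cluster_tilting_rigid[OF T]
  obtain B where B: "finite B" "B \<subseteq> mor C T Y"
    "\<And>x. x \<in> mor C T Y \<Longrightarrow> \<exists>c. x = (\<Oplus>\<^bsub>Hom C T Y\<^esub>b\<in>B. c b \<odot>\<^bsub>Hom C T Y\<^esub> b)"
    using Hom_finite[OF TO Y] unfolding finite_dimensional_def by blast
  obtain bs where bs: "set bs = B" using B(1) finite_list by blast
  have "set (replicate (length bs) T) \<subseteq> Ob C" using TO by auto
  then obtain S where ds: "direct_sum C S (replicate (length bs) T)" using direct_sums by blast
  then have S: "S \<in> Ob C" unfolding direct_sum_def by blast
  note SS = Shift_closed[OF S]
  obtain p where p: "p \<in> mor C S Y" "\<And>v. v \<in> mor C T Y \<Longrightarrow> \<exists>v'\<in>mor C T S. v = p \<cdot> v'"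
    using direct_sum_factor_span[OF TO Y _ _ ds] B bs by blast
  have S_test: "k = zero_mor C S W"
    if "W \<in> Ob C" "k \<in> mor C S W" "\<And>x. x \<in> mor C T S \<Longrightarrow> k \<cdot> x = zero_mor C T W" for k W
    by (rule direct_sum_zero_right[OF ds that(1,2)]) (use that(3) in auto)
  \<comment> \<open>The identity of \<open>S\<close> is a sum of endomorphisms that factor through
    \<open>T\<close>, and Hom(T, T[1]) = 0.\<close>
  have Hom_SS: "mor C T (Shift C S) = {zero_mor C T (Shift C S)}"
  proof -
    obtain \<iota> \<pi> where io1: "\<And>i. i < length (replicate (length bs) T) \<Longrightarrow> \<iota> i \<in> mor C (replicate (length bs) T ! i) S"
      and io2: "\<And>i. i < length (replicate (length bs) T) \<Longrightarrow> \<pi> i \<in> mor C S (replicate (length bs) T ! i)"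
      and id: "Ident C S = (\<Oplus>\<^bsub>Hom C S S\<^esub>i\<in>{..<length (replicate (length bs) T)}. \<iota> i \<cdot> \<pi> i)"
      by (rule direct_sumE[OF ds]) blast
    have io: "\<iota> i \<in> mor C T S" "\<pi> i \<in> mor C S T" if "i < length bs" for i
      using io1[of i] io2[of i] that by auto
    have "k = zero_mor C T (Shift C S)" if k: "k \<in> mor C T (Shift C S)" for k
    proof -
      interpret abelian_group "Hom C S S" using Hom_group S by blast
      interpret T: abelian_group "Hom C T (Shift C S)" using Hom_group TO SS by blast
      have "Shift_mor C (Ident C S) \<cdot> k = zero_mor C T (Shift C S)" unfolding id
      proof (rule finsum_induct_closed[where P = "\<lambda>x. Shift_mor C x \<cdot> k = zero_mor C T (Shift C S)"])
        show "Shift_mor C (zero_mor C S S) \<cdot> k = zero_mor C T (Shift C S)"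
          using Shift_mor_zero[OF S S] Comp_zero_left[OF TO SS SS k] by simp
        show "Shift_mor C (x \<oplus>\<^bsub>Hom C S S\<^esub> y) \<cdot> k = zero_mor C T (Shift C S)"
          if "x \<in> mor C S S" "y \<in> mor C S S" "Shift_mor C x \<cdot> k = zero_mor C T (Shift C S)"
            "Shift_mor C y \<cdot> k = zero_mor C T (Shift C S)" for x y
          using Comp_add_left[OF TO SS SS k Shift_mor_closed[OF S S that(1)] Shift_mor_closed[OF S S that(2)]]
            Shift_mor_add[OF S S that(1,2)] that(3,4) by simp
        fix i assume "i \<in> {..<length (replicate (length bs) T)}"
        then have i: "i < length bs" by simp
        note sp = Shift_mor_closed[OF S TO io(2)[OF i]] and si = Shift_mor_closed[OF TO S io(1)[OF i]]
        have "Shift_mor C (\<pi> i) \<cdot> k = zero_mor C T (Shift C T)"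
          using Comp_closed[OF TO SS ST k sp] rigid by blast
        then have "Shift_mor C (\<iota> i) \<cdot> Shift_mor C (\<pi> i) \<cdot> k = zero_mor C T (Shift C S)"
          using Comp_assoc[OF TO SS ST SS k sp si] Comp_zero_right[OF TO ST SS si] by simp
        then show "\<iota> i \<cdot> \<pi> i \<in> mor C S S \<and> Shift_mor C (\<iota> i \<cdot> \<pi> i) \<cdot> k = zero_mor C T (Shift C S)"
          using Comp_closed[OF S TO S io(2)[OF i] io(1)[OF i]] Shift_Comp[OF S TO S io(2)[OF i] io(1)[OF i]] by simp
      qed
      then show ?thesis using Shift_Ident[OF S] Comp_Ident_left[OF TO SS k] by simp
    qed
    then show ?thesis using zero_mor_closed[OF TO SS] by blast
  qed
  obtain Z q w where t: "(S, Y, Z, p, q, w) \<in> Distinguished C" using TR1_ex[OF S Y p(1)] by blast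
  note d = DistinguishedD[OF t]
  obtain N \<kappa> \<kappa>' where N: "N \<in> Ob C" "\<kappa> \<in> mor C (Shift C N) Z" "\<kappa>' \<in> mor C Z (Shift C N)"
    "\<kappa>' \<cdot> \<kappa> = Ident C (Shift C N)" "\<kappa> \<cdot> \<kappa>' = Ident C Z"
    using Shift_ess_surj[OF d(3)] unfolding iso_obj_def iso_mor_def by blast
  note SN = Shift_closed[OF N(1)]
  \<comment> \<open>\<open>x\<close> lifts to \<open>Y\<close> because \<open>w \<cdot> x\<close>
    vanishes, then to \<open>S\<close> by the approximation, and q p = 0.\<close>
  have TZ: "x = zero_mor C T Z" if x: "x \<in> mor C T Z" for x
  proof -
    have "w \<cdot> x = zero_mor C T (Shift C S)" using Comp_closed[OF TO d(3) SS x d(6)] Hom_SS by blast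
    then obtain v where v: "v \<in> mor C T Y" "x = q \<cdot> v" using weak_kernel2[OF t TO x] by blast
    then obtain v' where v': "v' \<in> mor C T S" "v = p \<cdot> v'" using p(2) by blast
    have "q \<cdot> p \<cdot> v' = q \<cdot> (p \<cdot> v')" using Comp_assoc[OF TO S Y d(3) v'(1) d(4,5)] .
    then show ?thesis using v(2) v'(2) triangle_comp_zero[OF t] Comp_zero_left[OF TO S d(3) v'(1)] by simp
  qed
  have TSN: "x = zero_mor C T (Shift C N)" if x: "x \<in> mor C T (Shift C N)" for x
  proof -
    have "\<kappa>' \<cdot> \<kappa> \<cdot> x = \<kappa>' \<cdot> (\<kappa> \<cdot> x)" using Comp_assoc[OF TO SN d(3) SN x N(2,3)] .
    then show ?thesis
      using TZ[OF Comp_closed[OF TO SN d(3) x N(2)]] N(4) Comp_Ident_left[OF TO SN x] Comp_zero_right[OF TO d(3) SN N(3)]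
      by simp
  qed
  obtain \<phi> where \<phi>: "serre_pairing \<phi>" using serre_pairing_exists by blast
  note inj = serre_eqI[OF \<phi>] and phi0 = serre_zero[OF \<phi>] and surj = serre_surj[OF \<phi>]
    and natL = serre_natural_left[OF \<phi>] and natR = serre_natural_right[OF \<phi>]
  \<comment> \<open>The functional dual to \<open>x\<close> lives on Hom(T[1], N[2]), the shift of
    Hom(T, N[1]) = 0.\<close>
  have "x = zero_mor C N (Shift C T)" if x: "x \<in> mor C N (Shift C T)" for x
  proof (rule inj[OF N(1) ST x zero_mor_closed[OF N(1) ST]])
    fix g assume g: "g \<in> mor C (Shift C T) (Shift C (Shift C N))"
    obtain g' where g': "g' \<in> mor C T (Shift C N)" "g = Shift_mor C g'" using Shift_mor_surj[OF TO SN g] .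
    then have g0: "g = zero_mor C (Shift C T) (Shift C (Shift C N))"
      using TSN Shift_mor_zero[OF TO SN] by metis
    have "\<phi> N (Shift C T) x g = \<phi> N (Shift C T) x (g \<cdot> zero_mor C (Shift C T) (Shift C T))"
      using g0 Comp_zero_right[OF ST ST Shift_closed[OF SN] g] by simp
    also have "\<dots> = \<phi> N (Shift C T) (zero_mor C (Shift C T) (Shift C T) \<cdot> x) g"
      using natR[OF N(1) ST ST zero_mor_closed[OF ST ST] x g] by simp
    also have "\<dots> = \<phi> N (Shift C T) (zero_mor C N (Shift C T)) g"
      using Comp_zero_left[OF N(1) ST ST x] by simp
    finally show "\<phi> N (Shift C T) x g = \<phi> N (Shift C T) (zero_mor C N (Shift C T)) g" .
  qed
  then have "mor C N (Shift C T) = {zero_mor C N (Shift C T)}" using zero_mor_closed[OF N(1) ST] by blast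
  then have Nadd: "N \<in> add_closure C T" using T N(1) unfolding cluster_tilting_def by blast
  have fact: "\<exists>k'\<in>mor C Z W. k = k' \<cdot> q"
    if W: "W \<in> Ob C" and k: "k \<in> mor C Y W" and k0: "\<And>v. v \<in> mor C T Y \<Longrightarrow> k \<cdot> v = zero_mor C T W" for W k
  proof -
    have "k \<cdot> p = zero_mor C S W"
    proof (rule S_test[OF W Comp_closed[OF S Y W p(1) k]])
      fix x assume x: "x \<in> mor C T S"
      show "k \<cdot> p \<cdot> x = zero_mor C T W"
        using Comp_assoc[OF TO S Y W x p(1) k] k0[OF Comp_closed[OF TO S Y x p(1)]] by simp
    qed
    from weak_cokernel[OF t W k this] show ?thesis by blast
  qed
  show thesis by (rule that[OF Nadd N(1) d(3) d(5) N(2,3,5) fact])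
qed

text \<open>In the application \<open>e\<close> and \<open>d\<close> are the idempotents at the
  start and at the end of the arrow \<open>b\<close>, \<open>lam\<close> reads off the coefficient
  of \<open>d\<close>, and \<open>R\<close> is the radical of d\<Lambda>. \<open>exact\<close> says
  that the kernel of \<open>a\<close> on e\<Lambda> is b\<Lambda>; \<open>lam_ker\<close> puts the
  kernel of \<open>b\<close> on d\<Lambda> into \<open>R\<close>. In the conclusion,
  \<open>\<rho>\<close> is a map of right modules from \<open>R\<close> to
  \<Lambda>/a\<Lambda>.\<close>

lemma extension_obstruction:
  fixes lam :: "'m \<Rightarrow> 'k"
  assumes T: "cluster_tilting C T"
    and mors: "a \<in> mor C T T" "b \<in> mor C T T" "e \<in> mor C T T" "d \<in> mor C T T"
    and ee: "e \<cdot> e = e" and ae: "a \<cdot> e = a" and eb: "e \<cdot> b = b" and bd: "b \<cdot> d = b" and dd: "d \<cdot> d = d"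
    and ab: "a \<cdot> b = zero_mor C T T"
    and exact: "\<And>p. \<lbrakk>p \<in> mor C T T; e \<cdot> p = p; a \<cdot> p = zero_mor C T T\<rbrakk> \<Longrightarrow> \<exists>q\<in>mor C T T. p = b \<cdot> q"
    and lam_add: "\<And>f g. \<lbrakk>f \<in> mor C T T; g \<in> mor C T T\<rbrakk> \<Longrightarrow> lam (f \<oplus>\<^bsub>Hom C T T\<^esub> g) = lam f + lam g"
    and lam_smult: "\<And>f c. f \<in> mor C T T \<Longrightarrow> lam (c \<odot>\<^bsub>Hom C T T\<^esub> f) = c * lam f"
    and lam_b: "\<And>f. f \<in> mor C T T \<Longrightarrow> lam (f \<cdot> b) = 0"
    and lam_d: "\<And>f. f \<in> mor C T T \<Longrightarrow> lam (d \<cdot> f) = lam f"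
    and lam_Ident: "lam (Ident C T) \<noteq> 0"
    and lam_ker: "\<And>r. \<lbrakk>r \<in> mor C T T; d \<cdot> r = r; b \<cdot> r = zero_mor C T T\<rbrakk> \<Longrightarrow> lam r = 0"
    and R_def: "R = {r \<in> mor C T T. d \<cdot> r = r \<and> (\<forall>f\<in>mor C T T. lam (r \<cdot> f) = 0)}"
  obtains \<rho> where "\<And>r. r \<in> R \<Longrightarrow> \<rho> r \<in> mor C T T"
    "\<And>r x. \<lbrakk>r \<in> R; x \<in> mor C T T\<rbrakk> \<Longrightarrow> \<exists>q\<in>mor C T T. \<rho> (r \<cdot> x) = \<rho> r \<cdot> x \<oplus>\<^bsub>Hom C T T\<^esub> a \<cdot> q"
    "\<And>x. x \<in> mor C T T \<Longrightarrow>
      \<exists>r\<in>R. b \<cdot> r = zero_mor C T T \<and> \<not> (\<exists>q\<in>mor C T T. \<rho> r = x \<cdot> r \<oplus>\<^bsub>Hom C T T\<^esub> a \<cdot> q)"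
proof -
  let ?S = "Shift C" and ?s = "Shift_mor C" and ?A = "mor C T T"
  have TO: "T \<in> Ob C" using T unfolding cluster_tilting_def by blast
  note T1 = Shift_closed[OF TO]
  note T2 = Shift_closed[OF T1]
  note T3 = Shift_closed[OF T2]
  note sc = Shift_mor_closed
  note rigid = cluster_tilting_rigid[OF T]
  note IT = Ident_closed[OF TO]
  \<comment> \<open>The cone of \<open>b\<close> as an endomorphism of \<open>T\<close> would also
    contain the complement of \<open>V\<close> in \<open>T\<close>. The map induced by
    \<open>a\<close> vanishes there, so the injectivity in \<open>TX_inj\<close> could fail.\<close>
  obtain V p i where V: "V \<in> Ob C" and p: "p \<in> mor C T V" and i: "i \<in> mor C V T"
    and ip: "i \<cdot> p = e" and pi: "p \<cdot> i = Ident C V"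
    using split_idempotents[OF TO mors(3) ee] by blast
  note V1 = Shift_closed[OF V]
  note V2 = Shift_closed[OF V1]
  note V3 = Shift_closed[OF V2]
  define b0 where "b0 = p \<cdot> b"
  define a0 where "a0 = a \<cdot> i"
  have b0: "b0 \<in> mor C T V" unfolding b0_def by (rule Comp_closed[OF TO TO V mors(2) p])
  have a0: "a0 \<in> mor C V T" unfolding a0_def by (rule Comp_closed[OF V TO TO i mors(1)])
  have a0p: "a0 \<cdot> p = a" unfolding a0_def using Comp_assoc[OF TO V TO TO p i mors(1)] ip ae by simp
  have ib0: "i \<cdot> b0 = b" unfolding b0_def using Comp_assoc[OF TO TO V TO mors(2) p i] ip eb by simp
  have a0b0: "a0 \<cdot> b0 = zero_mor C T T"
    unfolding b0_def using Comp_assoc[OF TO TO V TO mors(2) p a0] a0p ab by simp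
  have exact0: "\<exists>q\<in>?A. x = b0 \<cdot> q" if x: "x \<in> mor C T V" and 0: "a0 \<cdot> x = zero_mor C T T" for x
  proof -
    note ix = Comp_closed[OF TO V TO x i]
    have "p \<cdot> i \<cdot> x = p \<cdot> (i \<cdot> x)" using Comp_assoc[OF TO V TO V x i p] .
    then have pix: "p \<cdot> (i \<cdot> x) = x" using pi Comp_Ident_left[OF TO V x] by simp
    have "e \<cdot> (i \<cdot> x) = i \<cdot> x" using Comp_assoc[OF TO TO V TO ix p i] pix ip by simp
    moreover have "a \<cdot> (i \<cdot> x) = zero_mor C T T" using Comp_assoc[OF TO V TO TO x i mors(1)] 0 a0_def by simp
    ultimately obtain q where q: "q \<in> ?A" "i \<cdot> x = b \<cdot> q" using exact[OF ix] by blast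
    then have "x = b0 \<cdot> q" using pix Comp_assoc[OF TO TO TO V q(1) mors(2) p] b0_def by simp
    with q(1) show ?thesis by blast
  qed
  obtain X g h where tX: "(T, V, X, b0, g, h) \<in> Distinguished C" using TR1_ex[OF TO V b0] by blast
  note X = DistinguishedD(3)[OF tX] and g = DistinguishedD(5)[OF tX] and h = DistinguishedD(6)[OF tX]
  note X1 = Shift_closed[OF X]
  note X2 = Shift_closed[OF X1]
  obtain a' where a': "a' \<in> mor C X T" "a0 = a' \<cdot> g" using weak_cokernel[OF tX TO a0 a0b0] .
  \<comment> \<open>By rigidity \<open>x\<close> comes from a map to \<open>V\<close>. There the
    kernel of \<open>a0\<close> is the image of \<open>b0\<close>, which dies in the cone.\<close>
  have TX_inj: "x = zero_mor C T X" if x: "x \<in> mor C T X" and 0: "a' \<cdot> x = zero_mor C T T" for x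
  proof -
    have "h \<cdot> x = zero_mor C T (?S T)" using Comp_closed[OF TO X T1 x h] rigid by blast
    then obtain m where m: "m \<in> mor C T V" "x = g \<cdot> m" using weak_kernel2[OF tX TO x] by blast
    have "a0 \<cdot> m = zero_mor C T T" using Comp_assoc[OF TO V X TO m(1) g a'(1)] m(2) 0 a'(2) by simp
    then obtain q where q: "q \<in> ?A" "m = b0 \<cdot> q" using exact0[OF m(1)] by blast
    then show ?thesis
      using Comp_assoc[OF TO TO V X q(1) b0 g] m(2) triangle_comp_zero[OF tX] Comp_zero_left[OF TO TO X q(1)] by simp
  qed
  obtain Y u v where tY: "(X, T, Y, a', u, v) \<in> Distinguished C" using TR1_ex[OF X TO a'(1)] by blast
  note Y = DistinguishedD(3)[OF tY] and u = DistinguishedD(5)[OF tY] and v = DistinguishedD(6)[OF tY]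
  note Y1 = Shift_closed[OF Y]
  have ua: "u \<cdot> a = zero_mor C T Y"
  proof -
    have "a = a' \<cdot> (g \<cdot> p)" using a0p a'(2) Comp_assoc[OF TO V X TO p g a'(1)] by simp
    then show ?thesis
      using Comp_assoc[OF TO X TO Y Comp_closed[OF TO V X p g] a'(1) u] triangle_comp_zero[OF tY]
        Comp_zero_left[OF TO X Y Comp_closed[OF TO V X p g]] by simp
  qed
  obtain \<phi> where \<phi>: "serre_pairing \<phi>" using serre_pairing_exists by blast
  note inj = serre_eqI[OF \<phi>] and phi0 = serre_zero[OF \<phi>] and surj = serre_surj[OF \<phi>]
    and natL = serre_natural_left[OF \<phi>] and natR = serre_natural_right[OF \<phi>]
  \<comment> \<open>\<open>t\<close> is the morphism \<open>T \<rightarrow> T[2]\<close> dual to \<open>lam\<close>\<close>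
  have s3_surj: "\<exists>f\<in>?A. x = ?s (?s (?s f))" if x: "x \<in> mor C (?S (?S (?S T))) (?S (?S (?S T)))" for x
  proof -
    obtain x2 where x2: "x2 \<in> mor C (?S (?S T)) (?S (?S T))" "x = ?s x2" using Shift_mor_surj[OF T2 T2 x] .
    obtain x1 where x1: "x1 \<in> mor C (?S T) (?S T)" "x2 = ?s x1" using Shift_mor_surj[OF T1 T1 x2(1)] .
    obtain x0 where "x0 \<in> ?A" "x1 = ?s x0" using Shift_mor_surj[OF TO TO x1(1)] .
    with x2 x1 show ?thesis by blast
  qed
  have s1c: "?s f \<in> mor C (?S T) (?S T)" if "f \<in> ?A" for f by (rule sc[OF TO TO that])
  have s2c: "?s (?s f) \<in> mor C (?S (?S T)) (?S (?S T))" if "f \<in> ?A" for f by (rule sc[OF T1 T1 s1c[OF that]])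
  have s3c: "?s (?s (?s f)) \<in> mor C (?S (?S (?S T))) (?S (?S (?S T)))" if "f \<in> ?A" for f
    by (rule sc[OF T2 T2 s2c[OF that]])
  have s3_inj: "f = f'" if "f \<in> ?A" "f' \<in> ?A" "?s (?s (?s f)) = ?s (?s (?s f'))" for f f'
    using that(3) Shift_mor_eq_iff[OF T2 T2 s2c[OF that(1)] s2c[OF that(2)]]
      Shift_mor_eq_iff[OF T1 T1 s1c[OF that(1)] s1c[OF that(2)]] Shift_mor_eq_iff[OF TO TO that(1,2)] by simp
  have s3_comp: "?s (?s (?s (f \<cdot> f'))) = ?s (?s (?s f)) \<cdot> ?s (?s (?s f'))" if "f \<in> ?A" "f' \<in> ?A" for f f'
    using Shift_Comp[OF TO TO TO that(2,1)] Shift_Comp[OF T1 T1 T1 s1c[OF that(2)] s1c[OF that(1)]]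
      Shift_Comp[OF T2 T2 T2 s2c[OF that(2)] s2c[OF that(1)]] by simp
  \<comment> \<open>Duality is applied at (T[1], T[3]) instead of (T, T[2]): \<phi> is not assumed
    compatible with the shift, and the pairing on \<open>X\<close> computed at the end arrives at
    T[1]. Hence \<open>lam\<close> is moved to End(T[3]) by three shifts. The value 0 off the
    carrier is the normalisation of \<open>dual_space\<close>.\<close>
  define l where "l x = (if x \<in> mor C (?S (?S (?S T))) (?S (?S (?S T)))
    then lam (SOME f. f \<in> ?A \<and> x = ?s (?s (?s f))) else 0)" for x
  have l_s3: "l (?s (?s (?s f))) = lam f" if f: "f \<in> ?A" for f
  proof -
    have "(SOME f'. f' \<in> ?A \<and> ?s (?s (?s f)) = ?s (?s (?s f'))) = f"
    proof (rule some_equality)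
      show "f' = f" if "f' \<in> ?A \<and> ?s (?s (?s f)) = ?s (?s (?s f'))" for f'
        by (rule s3_inj[OF _ f]) (use that in simp_all)
    qed (use f in blast)
    then show ?thesis using s3c[OF f] unfolding l_def by simp
  qed
  have "l \<in> carrier (dual_space (Hom C (?S (?S (?S T))) (?S (?S (?S T)))))"
  proof -
    have "l (x \<oplus>\<^bsub>Hom C (?S (?S (?S T))) (?S (?S (?S T)))\<^esub> y) = l x + l y"
      if xy: "x \<in> mor C (?S (?S (?S T))) (?S (?S (?S T)))" "y \<in> mor C (?S (?S (?S T))) (?S (?S (?S T)))" for x y
    proof -
      obtain f f' where f: "f \<in> ?A" "f' \<in> ?A" "x = ?s (?s (?s f))" "y = ?s (?s (?s f'))"
        using s3_surj xy by blast
      have "?s (?s (?s (f \<oplus>\<^bsub>Hom C T T\<^esub> f'))) = x \<oplus>\<^bsub>Hom C (?S (?S (?S T))) (?S (?S (?S T)))\<^esub> y"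
        using f Shift_mor_add[OF TO TO f(1,2)] Shift_mor_add[OF T1 T1 s1c[OF f(1)] s1c[OF f(2)]]
          Shift_mor_add[OF T2 T2 s2c[OF f(1)] s2c[OF f(2)]] by simp
      then show ?thesis
        using l_s3[OF mor_add_closed[OF TO TO f(1,2)]] l_s3[OF f(1)] l_s3[OF f(2)] lam_add[OF f(1,2)] f(3,4) by simp
    qed
    moreover have "l (c \<odot>\<^bsub>Hom C (?S (?S (?S T))) (?S (?S (?S T)))\<^esub> x) = c * l x"
      if x: "x \<in> mor C (?S (?S (?S T))) (?S (?S (?S T)))" for x c
    proof -
      obtain f where f: "f \<in> ?A" "x = ?s (?s (?s f))" using s3_surj x by blast
      interpret m: module ground_ring "Hom C T T" using Hom_module TO by blast
      have cf: "c \<odot>\<^bsub>Hom C T T\<^esub> f \<in> ?A" using m.smult_closed f(1) by (simp add: ground_ring_def)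
      have "?s (?s (?s (c \<odot>\<^bsub>Hom C T T\<^esub> f))) = c \<odot>\<^bsub>Hom C (?S (?S (?S T))) (?S (?S (?S T)))\<^esub> x"
        using f Shift_mor_smult[OF TO TO f(1)] Shift_mor_smult[OF T1 T1 s1c[OF f(1)]]
          Shift_mor_smult[OF T2 T2 s2c[OF f(1)]] by simp
      then show ?thesis using l_s3[OF cf] l_s3[OF f(1)] lam_smult[OF f(1)] f(2) by simp
    qed
    moreover have "l x = 0" if "x \<notin> mor C (?S (?S (?S T))) (?S (?S (?S T)))" for x using that unfolding l_def by simp
    ultimately show ?thesis unfolding dual_space_def by simp
  qed
  then obtain t1 where t1: "t1 \<in> mor C (?S T) (?S (?S (?S T)))" "\<phi> (?S T) (?S (?S (?S T))) t1 = l"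
    using surj[OF T1 T3] by blast
  obtain t where t: "t \<in> mor C T (?S (?S T))" "t1 = ?s t" using Shift_mor_surj[OF TO T2 t1(1)] .
  have phi_t1: "\<phi> (?S T) (?S (?S (?S T))) t1 (?s (?s (?s f))) = lam f" if "f \<in> ?A" for f
    using t1(2) l_s3[OF that] by simp
  have phi_tr: "\<phi> (?S T) (?S (?S (?S T))) (?s (t \<cdot> r)) (?s (?s (?s f))) = lam (r \<cdot> f)"
    if r: "r \<in> ?A" and f: "f \<in> ?A" for r f
    using Shift_Comp[OF TO TO T2 r t(1)] t(2) natL[OF T1 T1 T3 s1c[OF r] t1(1) s3c[OF f]]
      s3_comp[OF r f] phi_t1[OF Comp_closed[OF TO TO TO f r]] by simp
  \<comment> \<open>By duality \<open>t \<cdot> r\<close> is determined by the functional sending f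
    to \<open>lam (r \<cdot> f)\<close>.\<close>
  have t_eq: "t \<cdot> r = t \<cdot> r'" if r: "r \<in> ?A" "r' \<in> ?A" and eq: "\<And>f. f \<in> ?A \<Longrightarrow> lam (r \<cdot> f) = lam (r' \<cdot> f)" for r r'
  proof -
    note c = Comp_closed[OF TO TO T2 r(1) t(1)] Comp_closed[OF TO TO T2 r(2) t(1)]
    have "?s (t \<cdot> r) = ?s (t \<cdot> r')"
    proof (rule inj[OF T1 T3 sc[OF TO T2 c(1)] sc[OF TO T2 c(2)]])
      fix x assume "x \<in> mor C (?S (?S (?S T))) (?S (?S (?S T)))"
      then obtain f where f: "f \<in> ?A" "x = ?s (?s (?s f))" using s3_surj by blast
      then show "\<phi> (?S T) (?S (?S (?S T))) (?s (t \<cdot> r)) x = \<phi> (?S T) (?S (?S (?S T))) (?s (t \<cdot> r')) x"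
        using phi_tr[OF r(1) f(1)] phi_tr[OF r(2) f(1)] eq[OF f(1)] by simp
    qed
    then show ?thesis using Shift_mor_eq_iff[OF TO T2 c] by simp
  qed
  have td: "t \<cdot> d = t"
  proof -
    have "t \<cdot> d = t \<cdot> Ident C T"
      by (rule t_eq[OF mors(4) IT]) (use lam_d Comp_Ident_left[OF TO TO] in simp)
    then show ?thesis using Comp_Ident_right[OF TO T2 t(1)] by simp
  qed
  have tr: "t \<cdot> r = zero_mor C T (?S (?S T))" if r: "r \<in> R" for r
  proof -
    note z = zero_mor_closed[OF TO TO]
    have rA: "r \<in> ?A" using r R_def by blast
    have "zero_mor C T T \<oplus>\<^bsub>Hom C T T\<^esub> zero_mor C T T = zero_mor C T T"
      using abelian_monoid.l_zero[OF abelian_group.axioms(1)[OF Hom_group[OF TO TO]] z] .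
    then have "lam (zero_mor C T T) = lam (zero_mor C T T) + lam (zero_mor C T T)"
      using lam_add[OF z z] by argo
    then have "lam (zero_mor C T T) = 0" by (simp only: add_cancel_right_right)
    then have "t \<cdot> r = t \<cdot> zero_mor C T T"
      using r R_def Comp_zero_left[OF TO TO TO] by (intro t_eq[OF rA z]) simp
    then show ?thesis using Comp_zero_right[OF TO TO T2 t(1)] by simp
  qed
  \<comment> \<open>After one shift, the functional dual to this composite takes f : V -> T to
    \<open>lam (f \<cdot> b0)\<close>, which is 0 by \<open>lam_b\<close>.\<close>
  have bt: "?s (?s b0) \<cdot> t = zero_mor C T (?S (?S V))"
  proof (rule Shift_mor_eq_zero[OF TO V2])
    note sb = sc[OF TO V b0]
    note ssb = sc[OF T1 V1 sb]
    note sssb = sc[OF T2 V2 ssb]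
    show "?s (?s b0) \<cdot> t \<in> mor C T (?S (?S V))" by (rule Comp_closed[OF TO T2 V2 t(1) ssb])
    have "?s (?s (?s b0)) \<cdot> t1 = zero_mor C (?S T) (?S (?S (?S V)))"
    proof (rule inj[OF T1 V3 Comp_closed[OF T1 T3 V3 t1(1) sssb] zero_mor_closed[OF T1 V3]])
      fix x assume x: "x \<in> mor C (?S (?S (?S V))) (?S (?S (?S T)))"
      obtain x2 where x2: "x2 \<in> mor C (?S (?S V)) (?S (?S T))" "x = ?s x2" using Shift_mor_surj[OF V2 T2 x] .
      obtain x1 where x1: "x1 \<in> mor C (?S V) (?S T)" "x2 = ?s x1" using Shift_mor_surj[OF V1 T1 x2(1)] .
      obtain f where f: "f \<in> mor C V T" "x1 = ?s f" using Shift_mor_surj[OF V TO x1(1)] .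
      have "?s (?s (?s (f \<cdot> b0))) = x \<cdot> ?s (?s (?s b0))"
        using Shift_Comp[OF TO V TO b0 f(1)] Shift_Comp[OF T1 V1 T1 sb x1(1)] Shift_Comp[OF T2 V2 T2 ssb x2(1)]
          f(2) x1(2) x2(2) by simp
      moreover have "lam (f \<cdot> b0) = 0"
        using lam_b[OF Comp_closed[OF TO V TO p f(1)]] Comp_assoc[OF TO TO V TO mors(2) p f(1)] b0_def by simp
      ultimately show "\<phi> (?S T) (?S (?S (?S V))) (?s (?s (?s b0)) \<cdot> t1) x
          = \<phi> (?S T) (?S (?S (?S V))) (zero_mor C (?S T) (?S (?S (?S V)))) x"
        using natR[OF T1 T3 V3 sssb t1(1) x] phi_t1[OF Comp_closed[OF TO V TO b0 f(1)]] phi0[OF T1 V3] by simp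
    qed
    then show "?s (?s (?s b0) \<cdot> t) = zero_mor C (?S T) (?S (?S (?S V)))"
      using Shift_Comp[OF TO T2 V2 t(1) ssb] t(2) by simp
  qed
  obtain c0 where c0: "c0 \<in> mor C T (?S X)" "t = ?s h \<cdot> c0" using weak_kernel_Shift3[OF tX TO t(1) bt] .
  note sh = sc[OF X T1 h]
  \<comment> \<open>Multiplying by \<open>d\<close> preserves h[1] c = t, because t d = t. It makes
    \<open>c\<close> depend only on the component \<open>d \<cdot> y\<close> of an argument y;
    \<open>s1\<close> is cut down for the same reason.\<close>
  define c where "c = c0 \<cdot> d"
  have c: "c \<in> mor C T (?S X)" unfolding c_def by (rule Comp_closed[OF TO TO X1 mors(4) c0(1)])
  have hc: "?s h \<cdot> c = t" unfolding c_def using Comp_assoc[OF TO TO X1 T2 mors(4) c0(1) sh] c0(2) td by simp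
  have cd: "c \<cdot> d = c" unfolding c_def using Comp_assoc[OF TO TO TO X1 mors(4) mors(4) c0(1)] dd by simp
  note sa' = sc[OF X TO a'(1)]
  \<comment> \<open>This composite lies in Hom(T, T[1]) = 0, so \<open>c\<close> lifts along v : Y
    -> X[1].\<close>
  have "?s a' \<cdot> c = zero_mor C T (?S T)" using Comp_closed[OF TO X1 T1 c sa'] rigid by blast
  then obtain s0 where s0: "s0 \<in> mor C T Y" "c = v \<cdot> s0" using weak_kernel3[OF tY TO c] by blast
  define s1 where "s1 = s0 \<cdot> d"
  have s1: "s1 \<in> mor C T Y" unfolding s1_def by (rule Comp_closed[OF TO TO Y mors(4) s0(1)])
  have vs1: "v \<cdot> s1 = c" unfolding s1_def using Comp_assoc[OF TO TO Y X1 mors(4) s0(1) v] s0(2) cd by simp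
  have s1d: "s1 \<cdot> d = s1" unfolding s1_def using Comp_assoc[OF TO TO TO Y mors(4) mors(4) s0(1)] dd by simp
  have RA: "r \<in> ?A" "d \<cdot> r = r" if "r \<in> R" for r using that R_def by auto
  \<comment> \<open>h[1] c r = t r = 0, so \<open>c \<cdot> r\<close> comes from Hom(T, V[1]), which
    is zero because \<open>V\<close> is a summand of \<open>T\<close>.\<close>
  have cr: "c \<cdot> r = zero_mor C T (?S X)" if r: "r \<in> R" for r
  proof -
    note cc = Comp_closed[OF TO TO X1 RA(1)[OF r] c]
    have "?s h \<cdot> (c \<cdot> r) = zero_mor C T (?S (?S T))" using Comp_assoc[OF TO TO X1 T2 RA(1)[OF r] c sh] hc tr[OF r] by simp
    then obtain k where k: "k \<in> mor C T (?S V)" "c \<cdot> r = ?s g \<cdot> k" using weak_kernel_Shift2[OF tX TO cc] by blast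
    note sp = sc[OF TO V p] and si = sc[OF V TO i]
    have "?s i \<cdot> k = zero_mor C T (?S T)" using Comp_closed[OF TO V1 T1 k(1) si] rigid by blast
    moreover have "?s p \<cdot> ?s i \<cdot> k = k"
      using Shift_Comp[OF V TO V i p] pi Shift_Ident[OF V] Comp_Ident_left[OF TO V1 k(1)] by simp
    ultimately have "k = zero_mor C T (?S V)"
      using Comp_assoc[OF TO V1 T1 V1 k(1) si sp] Comp_zero_right[OF TO T1 V1 sp] by simp
    then show ?thesis using k(2) Comp_zero_right[OF TO V1 X1 sc[OF V X g]] by simp
  qed
  \<comment> \<open>Since v s1 r = c r = 0, the map factors through \<open>u\<close>. The factor is
    unique only modulo a\<Lambda>, by \<open>u_eq\<close> below, whence the error terms
    \<open>a \<cdot> q\<close> in the conclusion.\<close>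
  have "\<exists>x\<in>?A. s1 \<cdot> r = u \<cdot> x" if r: "r \<in> R" for r
  proof -
    note cc = Comp_closed[OF TO TO Y RA(1)[OF r] s1]
    have "v \<cdot> (s1 \<cdot> r) = zero_mor C T (?S X)" using Comp_assoc[OF TO TO Y X1 RA(1)[OF r] s1 v] vs1 cr[OF r] by simp
    then show ?thesis using weak_kernel2[OF tY TO cc] by blast
  qed
  then obtain \<rho> where \<rho>: "\<And>r. r \<in> R \<Longrightarrow> \<rho> r \<in> ?A \<and> s1 \<cdot> r = u \<cdot> \<rho> r" by metis
  \<comment> \<open>The kernel of \<open>u\<close> on \<Lambda> is the image of Hom(T, X) under
    \<open>a'\<close>. By rigidity every map T -> X comes from \<open>V\<close>, and on
    \<open>V\<close> the map is \<open>a0\<close>.\<close>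
  have u_eq: "\<exists>q\<in>?A. x = y \<oplus>\<^bsub>Hom C T T\<^esub> a \<cdot> q" if x: "x \<in> ?A" and y: "y \<in> ?A" and eq: "u \<cdot> x = u \<cdot> y" for x y
  proof -
    interpret A: abelian_group "Hom C T T" using Hom_group TO by blast
    interpret TY: abelian_group "Hom C T Y" using Hom_group TO Y by blast
    define m where "m = x \<oplus>\<^bsub>Hom C T T\<^esub> (\<ominus>\<^bsub>Hom C T T\<^esub> y)"
    have m: "m \<in> ?A" using x y unfolding m_def by simp
    have "u \<cdot> m = zero_mor C T Y"
      unfolding m_def using Comp_add_right[OF TO TO Y x A.a_inv_closed[OF y] u] Comp_minus_right[OF TO TO Y y u]
        eq TY.r_neg[OF Comp_closed[OF TO TO Y y u]] by simp
    then obtain k where k: "k \<in> mor C T X" "m = a' \<cdot> k" using weak_kernel[OF tY TO m] by blast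
    have "h \<cdot> k = zero_mor C T (?S T)" using Comp_closed[OF TO X T1 k(1) h] rigid by blast
    then obtain k' where k': "k' \<in> mor C T V" "k = g \<cdot> k'" using weak_kernel2[OF tX TO k(1)] by blast
    note ik = Comp_closed[OF TO V TO k'(1) i]
    have "m = a \<cdot> (i \<cdot> k')"
      using k(2) k'(2) Comp_assoc[OF TO V X TO k'(1) g a'(1)] a'(2) Comp_assoc[OF TO V TO TO k'(1) i mors(1)] a0_def by simp
    moreover have "x = y \<oplus>\<^bsub>Hom C T T\<^esub> m"
      unfolding m_def using x y A.a_lcomm[OF y x A.a_inv_closed[OF y]] A.r_neg[OF y] by simp
    ultimately show ?thesis using ik by blast
  qed
  show thesis
  proof (rule that[of \<rho>])
    show "\<rho> r \<in> ?A" if "r \<in> R" for r using \<rho>[OF that] by blast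
  next
    fix r x assume r: "r \<in> R" and x: "x \<in> ?A"
    note rA = RA[OF r]
    have "r \<cdot> x \<in> R"
    proof -
      have "d \<cdot> (r \<cdot> x) = r \<cdot> x" using Comp_assoc[OF TO TO TO TO x rA(1) mors(4)] rA(2) by simp
      moreover have "lam (r \<cdot> x \<cdot> f) = 0" if f: "f \<in> ?A" for f
        using Comp_assoc[OF TO TO TO TO f x rA(1)] r Comp_closed[OF TO TO TO f x] R_def by simp
      ultimately show ?thesis using R_def Comp_closed[OF TO TO TO x rA(1)] by simp
    qed
    note rx = \<rho>[OF this] and r0 = \<rho>[OF r]
    have "u \<cdot> \<rho> (r \<cdot> x) = s1 \<cdot> r \<cdot> x" using rx Comp_assoc[OF TO TO TO Y x rA(1) s1] by simp
    also have "\<dots> = u \<cdot> (\<rho> r \<cdot> x)" using r0 Comp_assoc[OF TO TO TO Y x _ u] by simp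
    finally show "\<exists>q\<in>?A. \<rho> (r \<cdot> x) = \<rho> r \<cdot> x \<oplus>\<^bsub>Hom C T T\<^esub> a \<cdot> q"
      using u_eq rx r0 Comp_closed[OF TO TO TO x] by blast
  next
    fix x assume x: "x \<in> ?A"
    show "\<exists>r\<in>R. b \<cdot> r = zero_mor C T T \<and> \<not> (\<exists>q\<in>?A. \<rho> r = x \<cdot> r \<oplus>\<^bsub>Hom C T T\<^esub> a \<cdot> q)"
    proof (rule ccontr)
      assume "\<not> ?thesis"
      then have triv: "\<exists>q\<in>?A. \<rho> r = x \<cdot> r \<oplus>\<^bsub>Hom C T T\<^esub> a \<cdot> q" if "r \<in> R" "b \<cdot> r = zero_mor C T T" for r
        using that by blast
      interpret TY: abelian_group "Hom C T Y" using Hom_group TO Y by blast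
      note xd = Comp_closed[OF TO TO TO mors(4) x]
      note uxd = Comp_closed[OF TO TO Y xd u]
      \<comment> \<open>If \<rho> is multiplication by \<open>x\<close> on the kernel of
        \<open>b\<close>, this correction makes the lift vanish on that kernel. It leaves v s' = c,
        since v u = 0.\<close>
      define s' where "s' = s1 \<oplus>\<^bsub>Hom C T Y\<^esub> (\<ominus>\<^bsub>Hom C T Y\<^esub> (u \<cdot> (x \<cdot> d)))"
      have s': "s' \<in> mor C T Y" unfolding s'_def using s1 uxd by simp
      have s'_comp: "s' \<cdot> r = s1 \<cdot> r \<oplus>\<^bsub>Hom C T Y\<^esub> (\<ominus>\<^bsub>Hom C T Y\<^esub> (u \<cdot> (x \<cdot> (d \<cdot> r))))" if r: "r \<in> ?A" for r
        unfolding s'_def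
        using Comp_add_left[OF TO TO Y r s1 TY.a_inv_closed[OF uxd]] Comp_minus_left[OF TO TO Y r uxd]
          Comp_assoc[OF TO TO TO Y r xd u] Comp_assoc[OF TO TO TO TO r mors(4) x] by simp
      have s'd: "s' \<cdot> d = s'"
        unfolding s'_comp[OF mors(4)] dd s1d by (simp add: s'_def)
      have vs': "v \<cdot> s' = c"
      proof -
        interpret TX: abelian_group "Hom C T (?S X)" using Hom_group TO X1 by blast
        have "v \<cdot> (u \<cdot> (x \<cdot> d)) = zero_mor C T (?S X)"
          using Comp_assoc[OF TO TO Y X1 xd u v] triangle_comp_zero2[OF tY] Comp_zero_left[OF TO TO X1 xd] by simp
        then show ?thesis
          unfolding s'_def using Comp_add_right[OF TO Y X1 s1 TY.a_inv_closed[OF uxd] v]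
            Comp_minus_right[OF TO Y X1 uxd v] vs1 c by simp
      qed
      have s'_ker: "s' \<cdot> y = zero_mor C T Y" if y: "y \<in> ?A" and by0: "b0 \<cdot> y = zero_mor C T V" for y
      proof -
        define r where "r = d \<cdot> y"
        have rA: "r \<in> ?A" unfolding r_def by (rule Comp_closed[OF TO TO TO y mors(4)])
        have dr: "d \<cdot> r = r" unfolding r_def using Comp_assoc[OF TO TO TO TO y mors(4) mors(4)] dd by simp
        have "b \<cdot> y = i \<cdot> (b0 \<cdot> y)" using Comp_assoc[OF TO TO V TO y b0 i] ib0 by simp
        then have by1: "b \<cdot> y = zero_mor C T T" using by0 Comp_zero_right[OF TO V TO i] by simp
        have br: "b \<cdot> r = zero_mor C T T" unfolding r_def using Comp_assoc[OF TO TO TO TO y mors(4) mors(2)] bd by1 by simp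
        \<comment> \<open>The kernel of \<open>b\<close> is a right ideal, so \<open>lam_ker\<close>
          applies to every multiple of \<open>r\<close> and yields membership in
          \<open>R\<close>.\<close>
        have "lam (r \<cdot> f) = 0" if f: "f \<in> ?A" for f
          using Comp_assoc[OF TO TO TO TO f rA mors(4)] Comp_assoc[OF TO TO TO TO f rA mors(2)] dr br
            Comp_zero_left[OF TO TO TO f] Comp_closed[OF TO TO TO f rA] by (intro lam_ker) simp_all
        then have rR: "r \<in> R" using R_def rA dr by simp
        obtain q where q: "q \<in> ?A" "\<rho> r = x \<cdot> r \<oplus>\<^bsub>Hom C T T\<^esub> a \<cdot> q" using triv[OF rR br] by blast
        note xr = Comp_closed[OF TO TO TO rA x] and aq = Comp_closed[OF TO TO TO q(1) mors(1)]
        have "u \<cdot> (a \<cdot> q) = zero_mor C T Y" using Comp_assoc[OF TO TO TO Y q(1) mors(1) u] ua Comp_zero_left[OF TO TO Y q(1)] by simp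
        then have "s1 \<cdot> r = u \<cdot> (x \<cdot> r)"
          using \<rho>[OF rR] q(2) Comp_add_right[OF TO TO Y xr aq u] Comp_closed[OF TO TO Y xr u] by simp
        then have "s' \<cdot> r = zero_mor C T Y"
          using s'_comp[OF rA] dr TY.r_neg[OF Comp_closed[OF TO TO Y xr u]] by simp
        then show ?thesis using s'd Comp_assoc[OF TO TO TO Y y mors(4) s'] r_def by simp
      qed
      note ss' = sc[OF TO Y s']
      note ssh = sc[OF X1 T2 sh] and sc' = sc[OF TO X1 c] and sv = sc[OF Y X1 v]
      note s'h = Comp_closed[OF X T1 Y1 h ss']
      \<comment> \<open>the functional dual to \<open>c[1] \<cdot> h : X \<rightarrow> X[2]\<close> does not vanish at the identity\<close>
      have "\<phi> X (?S (?S X)) (?s c \<cdot> h) (Ident C (?S (?S X))) = \<phi> (?S T) (?S (?S X)) (?s c) (?s (?s h))"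
        using natL[OF T1 X X2 h sc' Ident_closed[OF X2]] Comp_Ident_right[OF X2 T3 ssh] by simp
      also have "\<dots> = \<phi> (?S T) (?S (?S (?S T))) (?s (?s h) \<cdot> ?s c) (Ident C (?S (?S (?S T))))"
        using natR[OF T1 X2 T3 ssh sc' Ident_closed[OF T3]] Comp_Ident_left[OF X2 T3 ssh] by simp
      also have "\<dots> = \<phi> (?S T) (?S (?S (?S T))) t1 (?s (?s (?s (Ident C T))))"
        using Shift_Comp[OF TO X1 T2 c sh] hc t(2) Shift_Ident[OF TO] Shift_Ident[OF T1] Shift_Ident[OF T2] by simp
      also have "\<dots> \<noteq> 0" using phi_t1[OF IT] lam_Ident by simp
      finally have nz: "\<phi> X (?S (?S X)) (?s c \<cdot> h) (Ident C (?S (?S X))) \<noteq> 0" .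
      \<comment> \<open>Replacing \<open>Y\<close> by an isomorphic shift \<open>?S Y0\<close>
        allows \<open>v\<close>, a map into X[1], to be desuspended to y : Y0 -> X.\<close>
      obtain Y0 j j' where Y0: "Y0 \<in> Ob C" and j: "j \<in> mor C (?S Y0) Y" and j': "j' \<in> mor C Y (?S Y0)"
        and jj': "j \<cdot> j' = Ident C Y"
        using Shift_ess_surj[OF Y] unfolding iso_obj_def iso_mor_def by blast
      note Y01 = Shift_closed[OF Y0]
      note Y02 = Shift_closed[OF Y01]
      obtain y where y: "y \<in> mor C Y0 X" "v \<cdot> j = ?s y"
        using Shift_mor_surj[OF Y0 X Comp_closed[OF Y01 Y X1 j v]] by blast
      have a'y: "a' \<cdot> y = zero_mor C Y0 T"
      proof (rule Shift_mor_eq_zero[OF Y0 TO Comp_closed[OF Y0 X TO y(1) a'(1)]])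
        show "?s (a' \<cdot> y) = zero_mor C (?S Y0) (?S T)"
          using Shift_Comp[OF Y0 X TO y(1) a'(1)] y(2) Comp_assoc[OF Y01 Y X1 T1 j v sa'] triangle_comp_zero3[OF tY]
            Comp_zero_left[OF Y01 Y T1 j] by simp
      qed
      \<comment> \<open>\<open>a'\<close> kills \<open>y\<close> and is injective on Hom(T, X). So
        \<open>y\<close> kills all maps from \<open>T\<close>, as the approximation lemma
        requires.\<close>
      have yT: "y \<cdot> w = zero_mor C T X" if w: "w \<in> mor C T Y0" for w
        by (rule TX_inj[OF Comp_closed[OF TO Y0 X w y(1)]])
          (use Comp_assoc[OF TO Y0 X TO w y(1) a'(1)] a'y Comp_zero_left[OF TO Y0 TO w] in simp)
      obtain N Z q \<kappa> \<kappa>' where N: "N \<in> add_closure C T" "N \<in> Ob C" and Z: "Z \<in> Ob C" and q: "q \<in> mor C Y0 Z"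
        and \<kappa>: "\<kappa> \<in> mor C (?S N) Z" "\<kappa>' \<in> mor C Z (?S N)" "\<kappa> \<cdot> \<kappa>' = Ident C Z"
        and fact: "\<And>W k. \<lbrakk>W \<in> Ob C; k \<in> mor C Y0 W; \<And>v. v \<in> mor C T Y0 \<Longrightarrow> k \<cdot> v = zero_mor C T W\<rbrakk>
          \<Longrightarrow> \<exists>k'\<in>mor C Z W. k = k' \<cdot> q"
        by (rule cluster_tilting_approximation[OF T Y0]) blast
      obtain z where z: "z \<in> mor C Z X" "y = z \<cdot> q" using fact[OF X y(1) yT] by blast
      note N1 = Shift_closed[OF N(2)]
      note zk = Comp_closed[OF N1 Z X \<kappa>(1) z(1)]
      \<comment> \<open>On N[1] the composite into T[1] is a shift of some r : N -> T, and it
        becomes 0 after b0[1], so b0 r = 0. As \<open>N\<close> is in add T, the vanishing of s' r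
        can be tested on maps from \<open>T\<close>, where \<open>s'_ker\<close> applies.\<close>
      obtain r where r: "r \<in> mor C N T" "h \<cdot> (z \<cdot> \<kappa>) = ?s r"
        using Shift_mor_surj[OF N(2) TO Comp_closed[OF N1 X T1 zk h]] by blast
      have b0r: "b0 \<cdot> r = zero_mor C N V"
      proof (rule Shift_mor_eq_zero[OF N(2) V Comp_closed[OF N(2) TO V r(1) b0]])
        show "?s (b0 \<cdot> r) = zero_mor C (?S N) (?S V)"
          using Shift_Comp[OF N(2) TO V r(1) b0] r(2) Comp_assoc[OF N1 X T1 V1 zk h sc[OF TO V b0]]
            triangle_comp_zero3[OF tX] Comp_zero_left[OF N1 X V1 zk] by simp
      qed
      have s'r: "s' \<cdot> r = zero_mor C N Y"
      proof (rule add_closure_zero[OF N(1) Y TO Comp_closed[OF N(2) TO Y r(1) s']])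
        fix w assume w: "w \<in> mor C T N"
        have "b0 \<cdot> (r \<cdot> w) = zero_mor C T V"
          using Comp_assoc[OF TO N(2) TO V w r(1) b0] b0r Comp_zero_left[OF TO N(2) V w] by simp
        then show "s' \<cdot> r \<cdot> w = zero_mor C T Y"
          using s'_ker[OF Comp_closed[OF TO N(2) TO w r(1)]] Comp_assoc[OF TO N(2) TO Y w r(1) s'] by simp
      qed
      have "?s s' \<cdot> h \<cdot> (z \<cdot> \<kappa>) = zero_mor C (?S N) (?S Y)"
        using Comp_assoc[OF N1 X T1 Y1 zk h ss'] r(2) Shift_Comp[OF N(2) TO Y r(1) s'] s'r Shift_mor_zero[OF N(2) Y] by simp
      then have "?s s' \<cdot> h \<cdot> z \<cdot> \<kappa> \<cdot> \<kappa>' = zero_mor C Z (?S Y)"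
        using Comp_assoc[OF N1 Z X Y1 \<kappa>(1) z(1) s'h] Comp_zero_left[OF Z N1 Y1 \<kappa>(2)] by simp
      then have "?s s' \<cdot> h \<cdot> z = zero_mor C Z (?S Y)"
        using Comp_assoc[OF Z N1 Z Y1 \<kappa>(2) \<kappa>(1) Comp_closed[OF Z X Y1 z(1) s'h]] \<kappa>(3)
          Comp_Ident_right[OF Z Y1 Comp_closed[OF Z X Y1 z(1) s'h]] by simp
      then have s'hy: "?s s' \<cdot> h \<cdot> y = zero_mor C Y0 (?S Y)"
        using z(2) Comp_assoc[OF Y0 Z X Y1 q z(1) s'h] Comp_zero_left[OF Y0 Z Y1 q] by simp
      note sj' = sc[OF Y Y01 j'] and sj = sc[OF Y01 Y j]
      have sv_eq: "?s v = ?s (?s y) \<cdot> ?s j'"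
      proof -
        have "?s y \<cdot> j' = v" using y(2) Comp_assoc[OF Y Y01 Y X1 j' j v] jj' Comp_Ident_right[OF Y X1 v] by simp
        then show ?thesis using Shift_Comp[OF Y Y01 X1 j' sc[OF Y0 X y(1)]] by simp
      qed
      have "?s c \<cdot> h = ?s v \<cdot> (?s s' \<cdot> h)"
        using Shift_Comp[OF TO Y X1 s' v] vs' Comp_assoc[OF X T1 Y1 X2 h ss' sv] by simp
      \<comment> \<open>Naturality moves v[1] = y[2] j'[1] across the pairing; there
        \<open>y\<close> meets s'[1] h, and the composite is 0. This contradicts
        \<open>nz\<close>.\<close>
      then have "\<phi> X (?S (?S X)) (?s c \<cdot> h) (Ident C (?S (?S X))) = \<phi> X (?S Y) (?s s' \<cdot> h) (?s v)"
        using natR[OF X Y1 X2 sv s'h Ident_closed[OF X2]] Comp_Ident_left[OF Y1 X2 sv] by simp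
      also have "\<dots> = \<phi> Y0 (?S Y) (?s s' \<cdot> h \<cdot> y) (?s j')"
        unfolding sv_eq using natL[OF X Y0 Y1 y(1) s'h sj'] by simp
      also have "\<dots> = 0" unfolding s'hy by (rule phi0[OF Y0 Y1])
      finally show False using nz by simp
    qed
  qed
qed

end

section \<open>Path algebras\<close>

text \<open>A path is a pair, but quantifiers over paths are kept on a single variable so that
  hypotheses about \<open>x\<close> still match.\<close>

declare split_paired_All [simp del]

text \<open>Closure under negatives follows from absorption, as \<ominus>x is \<ominus>1 times
  x.\<close>

lemma (in ring) ideal_intro:
  assumes "J \<subseteq> carrier R" "\<zero> \<in> J" "\<And>x y. \<lbrakk>x \<in> J; y \<in> J\<rbrakk> \<Longrightarrow> x \<oplus> y \<in> J"
    "\<And>r x. \<lbrakk>r \<in> carrier R; x \<in> J\<rbrakk> \<Longrightarrow> r \<otimes> x \<in> J" "\<And>r x. \<lbrakk>r \<in> carrier R; x \<in> J\<rbrakk> \<Longrightarrow> x \<otimes> r \<in> J"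
  shows "ideal J R"
proof (rule idealI)
  show "subgroup J (add_monoid R)"
  proof (rule add.subgroupI)
    fix x assume x: "x \<in> J"
    then have "\<ominus> \<one> \<otimes> x = \<ominus> x" using assms(1) by (simp add: l_minus subset_iff)
    then show "\<ominus> x \<in> J" using assms(4)[OF a_inv_closed[OF one_closed] x] by simp
  qed (use assms in auto)
qed (use assms ring_axioms in auto)

abbreviation path_mult ::
    "('v \<times> 'a list \<Rightarrow> 'k::field) \<Rightarrow> ('v, 'a) pre_digraph \<Rightarrow> ('v \<times> 'a list \<Rightarrow> 'k) \<Rightarrow> 'v \<times> 'a list \<Rightarrow> 'k"
    (\<open>(_ \<star>\<^bsub>_\<^esub> _)\<close> [71, 0, 70] 70) where
  "f \<star>\<^bsub>Q\<^esub> g \<equiv> f \<otimes>\<^bsub>complete_path_algebra Q\<^esub> g"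

abbreviation avoids :: "('a \<Rightarrow> 'a \<Rightarrow> bool) \<Rightarrow> 'a list \<Rightarrow> bool" where
  "avoids rel \<equiv> successively (\<lambda>a b. \<not> rel a b)"

lemma complete_path_algebra_simps:
  "carrier (complete_path_algebra Q) = {f. \<forall>x. f x \<noteq> 0 \<longrightarrow> x \<in> quiver_paths Q}"
  "zero (complete_path_algebra Q) = (\<lambda>x. 0)"
  "add (complete_path_algebra Q) = (\<lambda>f g x. f x + g x)"
  "smult (complete_path_algebra Q) = (\<lambda>c f x. c * f x)"
  "one (complete_path_algebra Q) = (\<lambda>(u, p). if u \<in> verts Q \<and> p = [] then 1 else 0)"
  by (simp_all add: complete_path_algebra_def)

lemma support_path: "f \<in> carrier (complete_path_algebra Q) \<Longrightarrow> f x \<noteq> 0 \<Longrightarrow> x \<in> quiver_paths Q"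
  by (simp add: complete_path_algebra_simps)

lemma path_algebra_simps:
  "carrier (path_algebra Q) = {f. (\<forall>x. f x \<noteq> 0 \<longrightarrow> x \<in> quiver_paths Q) \<and> finite {x. f x \<noteq> 0}}"
  "zero (path_algebra Q) = (\<lambda>x. 0)"
  "add (path_algebra Q) = (\<lambda>f g x. f x + g x)"
  "smult (path_algebra Q) = (\<lambda>c f x. c * f x)"
  "one (path_algebra Q) = (\<lambda>(u, p). if u \<in> verts Q \<and> p = [] then 1 else 0)"
  "monoid.mult (path_algebra Q) = monoid.mult (complete_path_algebra Q)"
  by (auto simp: path_algebra_def complete_path_algebra_def)

lemma mult_path:
  "(f \<otimes>\<^bsub>complete_path_algebra Q\<^esub> g) (u, p) =
    (\<Sum>i\<le>length p. f (u, take i p) * g (pre_digraph.awlast Q u (take i p), drop i p))"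
  by (simp add: complete_path_algebra_def)

context wf_digraph
begin

lemma quiver_paths_iff: "(u, p) \<in> quiver_paths G \<longleftrightarrow> awalk u p (awlast u p)"
proof
  assume "(u, p) \<in> quiver_paths G"
  then obtain v where v: "awalk u p v" unfolding quiver_paths_def by blast
  then show "awalk u p (awlast u p)" by simp
qed (auto simp: quiver_paths_def)

lemma quiver_paths_append:
  "(u, p @ q) \<in> quiver_paths G \<longleftrightarrow> (u, p) \<in> quiver_paths G \<and> (awlast u p, q) \<in> quiver_paths G"
  by (simp add: quiver_paths_iff awlast_append awalk_append_iff)

lemma quiver_paths_Nil: "(u, []) \<in> quiver_paths G \<longleftrightarrow> u \<in> verts G"
  by (simp add: quiver_paths_iff awalk_Nil_iff)

lemma quiver_paths_Cons:
  "(u, a # p) \<in> quiver_paths G \<longleftrightarrow> a \<in> arcs G \<and> u = tail G a \<and> (head G a, p) \<in> quiver_paths G"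
  by (simp add: quiver_paths_iff awalk_Cons_iff)

lemma quiver_paths_verts:
  "(u, p) \<in> quiver_paths G \<Longrightarrow> u \<in> verts G" "(u, p) \<in> quiver_paths G \<Longrightarrow> awlast u p \<in> verts G"
  by (auto simp: quiver_paths_iff awalk_hd_in_verts awalk_last_in_verts)

lemma quiver_paths_take_drop:
  "(u, take i p) \<in> quiver_paths G \<Longrightarrow> (awlast u (take i p), drop i p) \<in> quiver_paths G \<Longrightarrow> (u, p) \<in> quiver_paths G"
  using quiver_paths_append[of u "take i p" "drop i p"] by simp

lemma mult_closed_complete:
  assumes "f \<in> carrier (complete_path_algebra G)" "g \<in> carrier (complete_path_algebra G)"
  shows "f \<otimes>\<^bsub>complete_path_algebra G\<^esub> g \<in> carrier (complete_path_algebra G)"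
  unfolding complete_path_algebra_simps
proof (intro CollectI allI impI)
  fix x assume nz: "(f \<otimes>\<^bsub>complete_path_algebra G\<^esub> g) x \<noteq> 0"
  obtain u p where x: "x = (u, p)" by fastforce
  obtain i where "f (u, take i p) * g (awlast u (take i p), drop i p) \<noteq> 0"
    using nz unfolding x mult_path by (meson sum.not_neutral_contains_not_neutral)
  then have "f (u, take i p) \<noteq> 0" "g (awlast u (take i p), drop i p) \<noteq> 0" by auto
  then show "x \<in> quiver_paths G"
    unfolding x using quiver_paths_take_drop[OF support_path[OF assms(1)] support_path[OF assms(2)]] by blast
qed

lemma mult_assoc_complete:
  "(f \<otimes>\<^bsub>complete_path_algebra G\<^esub> g) \<otimes>\<^bsub>complete_path_algebra G\<^esub> h =
    f \<otimes>\<^bsub>complete_path_algebra G\<^esub> (g \<otimes>\<^bsub>complete_path_algebra G\<^esub> h)"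
proof
  fix x :: "'a \<times> 'b list"
  obtain u p where x: "x = (u, p)" by fastforce
  let ?n = "length p"
  have "((f \<otimes>\<^bsub>complete_path_algebra G\<^esub> g) \<otimes>\<^bsub>complete_path_algebra G\<^esub> h) x =
    (\<Sum>i\<le>?n. \<Sum>j\<le>i. f (u, take j p) * g (awlast u (take j p), drop j (take i p)) * h (awlast u (take i p), drop i p))"
    unfolding x mult_path sum_distrib_right by (intro sum.cong refl) (simp_all add: min_absorb1 min_absorb2)
  also have "\<dots> = (\<Sum>(i, j)\<in>(SIGMA i:{..?n}. {..i}).
      f (u, take j p) * g (awlast u (take j p), drop j (take i p)) * h (awlast u (take i p), drop i p))"
    by (simp add: sum.Sigma)
  also have "\<dots> = (\<Sum>(j, l)\<in>(SIGMA j:{..?n}. {..?n - j}).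
      f (u, take j p) * (g (awlast u (take j p), take l (drop j p)) *
        h (awlast (awlast u (take j p)) (take l (drop j p)), drop l (drop j p))))"
  \<comment> \<open>Cutting at \<open>i\<close> and then the front piece at \<open>j\<close> amounts
    to cutting at \<open>j\<close> and then the remainder at \<open>i - j\<close>.\<close>
  proof (rule sum.reindex_bij_witness[of _ "\<lambda>(j, l). (j + l, j)" "\<lambda>(i, j). (j, i - j)"])
    fix ij assume "ij \<in> (SIGMA i:{..?n}. {..i})"
    then obtain i j where ij: "ij = (i, j)" "i \<le> ?n" "j \<le> i" by auto
    then have "take i p = take j p @ take (i - j) (drop j p)" using take_add[of j "i - j" p] by simp
    then have "awlast (awlast u (take j p)) (take (i - j) (drop j p)) = awlast u (take i p)"
      by (simp add: awlast_append)
    then show "(case case ij of (i, j) \<Rightarrow> (j, i - j) of (j, l) \<Rightarrow>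
        f (u, take j p) * (g (awlast u (take j p), take l (drop j p)) *
          h (awlast (awlast u (take j p)) (take l (drop j p)), drop l (drop j p)))) =
        (case ij of (i, j) \<Rightarrow> f (u, take j p) * g (awlast u (take j p), drop j (take i p)) *
          h (awlast u (take i p), drop i p))"
      using ij by (simp add: drop_take mult.assoc)
  qed auto
  also have "\<dots> = (f \<otimes>\<^bsub>complete_path_algebra G\<^esub> (g \<otimes>\<^bsub>complete_path_algebra G\<^esub> h)) x"
    unfolding x mult_path sum_distrib_left by (simp add: sum.Sigma)
  finally show "((f \<otimes>\<^bsub>complete_path_algebra G\<^esub> g) \<otimes>\<^bsub>complete_path_algebra G\<^esub> h) x =
    (f \<otimes>\<^bsub>complete_path_algebra G\<^esub> (g \<otimes>\<^bsub>complete_path_algebra G\<^esub> h)) x" .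
qed

lemma mult_one_left_complete:
  assumes "f \<in> carrier (complete_path_algebra G)"
  shows "\<one>\<^bsub>complete_path_algebra G\<^esub> \<otimes>\<^bsub>complete_path_algebra G\<^esub> f = f"
proof
  fix x :: "'a \<times> 'b list"
  obtain u p where x: "x = (u, p)" by fastforce
  have "(\<one>\<^bsub>complete_path_algebra G\<^esub> \<otimes>\<^bsub>complete_path_algebra G\<^esub> f) x =
    (\<Sum>i\<le>length p. if i = 0 then (if u \<in> verts G then f (u, p) else 0) else 0)"
    unfolding x mult_path complete_path_algebra_simps by (intro sum.cong refl) auto
  then show "(\<one>\<^bsub>complete_path_algebra G\<^esub> \<otimes>\<^bsub>complete_path_algebra G\<^esub> f) x = f x"
    using assms quiver_paths_verts(1)[of u p] unfolding complete_path_algebra_simps x by auto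
qed

lemma mult_one_right_complete:
  assumes "f \<in> carrier (complete_path_algebra G)"
  shows "f \<otimes>\<^bsub>complete_path_algebra G\<^esub> \<one>\<^bsub>complete_path_algebra G\<^esub> = f"
proof
  fix x :: "'a \<times> 'b list"
  obtain u p where x: "x = (u, p)" by fastforce
  have "(f \<otimes>\<^bsub>complete_path_algebra G\<^esub> \<one>\<^bsub>complete_path_algebra G\<^esub>) x =
    (\<Sum>i\<le>length p. if i = length p then (if awlast u p \<in> verts G then f (u, p) else 0) else 0)"
    unfolding x mult_path complete_path_algebra_simps by (intro sum.cong refl) auto
  then show "(f \<otimes>\<^bsub>complete_path_algebra G\<^esub> \<one>\<^bsub>complete_path_algebra G\<^esub>) x = f x"
    using assms quiver_paths_verts(2)[of u p] unfolding complete_path_algebra_simps x by auto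
qed

lemma ring_complete: "ring (complete_path_algebra G :: ('k::field, 'a \<times> 'b list \<Rightarrow> 'k) module)"
proof (rule ringI)
  let ?K = "complete_path_algebra G :: ('k, 'a \<times> 'b list \<Rightarrow> 'k) module"
  show "abelian_group ?K"
  proof (rule abelian_groupI)
    fix x assume x: "x \<in> carrier ?K"
    show "\<exists>y\<in>carrier ?K. y \<oplus>\<^bsub>?K\<^esub> x = \<zero>\<^bsub>?K\<^esub>"
      by (rule bexI[of _ "\<lambda>z. - x z"]) (use x in \<open>auto simp: complete_path_algebra_simps\<close>)
  next
    fix x y assume "x \<in> carrier ?K" "y \<in> carrier ?K"
    then show "x \<oplus>\<^bsub>?K\<^esub> y \<in> carrier ?K" by (auto simp: complete_path_algebra_simps) (metis add.right_neutral)
  qed (auto simp: complete_path_algebra_simps)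
  show "Group.monoid ?K"
  proof (rule monoidI)
    show "\<one>\<^bsub>?K\<^esub> \<in> carrier ?K" by (auto simp: complete_path_algebra_simps quiver_paths_Nil split: if_splits)
  qed (simp_all add: mult_closed_complete mult_assoc_complete mult_one_left_complete mult_one_right_complete)
  fix x y z assume "x \<in> carrier ?K" "y \<in> carrier ?K" "z \<in> carrier ?K"
  show "(x \<oplus>\<^bsub>?K\<^esub> y) \<otimes>\<^bsub>?K\<^esub> z = x \<otimes>\<^bsub>?K\<^esub> z \<oplus>\<^bsub>?K\<^esub> y \<otimes>\<^bsub>?K\<^esub> z"
    by (rule ext) (auto simp: complete_path_algebra_def distrib_right sum.distrib)
  show "z \<otimes>\<^bsub>?K\<^esub> (x \<oplus>\<^bsub>?K\<^esub> y) = z \<otimes>\<^bsub>?K\<^esub> x \<oplus>\<^bsub>?K\<^esub> z \<otimes>\<^bsub>?K\<^esub> y"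
    by (rule ext) (auto simp: complete_path_algebra_def distrib_left sum.distrib)
qed

lemma path_algebra_subset: "carrier (path_algebra G) \<subseteq> carrier (complete_path_algebra G)"
  by (auto simp: path_algebra_def)

lemma mult_closed_path_algebra:
  assumes f: "f \<in> carrier (path_algebra G)" and g: "g \<in> carrier (path_algebra G)"
  shows "f \<otimes>\<^bsub>complete_path_algebra G\<^esub> g \<in> carrier (path_algebra G)"
proof -
  let ?F = "{x. f x \<noteq> 0}" and ?G = "{x. g x \<noteq> 0}"
  have fin: "finite ?F" "finite ?G" using f g by (auto simp: path_algebra_simps)
  have "{x. (f \<otimes>\<^bsub>complete_path_algebra G\<^esub> g) x \<noteq> 0} \<subseteq> (\<lambda>(x, y). (fst x, snd x @ snd y)) ` (?F \<times> ?G)"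
  proof
    fix x assume "x \<in> {x. (f \<otimes>\<^bsub>complete_path_algebra G\<^esub> g) x \<noteq> 0}"
    then have nz: "(f \<otimes>\<^bsub>complete_path_algebra G\<^esub> g) x \<noteq> 0" by simp
    obtain u p where x: "x = (u, p)" by fastforce
    obtain i where "f (u, take i p) * g (awlast u (take i p), drop i p) \<noteq> 0"
      using nz unfolding x mult_path by (meson sum.not_neutral_contains_not_neutral)
    then show "x \<in> (\<lambda>(x, y). (fst x, snd x @ snd y)) ` (?F \<times> ?G)"
      unfolding x by (intro image_eqI[of _ _ "((u, take i p), (awlast u (take i p), drop i p))"]) auto
  qed
  then have "finite {x. (f \<otimes>\<^bsub>complete_path_algebra G\<^esub> g) x \<noteq> 0}"
    by (rule finite_subset) (use fin in simp)
  moreover have "f \<otimes>\<^bsub>complete_path_algebra G\<^esub> g \<in> carrier (complete_path_algebra G)"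
    by (rule mult_closed_complete) (use f g path_algebra_subset in blast)+
  ultimately show ?thesis by (simp add: path_algebra_def)
qed

lemma path_algebra_add_closed:
  "\<lbrakk>f \<in> carrier (path_algebra G); g \<in> carrier (path_algebra G)\<rbrakk> \<Longrightarrow> (\<lambda>x. f x + g x) \<in> carrier (path_algebra G)"
  unfolding path_algebra_simps
  by (auto intro: finite_subset[of _ "{x. f x \<noteq> 0} \<union> {x. g x \<noteq> 0}"]) (metis add.right_neutral)

end

context fin_digraph
begin

lemma ring_path_algebra: "ring (path_algebra G :: ('k::field, 'a \<times> 'b list \<Rightarrow> 'k) module)"
proof (rule ringI)
  let ?K = "path_algebra G :: ('k, 'a \<times> 'b list \<Rightarrow> 'k) module"
  let ?K' = "complete_path_algebra G :: ('k, 'a \<times> 'b list \<Rightarrow> 'k) module"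
  have K': "f \<in> carrier ?K'" if "f \<in> carrier ?K" for f using that path_algebra_subset by blast
  show "abelian_group ?K"
  proof (rule abelian_groupI)
    fix x assume x: "x \<in> carrier ?K"
    show "\<exists>y\<in>carrier ?K. y \<oplus>\<^bsub>?K\<^esub> x = \<zero>\<^bsub>?K\<^esub>"
      by (rule bexI[of _ "\<lambda>z. - x z"]) (use x in \<open>auto simp: path_algebra_simps\<close>)
  next
    fix x y assume "x \<in> carrier ?K" "y \<in> carrier ?K"
    then show "x \<oplus>\<^bsub>?K\<^esub> y \<in> carrier ?K" using path_algebra_add_closed by (simp add: path_algebra_simps(3))
  qed (auto simp: path_algebra_simps)
  have "{x. \<one>\<^bsub>?K\<^esub> x \<noteq> 0} \<subseteq> verts G \<times> {[]}" by (auto simp: path_algebra_simps split: if_splits)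
  then have "finite {x. \<one>\<^bsub>?K\<^esub> x \<noteq> 0}" by (rule finite_subset) simp
  moreover have "x \<in> quiver_paths G" if "\<one>\<^bsub>?K\<^esub> x \<noteq> 0" for x
    using that by (auto simp: path_algebra_simps(5) quiver_paths_Nil split: if_splits prod.splits)
  ultimately have one: "\<one>\<^bsub>?K\<^esub> \<in> carrier ?K" unfolding path_algebra_simps(1) by blast
  have "\<one>\<^bsub>?K\<^esub> = \<one>\<^bsub>?K'\<^esub>" by (simp add: path_algebra_simps complete_path_algebra_simps)
  then show "Group.monoid ?K"
    using one by (intro monoidI)
      (simp_all add: path_algebra_simps(6) mult_closed_path_algebra mult_assoc_complete
        mult_one_left_complete mult_one_right_complete K')
  interpret K': ring ?K' by (rule ring_complete)
  have a: "(x \<oplus>\<^bsub>?K\<^esub> y) = x \<oplus>\<^bsub>?K'\<^esub> y" for x y by (simp add: path_algebra_simps complete_path_algebra_simps)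
  fix x y z assume "x \<in> carrier ?K" "y \<in> carrier ?K" "z \<in> carrier ?K"
  then show "(x \<oplus>\<^bsub>?K\<^esub> y) \<otimes>\<^bsub>?K\<^esub> z = x \<otimes>\<^bsub>?K\<^esub> z \<oplus>\<^bsub>?K\<^esub> y \<otimes>\<^bsub>?K\<^esub> z"
    "z \<otimes>\<^bsub>?K\<^esub> (x \<oplus>\<^bsub>?K\<^esub> y) = z \<otimes>\<^bsub>?K\<^esub> x \<oplus>\<^bsub>?K\<^esub> z \<otimes>\<^bsub>?K\<^esub> y"
    unfolding a path_algebra_simps(6) using K' K'.l_distr K'.r_distr by simp_all
qed

end

section \<open>Monomial ideals\<close>

text \<open>Within the path algebra this is the monomial ideal generated by the related pairs.
  Within the complete path algebra it is the closed monomial ideal, with infinite combinations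
  allowed.\<close>

definition bad_support :: "('b \<Rightarrow> 'b \<Rightarrow> bool) \<Rightarrow> ('a \<times> 'b list \<Rightarrow> 'k::zero) \<Rightarrow> bool" where
  "bad_support rel f \<longleftrightarrow> (\<forall>x. f x \<noteq> 0 \<longrightarrow> \<not> avoids rel (snd x))"

lemma bad_support_zero:
  "bad_support rel f \<Longrightarrow> avoids rel (snd x) \<Longrightarrow> f x = 0"
  unfolding bad_support_def by blast

lemma ideal_zero: "ideal J R \<Longrightarrow> \<zero>\<^bsub>R\<^esub> \<in> J"
  by (rule additive_subgroup.zero_closed[OF ideal.axioms(1)])

lemma ideal_add: "ideal J R \<Longrightarrow> x \<in> J \<Longrightarrow> y \<in> J \<Longrightarrow> x \<oplus>\<^bsub>R\<^esub> y \<in> J"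
  by (rule additive_subgroup.a_closed[OF ideal.axioms(1)])

lemma not_successivelyE:
  assumes "\<not> successively P xs"
  obtains ys a b zs where "xs = ys @ a # b # zs" "\<not> P a b"
proof -
  obtain i where i: "Suc i < length xs" "\<not> P (xs ! i) (xs ! Suc i)"
    using assms unfolding successively_conv_nth by blast
  have "xs = take i xs @ xs ! i # xs ! Suc i # drop (Suc (Suc i)) xs"
    using i(1) by (simp add: id_take_nth_drop Cons_nth_drop_Suc)
  with i(2) that show thesis by blast
qed

lemma successively_append_D:
  "successively P (xs @ ys) \<Longrightarrow> successively P xs \<and> successively P ys"
  by (simp add: successively_append_iff)

lemma mult_path_smult_left:
  "(\<lambda>x. c * f x) \<otimes>\<^bsub>complete_path_algebra Q\<^esub> g = (\<lambda>x. c * (f \<otimes>\<^bsub>complete_path_algebra Q\<^esub> g) x)"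
proof
  fix x show "((\<lambda>x. c * f x) \<otimes>\<^bsub>complete_path_algebra Q\<^esub> g) x = c * (f \<otimes>\<^bsub>complete_path_algebra Q\<^esub> g) x"
    by (cases x) (simp add: mult_path sum_distrib_left mult.assoc)
qed

context wf_digraph
begin

lemma path_elem_mult:
  "(path_elem (v, p) \<otimes>\<^bsub>complete_path_algebra G\<^esub> f) (w, q) =
    (if w = v \<and> take (length p) q = p then f (awlast v p, drop (length p) q) else 0)" (is "_ = ?r")
proof -
  have "(path_elem (v, p) \<otimes>\<^bsub>complete_path_algebra G\<^esub> f) (w, q) = (\<Sum>i\<le>length q. if i = length p then ?r else 0)"
    unfolding mult_path
  proof (rule sum.cong[OF refl])
    fix i assume i: "i \<in> {..length q}"
    show "path_elem (v, p) (w, take i q) * f (awlast w (take i q), drop i q) = (if i = length p then ?r else 0)"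
    proof (cases "i = length p")
      case False
      then have "take i q \<noteq> p" using i by auto
      then show ?thesis using False by (simp add: path_elem_def)
    qed (auto simp: path_elem_def)
  qed
  \<comment> \<open>If \<open>p\<close> is longer than \<open>q\<close>, no cut contributes;
    comparing lengths shows that the condition in \<open>?r\<close> fails as well.\<close>
  also have "\<dots> = ?r" by (auto dest: arg_cong[of _ _ length])
  finally show ?thesis .
qed

text \<open>Only the cut at \<open>length q - length p\<close> can contribute. The subtraction
  truncates, so the comparison of the two lengths has to be part of the condition.\<close>

lemma mult_path_elem:
  "(f \<otimes>\<^bsub>complete_path_algebra G\<^esub> path_elem (v, p)) (w, q) =
    (if length p \<le> length q \<and> drop (length q - length p) q = p \<and> awlast w (take (length q - length p) q) = v
     then f (w, take (length q - length p) q) else 0)" (is "_ = ?r")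
proof -
  have "(f \<otimes>\<^bsub>complete_path_algebra G\<^esub> path_elem (v, p)) (w, q) =
    (\<Sum>i\<le>length q. if i = length q - length p then ?r else 0)"
    unfolding mult_path
  proof (rule sum.cong[OF refl])
    fix i assume i: "i \<in> {..length q}"
    show "f (w, take i q) * path_elem (v, p) (awlast w (take i q), drop i q) =
      (if i = length q - length p then ?r else 0)"
    proof (cases "length p \<le> length q \<and> i = length q - length p")
      case False
      then have "drop i q \<noteq> p" using i by auto
      then show ?thesis using False by (auto simp: path_elem_def)
    qed (auto simp: path_elem_def)
  qed
  also have "\<dots> = ?r" by simp
  finally show ?thesis .
qed

lemma path_elem_append:
  "path_elem (u, p) \<otimes>\<^bsub>complete_path_algebra G\<^esub> path_elem (awlast u p, q) = path_elem (u, p @ q)"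
proof
  fix x :: "'a \<times> 'b list"
  obtain w r where x: "x = (w, r)" by fastforce
  have "take (length p) r = p \<and> drop (length p) r = q \<longleftrightarrow> r = p @ q"
    by (metis append_eq_conv_conj)
  then show "(path_elem (u, p) \<otimes>\<^bsub>complete_path_algebra G\<^esub> path_elem (awlast u p, q)) x = path_elem (u, p @ q) x"
    unfolding x path_elem_mult by (auto simp: path_elem_def)
qed

lemma path_elem_closed: "x \<in> quiver_paths G \<Longrightarrow> path_elem x \<in> carrier (path_algebra G)"
  unfolding path_algebra_simps path_elem_def by simp

lemma bad_support_mult:
  assumes "bad_support rel f \<or> bad_support rel g"
  shows "bad_support rel (f \<otimes>\<^bsub>complete_path_algebra G\<^esub> g)"
  unfolding bad_support_def
proof (intro allI impI)
  fix x assume nz: "(f \<otimes>\<^bsub>complete_path_algebra G\<^esub> g) x \<noteq> 0"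
  obtain u p where x: "x = (u, p)" by fastforce
  obtain i where "f (u, take i p) * g (awlast u (take i p), drop i p) \<noteq> 0"
    using nz unfolding x mult_path by (meson sum.not_neutral_contains_not_neutral)
  then have "f (u, take i p) \<noteq> 0" "g (awlast u (take i p), drop i p) \<noteq> 0" by auto
  then have "\<not> avoids rel (take i p) \<or> \<not> avoids rel (drop i p)"
    using assms unfolding bad_support_def by (metis snd_conv)
  then show "\<not> avoids rel (snd x)"
    using successively_append_D[of _ "take i p" "drop i p"] x by auto
qed

lemma bad_support_add: "bad_support rel f \<Longrightarrow> bad_support rel g \<Longrightarrow> bad_support rel (\<lambda>x. f x + (g x :: 'k::field))"
  unfolding bad_support_def
proof (intro allI impI)
  fix x
  assume a: "\<forall>x. f x \<noteq> 0 \<longrightarrow> \<not> avoids rel (snd x)"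
    "\<forall>x. g x \<noteq> 0 \<longrightarrow> \<not> avoids rel (snd x)" and "f x + g x \<noteq> 0"
  then have "f x \<noteq> 0 \<or> g x \<noteq> 0" by auto
  then show "\<not> avoids rel (snd x)" using a by blast
qed

lemma bad_support_ideal_complete:
  "ideal {f \<in> carrier (complete_path_algebra G). bad_support rel f}
    (complete_path_algebra G :: ('k::field, 'a \<times> 'b list \<Rightarrow> 'k) module)"
proof -
  interpret ring "complete_path_algebra G :: ('k::field, 'a \<times> 'b list \<Rightarrow> 'k) module" by (rule ring_complete)
  show ?thesis
  proof (rule ideal_intro)
    fix f g :: "'a \<times> 'b list \<Rightarrow> 'k"
    assume "f \<in> {f \<in> carrier (complete_path_algebra G). bad_support rel f}"
      "g \<in> {f \<in> carrier (complete_path_algebra G). bad_support rel f}"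
    then show "f \<oplus>\<^bsub>complete_path_algebra G\<^esub> g \<in> {f \<in> carrier (complete_path_algebra G). bad_support rel f}"
      using a_closed[of f g] bad_support_add[of rel f g] by (simp add: complete_path_algebra_simps(3))
  qed (auto simp: bad_support_mult complete_path_algebra_simps(2) bad_support_def[of rel "\<lambda>x. 0"] zero_closed[unfolded complete_path_algebra_simps(2)])
qed

end

context fin_digraph
begin

lemma bad_support_ideal_path_algebra:
  "ideal {f \<in> carrier (path_algebra G). bad_support rel f}
    (path_algebra G :: ('k::field, 'a \<times> 'b list \<Rightarrow> 'k) module)"
proof -
  interpret ring "path_algebra G :: ('k::field, 'a \<times> 'b list \<Rightarrow> 'k) module" by (rule ring_path_algebra)
  show ?thesis
  proof (rule ideal_intro)
    fix f g :: "'a \<times> 'b list \<Rightarrow> 'k"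
    assume "f \<in> {f \<in> carrier (path_algebra G). bad_support rel f}"
      "g \<in> {f \<in> carrier (path_algebra G). bad_support rel f}"
    then show "f \<oplus>\<^bsub>path_algebra G\<^esub> g \<in> {f \<in> carrier (path_algebra G). bad_support rel f}"
      using a_closed[of f g] bad_support_add[of rel f g] by (simp add: path_algebra_simps(3))
  qed (auto simp: bad_support_mult path_algebra_simps(2,6) mult_closed_path_algebra bad_support_def[of rel "\<lambda>x. 0"]
      zero_closed[unfolded path_algebra_simps(2)])
qed

text \<open>An ideal absorbs ring elements, not scalars; but c f is the product of c times the unit
  with f.\<close>

lemma ideal_smult:
  fixes J :: "('a \<times> 'b list \<Rightarrow> 'k::field) set"
  assumes J: "ideal J (path_algebra G)" and f: "f \<in> J"
  shows "(\<lambda>x. c * f x) \<in> J"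
proof -
  interpret J: ideal J "path_algebra G" by fact
  let ?one = "\<one>\<^bsub>path_algebra G\<^esub> :: 'a \<times> 'b list \<Rightarrow> 'k"
  have "?one \<in> carrier (path_algebra G)" by simp
  then have one: "finite {x. ?one x \<noteq> 0}" "\<forall>x. ?one x \<noteq> 0 \<longrightarrow> x \<in> quiver_paths G"
    unfolding path_algebra_simps(1) by blast+
  have "{x. c * ?one x \<noteq> 0} \<subseteq> {x. ?one x \<noteq> 0}" by auto
  then have "finite {x. c * ?one x \<noteq> 0}" using one(1) by (rule finite_subset)
  then have "(\<lambda>x. c * ?one x) \<in> carrier (path_algebra G)"
    using one(2) unfolding path_algebra_simps(1) by (simp del: J.one_closed)
  then have "(\<lambda>x. c * ?one x) \<otimes>\<^bsub>path_algebra G\<^esub> f \<in> J" using J.I_l_closed f by blast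
  moreover have "?one \<otimes>\<^bsub>path_algebra G\<^esub> f = f" using J.l_one J.Icarr f by blast
  ultimately show ?thesis unfolding path_algebra_simps(6) mult_path_smult_left by simp
qed

lemma path_elem_span:
  fixes J :: "('a \<times> 'b list \<Rightarrow> 'k::field) set"
  assumes J: "ideal J (path_algebra G)" and f: "f \<in> carrier (path_algebra G)"
    and 0: "\<And>x. f x \<noteq> 0 \<Longrightarrow> path_elem x \<in> J"
  shows "f \<in> J"
proof -
  interpret J: ideal J "path_algebra G" by fact
  have "\<forall>f. {x. f x \<noteq> 0} \<subseteq> F \<longrightarrow> (\<forall>x. f x \<noteq> 0 \<longrightarrow> path_elem x \<in> J) \<longrightarrow> f \<in> J" if "finite F" for F :: "('a \<times> 'b list) set"
    using that
  proof induction
    case empty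
    show ?case
    proof (intro allI impI)
      fix f :: "'a \<times> 'b list \<Rightarrow> 'k"
      assume "{x. f x \<noteq> 0} \<subseteq> {}"
      then have "f = \<zero>\<^bsub>path_algebra G\<^esub>" unfolding path_algebra_simps(2) by auto
      then show "f \<in> J" using ideal_zero[OF J] by simp
    qed
  next
    case (insert y F)
    show ?case
    proof (intro allI impI)
      fix f :: "'a \<times> 'b list \<Rightarrow> 'k"
      assume s: "{x. f x \<noteq> 0} \<subseteq> insert y F" and e: "\<forall>x. f x \<noteq> 0 \<longrightarrow> path_elem x \<in> J"
      have "{x. (f(y := 0)) x \<noteq> 0} \<subseteq> F" "\<forall>x. (f(y := 0)) x \<noteq> 0 \<longrightarrow> path_elem x \<in> J" using s e by auto
      then have r: "f(y := 0) \<in> J" using insert.IH by blast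
      have t: "(\<lambda>x. f y * path_elem y x) \<in> J"
      proof (cases "f y = 0")
        case True
        then show ?thesis using ideal_zero[OF J] by (simp add: path_algebra_simps(2))
      next
        case False
        then show ?thesis using ideal_smult[OF J, of "path_elem y" "f y"] e by blast
      qed
      have "f = f(y := 0) \<oplus>\<^bsub>path_algebra G\<^esub> (\<lambda>x. f y * path_elem y x)"
        by (auto simp: path_algebra_simps(3) path_elem_def)
      then show "f \<in> J" using ideal_add[OF J r t] by simp
    qed
  qed
  then show ?thesis using f 0 unfolding path_algebra_simps(1) by blast
qed

lemma bad_path_elem_in_ideal:
  fixes J :: "('a \<times> 'b list \<Rightarrow> 'k::field) set"
  assumes J: "ideal J (path_algebra G)"
    and gens: "\<And>a b. \<lbrakk>rel a b; a \<in> arcs G; b \<in> arcs G; head G a = tail G b\<rbrakk> \<Longrightarrow> path_elem (tail G a, [a, b]) \<in> J"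
    and x: "x \<in> quiver_paths G" "\<not> avoids rel (snd x)"
  shows "path_elem x \<in> J"
proof -
  interpret J: ideal J "path_algebra G" by fact
  obtain u p where up: "x = (u, p)" by fastforce
  obtain ys a b zs where p: "p = ys @ a # b # zs" "rel a b" using x(2) up not_successivelyE by (metis snd_conv)
  have paths: "(u, ys) \<in> quiver_paths G" "(awlast u ys, [a, b]) \<in> quiver_paths G"
    "(awlast u (ys @ [a, b]), zs) \<in> quiver_paths G"
    using x(1) quiver_paths_append[of u ys "[a, b] @ zs"] quiver_paths_append[of "awlast u ys" "[a, b]" zs]
      awlast_append[of u ys "[a, b]"] unfolding up p(1) by simp_all
  then have ab: "a \<in> arcs G" "b \<in> arcs G" "head G a = tail G b" "awlast u ys = tail G a"
    by (auto simp: quiver_paths_Cons)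
  have m: "path_elem (u, ys) \<otimes>\<^bsub>path_algebra G\<^esub> path_elem (awlast u ys, [a, b]) \<in> J"
    using J.I_l_closed[OF gens[OF p(2) ab(1-3)] path_elem_closed[OF paths(1)]] ab(4) by simp
  have "path_elem (u, ys) \<otimes>\<^bsub>path_algebra G\<^esub> path_elem (awlast u ys, [a, b]) \<otimes>\<^bsub>path_algebra G\<^esub>
      path_elem (awlast u (ys @ [a, b]), zs) \<in> J"
    using J.I_r_closed[OF m path_elem_closed[OF paths(3)]] .
  then show ?thesis unfolding path_algebra_simps(6) path_elem_append up p(1) by simp
qed

lemma bad_support_in_ideal:
  fixes J :: "('a \<times> 'b list \<Rightarrow> 'k::field) set"
  assumes J: "ideal J (path_algebra G)"
    and gens: "\<And>a b. \<lbrakk>rel a b; a \<in> arcs G; b \<in> arcs G; head G a = tail G b\<rbrakk> \<Longrightarrow> path_elem (tail G a, [a, b]) \<in> J"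
    and f: "f \<in> carrier (path_algebra G)" "bad_support rel f"
  shows "f \<in> J"
proof (rule path_elem_span[OF J f(1)])
  fix x assume "f x \<noteq> 0"
  then show "path_elem x \<in> J"
    using f unfolding bad_support_def path_algebra_simps(1) by (intro bad_path_elem_in_ideal[OF J gens]) auto
qed

text \<open>Makes the results on finitely supported elements available for ideals of the complete
  path algebra.\<close>

lemma ideal_contraction:
  fixes J :: "('a \<times> 'b list \<Rightarrow> 'k::field) set"
  assumes J: "ideal J (complete_path_algebra G)"
  shows "ideal (J \<inter> carrier (path_algebra G)) (path_algebra G)"
proof -
  interpret J: ideal J "complete_path_algebra G" by fact
  interpret P: ring "path_algebra G :: ('k, 'a \<times> 'b list \<Rightarrow> 'k) module" by (rule ring_path_algebra)
  show ?thesis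
  proof (rule P.ideal_intro)
    show "\<zero>\<^bsub>path_algebra G\<^esub> \<in> J \<inter> carrier (path_algebra G)"
      using ideal_zero[OF J] P.zero_closed by (simp add: path_algebra_simps(2) complete_path_algebra_simps(2))
  next
    fix x y assume "x \<in> J \<inter> carrier (path_algebra G)" "y \<in> J \<inter> carrier (path_algebra G)"
    then show "x \<oplus>\<^bsub>path_algebra G\<^esub> y \<in> J \<inter> carrier (path_algebra G)"
      using ideal_add[OF J, of x y] P.a_closed[of x y] by (simp add: path_algebra_simps(3) complete_path_algebra_simps(3))
  next
    fix r x :: "'a \<times> 'b list \<Rightarrow> 'k"
    assume "r \<in> carrier (path_algebra G)" "x \<in> J \<inter> carrier (path_algebra G)"
    moreover from this have "r \<in> carrier (complete_path_algebra G)" using path_algebra_subset by blast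
    ultimately show "r \<otimes>\<^bsub>path_algebra G\<^esub> x \<in> J \<inter> carrier (path_algebra G)"
      "x \<otimes>\<^bsub>path_algebra G\<^esub> r \<in> J \<inter> carrier (path_algebra G)"
      using J.I_l_closed[of x r] J.I_r_closed[of x r] P.m_closed[of r x] P.m_closed[of x r]
      by (simp_all add: path_algebra_simps(6))
  qed auto
qed

lemma finite_short_paths: "finite {x \<in> quiver_paths G. length (snd x) \<le> m}"
proof (rule finite_subset)
  show "{x \<in> quiver_paths G. length (snd x) \<le> m} \<subseteq> verts G \<times> {p. set p \<subseteq> arcs G \<and> length p \<le> m}"
    by (auto simp: quiver_paths_iff awalk_def)
qed (simp add: finite_lists_length_le)

text \<open>Even an infinite combination of long paths is a finite sum of products: group its terms
  by their initial segment of length \<open>m\<close>, of which there are finitely many, and factor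
  the segment out. Hence an ideal not assumed closed contains it.\<close>

lemma long_paths_in_ideal:
  fixes J :: "('a \<times> 'b list \<Rightarrow> 'k::field) set"
  assumes J: "ideal J (complete_path_algebra G)"
    and m: "\<And>x. \<lbrakk>x \<in> quiver_paths G; length (snd x) = m\<rbrakk> \<Longrightarrow> path_elem x \<in> J"
    and f: "f \<in> carrier (complete_path_algebra G)" "\<And>x. f x \<noteq> 0 \<Longrightarrow> m \<le> length (snd x)"
  shows "f \<in> J"
proof -
  interpret J: ideal J "complete_path_algebra G" by fact
  have "\<forall>f \<in> carrier (complete_path_algebra G). (\<forall>x. f x \<noteq> 0 \<longrightarrow> m \<le> length (snd x) \<and> (fst x, take m (snd x)) \<in> S) \<longrightarrow> f \<in> J"
    if "finite S" "S \<subseteq> {x \<in> quiver_paths G. length (snd x) = m}" for S :: "('a \<times> 'b list) set"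
    using that
  proof (induction S)
    case empty
    show ?case
    proof (intro ballI impI)
      fix f :: "'a \<times> 'b list \<Rightarrow> 'k"
      assume "\<forall>x. f x \<noteq> 0 \<longrightarrow> m \<le> length (snd x) \<and> (fst x, take m (snd x)) \<in> {}"
      then have "f = \<zero>\<^bsub>complete_path_algebra G\<^esub>" unfolding complete_path_algebra_simps(2) by auto
      then show "f \<in> J" using ideal_zero[OF J] by simp
    qed
  next
    case (insert y S)
    obtain u p where y: "y = (u, p)" by fastforce
    have yp: "(u, p) \<in> quiver_paths G" "length p = m" using insert.prems y by auto
    show ?case
    proof (intro ballI impI)
      fix f :: "'a \<times> 'b list \<Rightarrow> 'k"
      assume f: "f \<in> carrier (complete_path_algebra G)"
        and s: "\<forall>x. f x \<noteq> 0 \<longrightarrow> m \<le> length (snd x) \<and> (fst x, take m (snd x)) \<in> insert y S"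
      \<comment> \<open>\<open>g\<close> is what follows the segment \<open>p\<close> in
        \<open>f\<close>, so p times \<open>g\<close> collects the terms that begin with
        \<open>p\<close>, and \<open>h\<close> the others.\<close>
      define g where "g = (\<lambda>(w, q). if w = awlast u p then f (u, p @ q) else 0)"
      define h where "h = (\<lambda>x. if (fst x, take m (snd x)) = y then 0 else f x)"
      have g: "g \<in> carrier (complete_path_algebra G)"
        unfolding complete_path_algebra_simps
      proof (intro CollectI allI impI)
        fix x assume "g x \<noteq> 0"
        then have "fst x = awlast u p" "f (u, p @ snd x) \<noteq> 0" unfolding g_def by (auto split: prod.splits if_splits)
        then show "x \<in> quiver_paths G"
          using support_path[OF f] quiver_paths_append[of u p "snd x"] by (metis prod.collapse)
      qed
      have h: "h \<in> carrier (complete_path_algebra G)"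
        using f unfolding complete_path_algebra_simps h_def by auto
      have "\<forall>x. h x \<noteq> 0 \<longrightarrow> m \<le> length (snd x) \<and> (fst x, take m (snd x)) \<in> S"
        using s unfolding h_def by auto
      then have "h \<in> J" using insert.IH insert.prems h by blast
      moreover have "path_elem y \<otimes>\<^bsub>complete_path_algebra G\<^esub> g \<in> J"
        using J.I_r_closed[OF m g] insert.prems by auto
      moreover have "f = h \<oplus>\<^bsub>complete_path_algebra G\<^esub> (path_elem y \<otimes>\<^bsub>complete_path_algebra G\<^esub> g)"
      proof
        fix x :: "'a \<times> 'b list"
        obtain w q where x: "x = (w, q)" by fastforce
        have "p @ drop m q = q" if "take m q = p" using that append_take_drop_id[of m q] by simp
        then show "f x = (h \<oplus>\<^bsub>complete_path_algebra G\<^esub> (path_elem y \<otimes>\<^bsub>complete_path_algebra G\<^esub> g)) x"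
          unfolding x y complete_path_algebra_simps(3) path_elem_mult h_def g_def using yp(2) by auto
      qed
      ultimately show "f \<in> J" using ideal_add[OF J] by metis
    qed
  qed
  moreover have "finite {x \<in> quiver_paths G. length (snd x) = m}"
    by (rule finite_subset[OF _ finite_short_paths[of m]]) auto
  moreover have "(fst x, take m (snd x)) \<in> {x \<in> quiver_paths G. length (snd x) = m}" if "f x \<noteq> 0" for x
    using support_path[OF f(1) that] f(2)[OF that] quiver_paths_append[of "fst x" "take m (snd x)" "drop m (snd x)"]
    by simp
  ultimately show ?thesis using f by blast
qed

text \<open>Split at length \<open>m\<close>: the short part has finite support, and the long part
  is handled by \<open>long_paths_in_ideal\<close>, as every path of length \<open>m\<close>
  contains a relation.\<close>

lemma bad_support_in_ideal_complete:
  fixes J :: "('a \<times> 'b list \<Rightarrow> 'k::field) set"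
  assumes J: "ideal J (complete_path_algebra G)"
    and gens: "\<And>a b. \<lbrakk>rel a b; a \<in> arcs G; b \<in> arcs G; head G a = tail G b\<rbrakk> \<Longrightarrow> path_elem (tail G a, [a, b]) \<in> J"
    and m: "\<And>x. \<lbrakk>x \<in> quiver_paths G; length (snd x) = m\<rbrakk> \<Longrightarrow> \<not> avoids rel (snd x)"
    and f: "f \<in> carrier (complete_path_algebra G)" "bad_support rel f"
  shows "f \<in> J"
proof -
  interpret J: ideal J "complete_path_algebra G" by fact
  note J' = ideal_contraction[OF J]
  have gens': "path_elem (tail G a, [a, b]) \<in> J \<inter> carrier (path_algebra G)"
    if "rel a b" "a \<in> arcs G" "b \<in> arcs G" "head G a = tail G b" for a b
    using gens[OF that] that by (auto intro!: path_elem_closed simp: quiver_paths_Cons quiver_paths_Nil)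
  define g where "g = (\<lambda>x. if length (snd x) \<le> m then f x else 0)"
  define h where "h = (\<lambda>x. if length (snd x) \<le> m then 0 else f x)"
  have "{x. g x \<noteq> 0} \<subseteq> {x \<in> quiver_paths G. length (snd x) \<le> m}"
    using support_path[OF f(1)] unfolding g_def by auto
  then have "g \<in> carrier (path_algebra G)"
    using finite_subset[OF _ finite_short_paths] unfolding path_algebra_simps by blast
  moreover have "bad_support rel g" using f(2) unfolding bad_support_def g_def by simp
  ultimately have "g \<in> J" using bad_support_in_ideal[OF J' gens'] by blast
  moreover have "h \<in> J"
  proof (rule long_paths_in_ideal[OF J])
    show "path_elem x \<in> J" if "x \<in> quiver_paths G" "length (snd x) = m" for x
      using bad_path_elem_in_ideal[OF J' gens' that(1) m[OF that]] by blast
    show "h \<in> carrier (complete_path_algebra G)" using f(1) unfolding complete_path_algebra_simps h_def by auto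
    show "m \<le> length (snd x)" if "h x \<noteq> 0" for x using that unfolding h_def by (auto split: if_splits)
  qed
  moreover have "f = g \<oplus>\<^bsub>complete_path_algebra G\<^esub> h"
    unfolding complete_path_algebra_simps g_def h_def by auto
  ultimately show ?thesis using ideal_add[OF J] by metis
qed

end

section \<open>Triangle potentials\<close>

lemma quotient_algebra_simps:
  "carrier (quotient_algebra A I) = carrier (A Quot I)"
  "monoid.mult (quotient_algebra A I) = monoid.mult (A Quot I)"
  "one (quotient_algebra A I) = one (A Quot I)"
  "zero (quotient_algebra A I) = zero (A Quot I)"
  "add (quotient_algebra A I) = add (A Quot I)"
  "smult (quotient_algebra A I) = (\<lambda>c X. \<Union>x\<in>X. I +>\<^bsub>A\<^esub> (c \<odot>\<^bsub>A\<^esub> x))"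
  by (simp_all add: quotient_algebra_def ring.defs module.defs)

lemma coset_eqI:
  assumes I: "ideal I R" and x: "x \<in> carrier R" and j: "j \<in> I"
  shows "I +>\<^bsub>R\<^esub> (j \<oplus>\<^bsub>R\<^esub> x) = I +>\<^bsub>R\<^esub> x"
proof -
  interpret ideal I R by fact
  have "j \<oplus>\<^bsub>R\<^esub> x \<in> I +>\<^bsub>R\<^esub> x" using j unfolding a_r_coset_def' by blast
  then show ?thesis using a_repr_independence[OF _ x a_subgroup] by simp
qed

lemma coset_elemE:
  assumes "y \<in> I +>\<^bsub>R\<^esub> x"
  obtains j where "j \<in> I" "y = j \<oplus>\<^bsub>R\<^esub> x"
  using assms unfolding a_r_coset_def' by blast

lemma quotient_carrier: "carrier (R Quot I) = (\<lambda>x. I +>\<^bsub>R\<^esub> x) ` carrier R"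
  by (auto simp: FactRing_def A_RCOSETS_def')

text \<open>\<open>quotient_algebra\<close> defines a scalar multiple as a union over all
  representatives. The union collapses because every representative yields the same coset.\<close>

lemma smult_coset:
  assumes I: "ideal I (A :: ('k, 'a) module)" and x: "x \<in> carrier A"
    and sI: "\<And>i. i \<in> I \<Longrightarrow> c \<odot>\<^bsub>A\<^esub> i \<in> I"
    and sc: "\<And>y. y \<in> carrier A \<Longrightarrow> c \<odot>\<^bsub>A\<^esub> y \<in> carrier A"
    and add: "\<And>y z. \<lbrakk>y \<in> carrier A; z \<in> carrier A\<rbrakk> \<Longrightarrow> c \<odot>\<^bsub>A\<^esub> (y \<oplus>\<^bsub>A\<^esub> z) = c \<odot>\<^bsub>A\<^esub> y \<oplus>\<^bsub>A\<^esub> c \<odot>\<^bsub>A\<^esub> z"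
  shows "c \<odot>\<^bsub>quotient_algebra A I\<^esub> (I +>\<^bsub>A\<^esub> x) = I +>\<^bsub>A\<^esub> (c \<odot>\<^bsub>A\<^esub> x)"
proof -
  interpret ideal I A by fact
  have "I +>\<^bsub>A\<^esub> (c \<odot>\<^bsub>A\<^esub> y) = I +>\<^bsub>A\<^esub> (c \<odot>\<^bsub>A\<^esub> x)" if y: "y \<in> I +>\<^bsub>A\<^esub> x" for y
  proof -
    obtain j where j: "j \<in> I" "y = j \<oplus>\<^bsub>A\<^esub> x" using coset_elemE[OF y] .
    then have "c \<odot>\<^bsub>A\<^esub> y = c \<odot>\<^bsub>A\<^esub> j \<oplus>\<^bsub>A\<^esub> c \<odot>\<^bsub>A\<^esub> x" using add[OF Icarr x] by simp
    then show ?thesis using coset_eqI[OF I sc[OF x] sI[OF j(1)]] by simp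
  qed
  then show ?thesis using a_rcos_self[OF x] unfolding quotient_algebra_simps(6) by blast
qed

text \<open>\<open>r\<close> induces a map A/I -> B/J, injective by \<open>ker\<close> and onto by
  \<open>surj\<close>. The isomorphism wanted goes the other way, so \<open>h\<close> chooses a
  representative in the image of \<open>r\<close>; by \<open>ker\<close> its class does not depend
  on the choice.\<close>

lemma quotient_algebra_iso:
  fixes A :: "('k, 'a) module" and B :: "('k, 'b) module"
  assumes I: "ideal I A" and J: "ideal J B" and r: "r \<in> ring_hom A B"
    and rs: "\<And>c x. x \<in> carrier A \<Longrightarrow> r (c \<odot>\<^bsub>A\<^esub> x) = c \<odot>\<^bsub>B\<^esub> r x"
    and sI: "\<And>c i. i \<in> I \<Longrightarrow> c \<odot>\<^bsub>A\<^esub> i \<in> I" and sJ: "\<And>c i. i \<in> J \<Longrightarrow> c \<odot>\<^bsub>B\<^esub> i \<in> J"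
    and scA: "\<And>c y. y \<in> carrier A \<Longrightarrow> c \<odot>\<^bsub>A\<^esub> y \<in> carrier A"
    and scB: "\<And>c y. y \<in> carrier B \<Longrightarrow> c \<odot>\<^bsub>B\<^esub> y \<in> carrier B"
    and addA: "\<And>c y z. \<lbrakk>y \<in> carrier A; z \<in> carrier A\<rbrakk> \<Longrightarrow> c \<odot>\<^bsub>A\<^esub> (y \<oplus>\<^bsub>A\<^esub> z) = c \<odot>\<^bsub>A\<^esub> y \<oplus>\<^bsub>A\<^esub> c \<odot>\<^bsub>A\<^esub> z"
    and addB: "\<And>c y z. \<lbrakk>y \<in> carrier B; z \<in> carrier B\<rbrakk> \<Longrightarrow> c \<odot>\<^bsub>B\<^esub> (y \<oplus>\<^bsub>B\<^esub> z) = c \<odot>\<^bsub>B\<^esub> y \<oplus>\<^bsub>B\<^esub> c \<odot>\<^bsub>B\<^esub> z"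
    and ker: "\<And>x. x \<in> carrier A \<Longrightarrow> r x \<in> J \<longleftrightarrow> x \<in> I"
    and surj: "\<And>y. y \<in> carrier B \<Longrightarrow> \<exists>x\<in>carrier A. \<exists>j\<in>J. y = j \<oplus>\<^bsub>B\<^esub> r x"
  shows "algebra_isomorphic (quotient_algebra B J) (quotient_algebra A I)"
proof -
  interpret I: ideal I A by fact
  interpret J: ideal J B by fact
  interpret r: ring_hom_ring A B r using r I.ring_axioms J.ring_axioms by (intro ring_hom_ringI2)
  have coset_iff: "J +>\<^bsub>B\<^esub> r x = J +>\<^bsub>B\<^esub> r y \<longleftrightarrow> I +>\<^bsub>A\<^esub> x = I +>\<^bsub>A\<^esub> y"
    if x: "x \<in> carrier A" and y: "y \<in> carrier A" for x y
  proof -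
    have "r x \<ominus>\<^bsub>B\<^esub> r y = r (x \<ominus>\<^bsub>A\<^esub> y)" using x y by (simp add: a_minus_def)
    then have "r x \<ominus>\<^bsub>B\<^esub> r y \<in> J \<longleftrightarrow> x \<ominus>\<^bsub>A\<^esub> y \<in> I" using ker[OF I.minus_closed[OF x y]] by simp
    then show ?thesis
      unfolding J.quotient_eq_iff_same_a_r_cos[OF J r.hom_closed[OF x] r.hom_closed[OF y]]
        I.quotient_eq_iff_same_a_r_cos[OF I x y] .
  qed
  have rep: "\<exists>x\<in>carrier A. Y = J +>\<^bsub>B\<^esub> r x" if Y: "Y \<in> carrier (B Quot J)" for Y
  proof -
    obtain y where y: "y \<in> carrier B" "Y = J +>\<^bsub>B\<^esub> y" using Y unfolding quotient_carrier by blast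
    obtain x j where x: "x \<in> carrier A" "j \<in> J" "y = j \<oplus>\<^bsub>B\<^esub> r x" using surj[OF y(1)] by blast
    then have "Y = J +>\<^bsub>B\<^esub> r x" using coset_eqI[OF J r.hom_closed[OF x(1)] x(2)] y(2) by simp
    then show ?thesis using x(1) by blast
  qed
  define h where "h Y = I +>\<^bsub>A\<^esub> (SOME x. x \<in> carrier A \<and> Y = J +>\<^bsub>B\<^esub> r x)" for Y
  have h: "h (J +>\<^bsub>B\<^esub> r x) = I +>\<^bsub>A\<^esub> x" if x: "x \<in> carrier A" for x
  proof -
    let ?x = "SOME x'. x' \<in> carrier A \<and> J +>\<^bsub>B\<^esub> r x = J +>\<^bsub>B\<^esub> r x'"
    have "?x \<in> carrier A \<and> J +>\<^bsub>B\<^esub> r x = J +>\<^bsub>B\<^esub> r ?x" by (rule someI_ex) (use x in blast)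
    then show ?thesis using coset_iff[OF x] unfolding h_def by metis
  qed
  have "h \<in> ring_iso (quotient_algebra B J) (quotient_algebra A I)"
    unfolding ring_iso_def
  proof (intro CollectI conjI ring_hom_memI)
    fix Y assume "Y \<in> carrier (quotient_algebra B J)"
    then obtain x where "x \<in> carrier A" "Y = J +>\<^bsub>B\<^esub> r x" using rep unfolding quotient_algebra_simps by blast
    then show "h Y \<in> carrier (quotient_algebra A I)" using h by (auto simp: quotient_algebra_simps quotient_carrier)
  next
    fix Y Z assume "Y \<in> carrier (quotient_algebra B J)" "Z \<in> carrier (quotient_algebra B J)"
    then obtain x z where xz: "x \<in> carrier A" "Y = J +>\<^bsub>B\<^esub> r x" "z \<in> carrier A" "Z = J +>\<^bsub>B\<^esub> r z"
      using rep unfolding quotient_algebra_simps by metis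
    have "Y \<otimes>\<^bsub>B Quot J\<^esub> Z = J +>\<^bsub>B\<^esub> r (x \<otimes>\<^bsub>A\<^esub> z)"
      using xz by (simp add: FactRing_def J.rcoset_mult_add)
    then show "h (Y \<otimes>\<^bsub>quotient_algebra B J\<^esub> Z) = h Y \<otimes>\<^bsub>quotient_algebra A I\<^esub> h Z"
      using xz h h[OF I.m_closed[OF xz(1,3)]]
      by (simp del: r.hom_mult add: quotient_algebra_simps FactRing_def I.rcoset_mult_add)
    have "Y \<oplus>\<^bsub>B Quot J\<^esub> Z = J +>\<^bsub>B\<^esub> r (x \<oplus>\<^bsub>A\<^esub> z)"
      using xz by (simp add: FactRing_def J.a_rcos_sum)
    then show "h (Y \<oplus>\<^bsub>quotient_algebra B J\<^esub> Z) = h Y \<oplus>\<^bsub>quotient_algebra A I\<^esub> h Z"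
      using xz h h[OF I.a_closed[OF xz(1,3)]]
      by (simp del: r.hom_add add: quotient_algebra_simps FactRing_def I.a_rcos_sum)
  next
    show "h \<one>\<^bsub>quotient_algebra B J\<^esub> = \<one>\<^bsub>quotient_algebra A I\<^esub>"
      using h[OF I.one_closed] by (simp add: quotient_algebra_simps FactRing_def)
  next
    show "bij_betw h (carrier (quotient_algebra B J)) (carrier (quotient_algebra A I))"
      unfolding bij_betw_def
    proof
      show "inj_on h (carrier (quotient_algebra B J))"
      proof (rule inj_onI)
        fix Y Z assume YZ: "Y \<in> carrier (quotient_algebra B J)" "Z \<in> carrier (quotient_algebra B J)" and eq: "h Y = h Z"
        then obtain x z where "x \<in> carrier A" "Y = J +>\<^bsub>B\<^esub> r x" "z \<in> carrier A" "Z = J +>\<^bsub>B\<^esub> r z"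
          using rep unfolding quotient_algebra_simps by metis
        then show "Y = Z" using eq h coset_iff by metis
      qed
      show "h ` carrier (quotient_algebra B J) = carrier (quotient_algebra A I)"
      proof
        show "h ` carrier (quotient_algebra B J) \<subseteq> carrier (quotient_algebra A I)"
          using rep h unfolding quotient_algebra_simps quotient_carrier[of A I] by fastforce
        show "carrier (quotient_algebra A I) \<subseteq> h ` carrier (quotient_algebra B J)"
        proof
          fix X assume "X \<in> carrier (quotient_algebra A I)"
          then obtain x where x: "x \<in> carrier A" "X = I +>\<^bsub>A\<^esub> x" unfolding quotient_algebra_simps quotient_carrier by blast
          have "J +>\<^bsub>B\<^esub> r x \<in> carrier (quotient_algebra B J)"
            using x(1) unfolding quotient_algebra_simps quotient_carrier by simp
          then show "X \<in> h ` carrier (quotient_algebra B J)" using h[OF x(1)] x(2) by (metis imageI)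
        qed
      qed
    qed
  qed
  moreover from this have "h \<in> linear_maps (quotient_algebra B J) (quotient_algebra A I)"
    unfolding linear_maps_def
  proof (intro CollectI conjI ballI allI)
    assume "h \<in> ring_iso (quotient_algebra B J) (quotient_algebra A I)"
    then have rh: "h \<in> ring_hom (quotient_algebra B J) (quotient_algebra A I)" unfolding ring_iso_def by blast
    show "h \<in> carrier (quotient_algebra B J) \<rightarrow> carrier (quotient_algebra A I)"
      using ring_hom_closed[OF rh] by blast
    show "h (Y \<oplus>\<^bsub>quotient_algebra B J\<^esub> Z) = h Y \<oplus>\<^bsub>quotient_algebra A I\<^esub> h Z"
      if "Y \<in> carrier (quotient_algebra B J)" "Z \<in> carrier (quotient_algebra B J)" for Y Z
      using ring_hom_add[OF rh that] .
    fix c Y assume "Y \<in> carrier (quotient_algebra B J)"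
    then obtain x where x: "x \<in> carrier A" "Y = J +>\<^bsub>B\<^esub> r x" using rep unfolding quotient_algebra_simps by blast
    have "c \<odot>\<^bsub>quotient_algebra B J\<^esub> Y = J +>\<^bsub>B\<^esub> r (c \<odot>\<^bsub>A\<^esub> x)"
      using smult_coset[OF J, of "r x" c] sJ scB addB x rs by simp
    then show "h (c \<odot>\<^bsub>quotient_algebra B J\<^esub> Y) = c \<odot>\<^bsub>quotient_algebra A I\<^esub> h Y"
      using smult_coset[OF I x(1), of c] sI scA addA x h by simp
  qed
  ultimately show ?thesis unfolding algebra_isomorphic_def by blast
qed

definition triangle_potential :: "('b \<Rightarrow> 'b \<Rightarrow> bool) \<Rightarrow> ('a, 'b) pre_digraph \<Rightarrow> 'a \<times> 'b list \<Rightarrow> 'k::field" where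
  "triangle_potential rel Q x =
    (if \<exists>a b c. x = (tail Q a, [a, b, c]) \<and> rel a b \<and> rel b c \<and> rel c a then 1 else 0)"

context fin_digraph
begin

lemma triangle_potential_nonzeroE:
  assumes "triangle_potential rel G x \<noteq> 0"
  obtains a b c where "x = (tail G a, [a, b, c])" "rel a b" "rel b c" "rel c a"
proof (cases "\<exists>a b c. x = (tail G a, [a, b, c]) \<and> rel a b \<and> rel b c \<and> rel c a")
  case True
  then show thesis using that by blast
next
  case False
  then have "triangle_potential rel G x = 0" unfolding triangle_potential_def by (rule if_not_P)
  with assms show thesis by contradiction
qed

lemma potential_triangle:
  assumes rel: "\<And>a b. rel a b \<Longrightarrow> a \<in> arcs G \<and> b \<in> arcs G \<and> head G a = tail G b"
  shows "potential G (triangle_potential rel G)"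
  unfolding potential_def
proof (intro allI impI)
  fix x assume "triangle_potential rel G x \<noteq> 0"
  then obtain a b c where "x = (tail G a, [a, b, c])" "rel a b" "rel b c" "rel c a"
    by (rule triangle_potential_nonzeroE)
  then show "x \<in> quiver_cycles G"
    using rel[of a b] rel[of b c] rel[of c a] by (simp add: quiver_cycles_def awalk_simps)
qed

text \<open>A contributing cycle is one arrow longer than \<open>y\<close>. Finiteness matters
  because a sum over an infinite set is 0 by convention.\<close>

lemma finite_derivative_index:
  "finite {(x, r). x \<in> quiver_cycles G \<and> r < length (snd x) \<and> snd x ! r = \<gamma> \<and>
     (head G \<gamma>, drop (Suc r) (snd x) @ take r (snd x)) = y}"
proof (rule finite_subset)
  let ?n = "Suc (length (snd y))"
  show "{(x, r). x \<in> quiver_cycles G \<and> r < length (snd x) \<and> snd x ! r = \<gamma> \<and>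
     (head G \<gamma>, drop (Suc r) (snd x) @ take r (snd x)) = y} \<subseteq>
    {x \<in> quiver_paths G. length (snd x) \<le> ?n} \<times> {..?n}"
    by (auto simp: quiver_cycles_def quiver_paths_def)
qed (simp add: finite_short_paths)

text \<open>The sum runs over pairs of a cycle and a position. So the three members of
  \<open>?T\<close> stay distinct even if the three rotations coincide, and the coefficient is 3 in
  all cases.\<close>

lemma cyclic_derivative_triangle:
  assumes rel: "\<And>a b. rel a b \<Longrightarrow> a \<in> arcs G \<and> b \<in> arcs G \<and> head G a = tail G b"
  shows "cyclic_derivative G \<gamma> (triangle_potential rel G :: _ \<Rightarrow> 'k::field) y =
    (if \<exists>a b. y = (head G \<gamma>, [a, b]) \<and> rel \<gamma> a \<and> rel a b \<and> rel b \<gamma> then 3 else 0)"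
proof -
  let ?W = "triangle_potential rel G :: _ \<Rightarrow> 'k"
  let ?S = "{(x, r). x \<in> quiver_cycles G \<and> r < length (snd x) \<and> snd x ! r = \<gamma> \<and>
     (head G \<gamma>, drop (Suc r) (snd x) @ take r (snd x)) = y}"
  have supp: "\<exists>a b. y = (head G \<gamma>, [a, b]) \<and> rel \<gamma> a \<and> rel a b \<and> rel b \<gamma> \<and>
      (x, r) \<in> {((tail G \<gamma>, [\<gamma>, a, b]), 0), ((tail G b, [b, \<gamma>, a]), 1), ((tail G a, [a, b, \<gamma>]), 2)}"
    if S: "(x, r) \<in> ?S" and W: "?W x \<noteq> 0" for x r
  proof -
    obtain a b c where x: "x = (tail G a, [a, b, c])" and r: "rel a b" "rel b c" "rel c a"
      using W by (rule triangle_potential_nonzeroE)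
    from S x have "r < 3" and g: "[a, b, c] ! r = \<gamma>" and y: "y = (head G \<gamma>, drop (Suc r) [a, b, c] @ take r [a, b, c])"
      by auto
    from \<open>r < 3\<close> have "r = 0 \<or> r = 1 \<or> r = 2" by auto
    then show ?thesis using g y x r by auto
  qed
  show ?thesis
  proof (cases "\<exists>a b. y = (head G \<gamma>, [a, b]) \<and> rel \<gamma> a \<and> rel a b \<and> rel b \<gamma>")
    case False
    then have "?W x = 0" if "(x, r) \<in> ?S" for x r using supp[OF that] by blast
    then have "cyclic_derivative G \<gamma> ?W y = 0"
      unfolding cyclic_derivative_def by (intro sum.neutral) auto
    then show ?thesis unfolding if_not_P[OF False] .
  next
    case True
    then obtain a b where y: "y = (head G \<gamma>, [a, b])" and r: "rel \<gamma> a" "rel a b" "rel b \<gamma>" by blast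
    let ?T = "{((tail G \<gamma>, [\<gamma>, a, b]), 0), ((tail G b, [b, \<gamma>, a]), 1), ((tail G a, [a, b, \<gamma>]), 2::nat)}"
    have W1: "?W x = 1" if "(x, r) \<in> ?T" for x r
      using that r unfolding triangle_potential_def by auto
    have TS: "?T \<subseteq> ?S"
      using rel[OF r(1)] rel[OF r(2)] rel[OF r(3)] y by (auto simp: quiver_cycles_def awalk_simps)
    have "cyclic_derivative G \<gamma> ?W y = (\<Sum>(x, r)\<in>?T. ?W x)"
      unfolding cyclic_derivative_def
    proof (rule sum.mono_neutral_right[OF finite_derivative_index TS])
      show "\<forall>z\<in>?S - ?T. (case z of (x, r) \<Rightarrow> ?W x) = 0"
        using supp y by fastforce
    qed
    also have "\<dots> = (\<Sum>z\<in>?T. 1)" using W1 by (intro sum.cong) auto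
    also have "\<dots> = 3" by simp
    finally show ?thesis unfolding if_P[OF True] .
  qed
qed

text \<open>For a relation \<open>rel a b\<close> with closing arrow \<open>c\<close>, uniqueness of
  continuations reduces the derivative at \<open>c\<close> to the single term 3ab, and dividing by 3
  recovers the generator. \<open>m\<close> makes every infinite combination of bad paths a member of
  the ideal generated algebraically.\<close>

lemma jacobian_ideal_triangle:
  assumes rel: "\<And>a b. rel a b \<Longrightarrow> a \<in> arcs G \<and> b \<in> arcs G \<and> head G a = tail G b"
    and uniq: "\<And>a b b'. rel a b \<Longrightarrow> rel a b' \<Longrightarrow> b = b'"
    and tri: "\<And>a b. rel a b \<Longrightarrow> \<exists>c. rel b c \<and> rel c a"
    and m: "\<And>x. \<lbrakk>x \<in> quiver_paths G; length (snd x) = m\<rbrakk> \<Longrightarrow> \<not> avoids rel (snd x)"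
    and char: "(3::'k::field) \<noteq> 0"
  shows "Idl\<^bsub>complete_path_algebra G\<^esub> ((\<lambda>\<alpha>. cyclic_derivative G \<alpha> (triangle_potential rel G)) ` arcs G) =
    {f \<in> carrier (complete_path_algebra G :: ('k, 'a \<times> 'b list \<Rightarrow> 'k) module). bad_support rel f}" (is "?J = ?B")
proof
  let ?K = "complete_path_algebra G :: ('k, 'a \<times> 'b list \<Rightarrow> 'k) module"
  let ?d = "\<lambda>\<alpha>. cyclic_derivative G \<alpha> (triangle_potential rel G) :: 'a \<times> 'b list \<Rightarrow> 'k"
  interpret K: ring ?K by (rule ring_complete)
  have d_eq: "?d \<gamma> y = (if \<exists>a b. y = (head G \<gamma>, [a, b]) \<and> rel \<gamma> a \<and> rel a b \<and> rel b \<gamma> then 3 else 0)" for \<gamma> y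
    by (rule cyclic_derivative_triangle) (rule rel)
  have dB: "?d ` arcs G \<subseteq> ?B"
  proof
    fix f assume "f \<in> ?d ` arcs G"
    then obtain \<gamma> where f: "f = ?d \<gamma>" by blast
    have *: "\<exists>a b. x = (tail G a, [a, b]) \<and> rel a b" if "f x \<noteq> 0" for x
    proof -
      have "\<exists>a b. x = (head G \<gamma>, [a, b]) \<and> rel \<gamma> a \<and> rel a b \<and> rel b \<gamma>"
        using that unfolding f d_eq by (auto split: if_splits)
      then show ?thesis using rel by metis
    qed
    have "f \<in> carrier ?K"
      unfolding complete_path_algebra_simps
    proof (intro CollectI allI impI)
      fix x assume "f x \<noteq> 0"
      then obtain a b where "x = (tail G a, [a, b])" "rel a b" using * by blast
      then show "x \<in> quiver_paths G" using rel[of a b] by (simp add: quiver_paths_Cons quiver_paths_Nil)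
    qed
    moreover have "bad_support rel f" unfolding bad_support_def using * by fastforce
    ultimately show "f \<in> ?B" by blast
  qed
  show "?J \<subseteq> ?B" by (rule K.genideal_minimal[OF bad_support_ideal_complete dB])
  have dK: "?d ` arcs G \<subseteq> carrier ?K" using dB by blast
  have J: "ideal ?J ?K" by (rule K.genideal_ideal[OF dK])
  show "?B \<subseteq> ?J"
  proof
    fix f assume f: "f \<in> ?B"
    show "f \<in> ?J"
    proof (rule bad_support_in_ideal_complete[OF J _ m])
      fix a b assume ab: "rel a b" "a \<in> arcs G" "b \<in> arcs G" "head G a = tail G b"
      obtain c where c: "rel b c" "rel c a" using tri[OF ab(1)] by blast
      have "(\<exists>a' b'. y = (head G c, [a', b']) \<and> rel c a' \<and> rel a' b' \<and> rel b' c) \<longleftrightarrow> y = (tail G a, [a, b])" for y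
        using c ab(1) rel[OF c(2)] uniq by metis
      then have d: "?d c = (\<lambda>x. 3 * path_elem (tail G a, [a, b]) x)"
        by (intro ext, subst d_eq) (simp add: path_elem_def)
      have "?d c \<in> ?J" using K.genideal_self[OF dK] rel[OF c(1)] by blast
      moreover have "?d c \<in> carrier (path_algebra G)"
      proof -
        have "{x. ?d c x \<noteq> 0} \<subseteq> {(tail G a, [a, b])}" unfolding d path_elem_def by auto
        then have "finite {x. ?d c x \<noteq> 0}" by (rule finite_subset) simp
        then show ?thesis using dK rel[OF c(1)] by (auto simp: path_algebra_def)
      qed
      ultimately have "(\<lambda>x. inverse 3 * ?d c x) \<in> ?J \<inter> carrier (path_algebra G)"
        by (intro ideal_smult[OF ideal_contraction[OF J]]) blast
      moreover have "(\<lambda>x. inverse 3 * ?d c x) = path_elem (tail G a, [a, b])"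
        unfolding d using char by (simp add: mult.assoc[symmetric])
      ultimately show "path_elem (tail G a, [a, b]) \<in> ?J" by simp
    qed (use f in auto)
  qed
qed

end

section \<open>Transport to a quiver on natural numbers\<close>

context fin_digraph
begin

context
  fixes hom :: "('a, 'b, 'c, 'd) digraph_isomorphism"
  assumes hom: "digraph_isomorphism hom"
begin

interpretation H: fin_digraph "app_iso hom G" by (rule fin_digraphI_app_iso[OF hom])

definition unlabel :: "'c \<times> 'd list \<Rightarrow> 'a \<times> 'b list" where
  "unlabel x = (iso_verts (inv_iso hom) (fst x), map (iso_arcs (inv_iso hom)) (snd x))"

definition label :: "'a \<times> 'b list \<Rightarrow> 'c \<times> 'd list" where
  "label x = (iso_verts hom (fst x), map (iso_arcs hom) (snd x))"

text \<open>On the path algebra this combines the renaming with the inclusion into the complete path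
  algebra. Off the paths of the new quiver \<open>unlabel\<close> has no meaning, hence the explicit
  0.\<close>

definition relabel :: "('a \<times> 'b list \<Rightarrow> 'k::field) \<Rightarrow> 'c \<times> 'd list \<Rightarrow> 'k" where
  "relabel f x = (if x \<in> quiver_paths (app_iso hom G) then f (unlabel x) else 0)"

lemma unlabel_path:
  assumes "x \<in> quiver_paths (app_iso hom G)"
  shows "unlabel x \<in> quiver_paths G"
proof -
  obtain u p where x: "x = (u, p)" by fastforce
  have "H.awalk u p (H.awlast u p)" using assms unfolding x H.quiver_paths_iff .
  from awalk_app_isoD[OF this hom] show ?thesis unfolding x unlabel_def quiver_paths_def fst_conv snd_conv by blast
qed

lemma label_path:
  assumes "x \<in> quiver_paths G"
  shows "label x \<in> quiver_paths (app_iso hom G)"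
proof -
  obtain u p where x: "x = (u, p)" by fastforce
  have "awalk u p (awlast u p)" using assms unfolding x quiver_paths_iff .
  from awalk_app_isoI[OF this hom] show ?thesis unfolding x label_def quiver_paths_def fst_conv snd_conv by blast
qed

lemma unlabel_label:
  assumes "x \<in> quiver_paths G"
  shows "unlabel (label x) = x"
proof -
  obtain u p where x: "x = (u, p)" by fastforce
  from assms have "u \<in> verts G" "set p \<subseteq> arcs G" unfolding x quiver_paths_iff awalk_def by blast+
  then have "iso_verts (inv_iso hom) (iso_verts hom u) = u"
    "\<And>a. a \<in> set p \<Longrightarrow> iso_arcs (inv_iso hom) (iso_arcs hom a) = a"
    using iso_verts_inv_iso[OF hom] iso_arcs_inv_iso[OF hom] by blast+
  then show ?thesis unfolding x label_def unlabel_def by (simp add: map_idI)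
qed

lemma label_unlabel: "x \<in> quiver_paths (app_iso hom G) \<Longrightarrow> label (unlabel x) = x"
proof -
  assume x: "x \<in> quiver_paths (app_iso hom G)"
  obtain u p where up: "x = (u, p)" by fastforce
  from x have "u \<in> verts (app_iso hom G)" "set p \<subseteq> arcs (app_iso hom G)"
    unfolding up H.quiver_paths_iff H.awalk_def by blast+
  then have "iso_verts hom (iso_verts (inv_iso hom) u) = u"
    "\<And>a. a \<in> set p \<Longrightarrow> iso_arcs hom (iso_arcs (inv_iso hom) a) = a"
    using iso_verts_iso_inv[OF hom] iso_arcs_iso_inv[OF hom] by blast+
  then show ?thesis unfolding up label_def unlabel_def by (simp add: map_idI)
qed

lemma unlabel_awlast:
  assumes "(u, p) \<in> quiver_paths (app_iso hom G)"
  shows "iso_verts (inv_iso hom) (H.awlast u p) = awlast (iso_verts (inv_iso hom) u) (map (iso_arcs (inv_iso hom)) p)"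
proof -
  have "H.awalk u p (H.awlast u p)" using assms unfolding H.quiver_paths_iff .
  from awalk_app_isoD[OF this hom] show ?thesis by simp
qed

lemma relabel_closed: "relabel f \<in> carrier (complete_path_algebra (app_iso hom G))"
  unfolding complete_path_algebra_simps relabel_def by simp

lemma relabel_mult:
  "relabel (f \<otimes>\<^bsub>complete_path_algebra G\<^esub> g) = relabel f \<otimes>\<^bsub>complete_path_algebra (app_iso hom G)\<^esub> relabel g"
proof
  fix x :: "'c \<times> 'd list"
  obtain u p where x: "x = (u, p)" by fastforce
  show "relabel (f \<otimes>\<^bsub>complete_path_algebra G\<^esub> g) x =
    (relabel f \<otimes>\<^bsub>complete_path_algebra (app_iso hom G)\<^esub> relabel g) x"
  proof (cases "x \<in> quiver_paths (app_iso hom G)")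
    case False
    have "(relabel f \<otimes>\<^bsub>complete_path_algebra (app_iso hom G)\<^esub> relabel g) x = 0"
      using support_path[OF H.mult_closed_complete[OF relabel_closed relabel_closed]] False by blast
    then show ?thesis using False by (simp add: relabel_def)
  next
    case True
    let ?u = "iso_verts (inv_iso hom) u" and ?p = "map (iso_arcs (inv_iso hom)) p"
    have "relabel (f \<otimes>\<^bsub>complete_path_algebra G\<^esub> g) x =
        (\<Sum>i\<le>length p. f (?u, take i ?p) * g (awlast ?u (take i ?p), drop i ?p))"
      using True unfolding relabel_def by (simp add: x unlabel_def mult_path)
    also have "\<dots> = (\<Sum>i\<le>length p. relabel f (u, take i p) * relabel g (H.awlast u (take i p), drop i p))"
    proof (rule sum.cong[OF refl])
      fix i
      have t: "(u, take i p) \<in> quiver_paths (app_iso hom G)"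
        "(H.awlast u (take i p), drop i p) \<in> quiver_paths (app_iso hom G)"
        using True H.quiver_paths_append[of u "take i p" "drop i p"] unfolding x by simp_all
      then show "f (?u, take i ?p) * g (awlast ?u (take i ?p), drop i ?p) =
          relabel f (u, take i p) * relabel g (H.awlast u (take i p), drop i p)"
        using unlabel_awlast[OF t(1)] by (simp add: relabel_def unlabel_def take_map drop_map)
    qed
    also have "\<dots> = (relabel f \<otimes>\<^bsub>complete_path_algebra (app_iso hom G)\<^esub> relabel g) x"
      unfolding x mult_path ..
    finally show ?thesis .
  qed
qed

lemma relabel_one: "relabel \<one>\<^bsub>path_algebra G\<^esub> = \<one>\<^bsub>complete_path_algebra (app_iso hom G)\<^esub>"
proof
  fix x :: "'c \<times> 'd list"
  obtain u p where x: "x = (u, p)" by fastforce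
  show "relabel \<one>\<^bsub>path_algebra G\<^esub> x = \<one>\<^bsub>complete_path_algebra (app_iso hom G)\<^esub> x"
  proof (cases "(u, p) \<in> quiver_paths (app_iso hom G)")
    case True
    have "iso_verts (inv_iso hom) u \<in> verts G"
      using quiver_paths_verts(1)[of "fst (unlabel x)" "snd (unlabel x)"] unlabel_path[OF True] by (simp add: x unlabel_def)
    moreover have "u \<in> verts (app_iso hom G)" using H.quiver_paths_verts(1)[OF True] .
    ultimately show ?thesis
      using True by (simp add: x relabel_def unlabel_def path_algebra_simps(5) complete_path_algebra_simps(5))
  next
    case False
    then have "\<not> (u \<in> verts (app_iso hom G) \<and> p = [])" using H.quiver_paths_Nil[of u] by auto
    then show ?thesis using False by (simp add: x relabel_def complete_path_algebra_simps(5) del: app_iso_simps)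
  qed
qed

lemma relabel_ring_hom:
  "relabel \<in> ring_hom (path_algebra G :: ('k::field, 'a \<times> 'b list \<Rightarrow> 'k) module) (complete_path_algebra (app_iso hom G))"
  by (intro ring_hom_memI)
    (auto simp: relabel_closed relabel_mult path_algebra_simps(3,6) relabel_one complete_path_algebra_simps(3) relabel_def)

end

text \<open>\<open>I\<close> lives in a path algebra and the Jacobian ideal in a complete one. All
  paths of length at least \<open>m\<close> are bad on both sides, so every element of the complete
  algebra is a finitely supported one modulo the ideal, and the two quotients agree.\<close>

lemma monomial_quotient_is_jacobian:
  fixes I :: "('a \<times> 'b list \<Rightarrow> 'k::field) set"
  assumes rel: "\<And>a b. rel a b \<Longrightarrow> a \<in> arcs G \<and> b \<in> arcs G \<and> head G a = tail G b"
    and uniq: "\<And>a b b'. rel a b \<Longrightarrow> rel a b' \<Longrightarrow> b = b'"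
    and tri: "\<And>a b. rel a b \<Longrightarrow> \<exists>c. rel b c \<and> rel c a"
    and m: "\<And>x. \<lbrakk>x \<in> quiver_paths G; length (snd x) = m\<rbrakk> \<Longrightarrow> \<not> avoids rel (snd x)"
    and char: "(3::'k::field) \<noteq> 0"
    and I: "I = {f \<in> carrier (path_algebra G). bad_support rel f}"
  shows "\<exists>(Q' :: (nat, nat) pre_digraph) (W :: nat \<times> nat list \<Rightarrow> 'k).
    fin_digraph Q' \<and> potential Q' W \<and>
    algebra_isomorphic (jacobian_algebra Q' W) (quotient_algebra (path_algebra G) I)"
proof -
  obtain fv :: "'a \<Rightarrow> nat" where fv: "inj_on fv (verts G)"
    using finite_imp_inj_to_nat_seg[OF finite_verts] by blast
  obtain fa :: "'b \<Rightarrow> nat" where fa: "inj_on fa (arcs G)"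
    using finite_imp_inj_to_nat_seg[OF finite_arcs] by blast
  define hom where "hom = \<lparr>iso_verts = fv, iso_arcs = fa,
    iso_head = (\<lambda>a. fv (head G (the_inv_into (arcs G) fa a))),
    iso_tail = (\<lambda>a. fv (tail G (the_inv_into (arcs G) fa a)))\<rparr>"
  have hom: "digraph_isomorphism hom"
    unfolding digraph_isomorphism_def hom_def using fv fa wf_digraph by (simp add: the_inv_into_f_f)
  note ul = unlabel_def[OF hom] and rl = relabel_def[OF hom]
  let ?H = "app_iso hom G"
  interpret H: fin_digraph ?H by (rule fin_digraphI_app_iso[OF hom])
  \<comment> \<open>Membership in \<open>arcs ?H\<close> is demanded explicitly because the inverse
    renaming is arbitrary on other numbers.\<close>
  define rel' where "rel' a b \<longleftrightarrow> a \<in> arcs ?H \<and> b \<in> arcs ?H \<and>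
    rel (iso_arcs (inv_iso hom) a) (iso_arcs (inv_iso hom) b)" for a b
  have inv_arcs: "iso_arcs hom (iso_arcs (inv_iso hom) a) = a" "iso_arcs (inv_iso hom) a \<in> arcs G" if "a \<in> arcs ?H" for a
    using iso_arcs_iso_inv[OF hom that] that hom by auto
  have rel'_hom: "rel' (iso_arcs hom a) (iso_arcs hom b) \<longleftrightarrow> rel a b" if "a \<in> arcs G" "b \<in> arcs G" for a b
    unfolding rel'_def using that iso_arcs_inv_iso[OF hom] by simp
  have rel': "a \<in> arcs ?H \<and> b \<in> arcs ?H \<and> head ?H a = tail ?H b" if "rel' a b" for a b
  proof -
    have ab: "a \<in> arcs ?H" "b \<in> arcs ?H" and r: "rel (iso_arcs (inv_iso hom) a) (iso_arcs (inv_iso hom) b)"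
      using that unfolding rel'_def by auto
    have "iso_head hom a = iso_tail hom b"
      using iso_verts_head[OF hom inv_arcs(2)[OF ab(1)]] iso_verts_tail[OF hom inv_arcs(2)[OF ab(2)]]
        inv_arcs(1)[OF ab(1)] inv_arcs(1)[OF ab(2)] rel[OF r] by simp
    then show ?thesis using ab by simp
  qed
  have uniq': "b = b'" if "rel' a b" "rel' a b'" for a b b'
    using uniq that inv_arcs unfolding rel'_def by metis
  have tri': "\<exists>c. rel' b c \<and> rel' c a" if "rel' a b" for a b
  proof -
    have ab: "a \<in> arcs ?H" "b \<in> arcs ?H" and r: "rel (iso_arcs (inv_iso hom) a) (iso_arcs (inv_iso hom) b)"
      using that unfolding rel'_def by auto
    obtain c where c: "rel (iso_arcs (inv_iso hom) b) c" "rel c (iso_arcs (inv_iso hom) a)" using tri[OF r] by blast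
    have "c \<in> arcs G" using rel[OF c(1)] by blast
    then have "rel' b (iso_arcs hom c)" "rel' (iso_arcs hom c) a"
      using c rel'_hom[of "iso_arcs (inv_iso hom) b" c] rel'_hom[of c "iso_arcs (inv_iso hom) a"] inv_arcs ab by auto
    then show ?thesis by blast
  qed
  have bad: "avoids rel' (snd x) \<longleftrightarrow> avoids rel (snd (unlabel hom x))"
    if "x \<in> quiver_paths ?H" for x
  proof -
    have "set (snd x) \<subseteq> arcs ?H" using that H.quiver_paths_iff[of "fst x" "snd x"] by (simp add: H.awalk_def)
    then show ?thesis
      unfolding ul snd_conv successively_map
      by (intro successively_cong) (auto simp: rel'_def)
  qed
  have m': "\<not> avoids rel' (snd x)" if "x \<in> quiver_paths ?H" "length (snd x) = m" for x
    using bad[OF that(1)] m[OF unlabel_path[OF hom that(1)]] that(2) by (simp add: ul)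
  let ?W = "triangle_potential rel' ?H :: _ \<Rightarrow> 'k"
  let ?J = "{f \<in> carrier (complete_path_algebra ?H :: ('k, _) module). bad_support rel' f}"
  have J: "jacobian_algebra ?H ?W = quotient_algebra (complete_path_algebra ?H) ?J"
    unfolding jacobian_algebra_def
    by (subst H.jacobian_ideal_triangle[of rel' m]) (use rel' uniq' tri' m' char in blast)+
  have "algebra_isomorphic (quotient_algebra (complete_path_algebra ?H) ?J) (quotient_algebra (path_algebra G) I)"
  proof (rule quotient_algebra_iso[OF _ H.bad_support_ideal_complete relabel_ring_hom[OF hom]])
    show II: "ideal I (path_algebra G)" unfolding I by (rule bad_support_ideal_path_algebra)
    show "relabel hom (c \<odot>\<^bsub>path_algebra G\<^esub> x) = c \<odot>\<^bsub>complete_path_algebra ?H\<^esub> relabel hom x" for c :: 'k and x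
      by (auto simp: rl path_algebra_simps(4) complete_path_algebra_simps(4))
    show "c \<odot>\<^bsub>path_algebra G\<^esub> i \<in> I" if "i \<in> I" for c i
      using ideal_smult[OF II that] by (simp add: path_algebra_simps(4))
    show "c \<odot>\<^bsub>complete_path_algebra ?H\<^esub> i \<in> ?J" if "i \<in> ?J" for c i
      using that by (auto simp: complete_path_algebra_simps bad_support_def)
    show "c \<odot>\<^bsub>path_algebra G\<^esub> y \<in> carrier (path_algebra G)" if "y \<in> carrier (path_algebra G)" for c :: 'k and y
    proof -
      have "{x. c * y x \<noteq> 0} \<subseteq> {x. y x \<noteq> 0}" by auto
      then show ?thesis using that finite_subset by (auto simp: path_algebra_simps)
    qed
    show "c \<odot>\<^bsub>complete_path_algebra ?H\<^esub> y \<in> carrier (complete_path_algebra ?H)"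
      if "y \<in> carrier (complete_path_algebra ?H)" for c :: 'k and y
      using that by (simp add: complete_path_algebra_simps)
    show "c \<odot>\<^bsub>path_algebra G\<^esub> (y \<oplus>\<^bsub>path_algebra G\<^esub> z) = c \<odot>\<^bsub>path_algebra G\<^esub> y \<oplus>\<^bsub>path_algebra G\<^esub> c \<odot>\<^bsub>path_algebra G\<^esub> z"
      for c :: 'k and y z by (simp add: path_algebra_simps distrib_left)
    show "c \<odot>\<^bsub>complete_path_algebra ?H\<^esub> (y \<oplus>\<^bsub>complete_path_algebra ?H\<^esub> z) =
      c \<odot>\<^bsub>complete_path_algebra ?H\<^esub> y \<oplus>\<^bsub>complete_path_algebra ?H\<^esub> c \<odot>\<^bsub>complete_path_algebra ?H\<^esub> z"
      for c :: 'k and y z by (simp add: complete_path_algebra_simps distrib_left)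
    show "relabel hom x \<in> ?J \<longleftrightarrow> x \<in> I" if x: "x \<in> carrier (path_algebra G)" for x :: "'a \<times> 'b list \<Rightarrow> 'k"
    proof -
      have "bad_support rel' (relabel hom x) \<longleftrightarrow> bad_support rel x"
        unfolding bad_support_def
      proof (intro iffI allI impI)
        fix y assume a: "\<forall>y. relabel hom x y \<noteq> 0 \<longrightarrow> \<not> avoids rel' (snd y)" and y: "x y \<noteq> 0"
        have yp: "y \<in> quiver_paths G" using y x unfolding path_algebra_simps(1) by blast
        note ly = label_path[OF hom yp]
        have "relabel hom x (label hom y) \<noteq> 0" using y ly unlabel_label[OF hom yp] by (simp add: rl)
        then show "\<not> avoids rel (snd y)" using a bad[OF ly] unlabel_label[OF hom yp] by simp
      next
        fix y assume a: "\<forall>y. x y \<noteq> 0 \<longrightarrow> \<not> avoids rel (snd y)" and y: "relabel hom x y \<noteq> 0"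
        have yp: "y \<in> quiver_paths ?H" "x (unlabel hom y) \<noteq> 0" using y unfolding rl by (auto split: if_splits)
        then show "\<not> avoids rel' (snd y)" using a bad by blast
      qed
      then show ?thesis using relabel_closed[OF hom, of x] x I by auto
    qed
    show "\<exists>x\<in>carrier (path_algebra G). \<exists>j\<in>?J. y = j \<oplus>\<^bsub>complete_path_algebra ?H\<^esub> relabel hom x"
      if y: "y \<in> carrier (complete_path_algebra ?H)" for y :: "nat \<times> nat list \<Rightarrow> 'k"
    proof -
      \<comment> \<open>\<open>x\<close> is the part of \<open>y\<close> of length at most
        \<open>m\<close>, pulled back to \<open>G\<close>; \<open>j\<close> is the longer rest, all
        of whose paths are bad.\<close>
      define x where "x z = (if z \<in> quiver_paths G \<and> length (snd z) \<le> m then y (label hom z) else 0)" for z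
      define j where "j z = (if length (snd z) \<le> m then 0 else y z)" for z
      have "{z. x z \<noteq> 0} \<subseteq> {z \<in> quiver_paths G. length (snd z) \<le> m}" unfolding x_def by auto
      then have "x \<in> carrier (path_algebra G)"
        using finite_subset[OF _ finite_short_paths] unfolding path_algebra_simps by blast
      moreover have "j \<in> ?J"
      proof -
        have "j \<in> carrier (complete_path_algebra ?H)" using y unfolding complete_path_algebra_simps j_def by simp
        moreover have "bad_support rel' j"
          unfolding bad_support_def
        proof (intro allI impI)
          fix z assume "j z \<noteq> 0"
          then have z: "y z \<noteq> 0" "m < length (snd z)" unfolding j_def by (auto split: if_splits)
          have "z \<in> quiver_paths ?H" using support_path[OF y z(1)] .
          then have "(fst z, take m (snd z)) \<in> quiver_paths ?H"
            using H.quiver_paths_append[of "fst z" "take m (snd z)" "drop m (snd z)"] by simp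
          from m'[OF this] have "\<not> avoids rel' (take m (snd z))" using z(2) by simp
          then show "\<not> avoids rel' (snd z)"
            using successively_append_D[of _ "take m (snd z)" "drop m (snd z)"] by auto
        qed
        ultimately show ?thesis by blast
      qed
      moreover have "y = j \<oplus>\<^bsub>complete_path_algebra ?H\<^esub> relabel hom x"
      proof
        fix z
        have "y z = j z + relabel hom x z"
        proof (cases "z \<in> quiver_paths ?H")
          case True
          then show ?thesis using unlabel_path[OF hom True] label_unlabel[OF hom True]
            by (auto simp: rl x_def j_def ul)
        next
          case False
          then have "y z = 0" using support_path[OF y] by blast
          then show ?thesis using False by (simp add: rl j_def)
        qed
        then show "y z = (j \<oplus>\<^bsub>complete_path_algebra ?H\<^esub> relabel hom x) z" by (simp add: complete_path_algebra_simps(3))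
      qed
      ultimately show ?thesis by blast
    qed
  qed
  then show ?thesis using J H.fin_digraph H.potential_triangle[OF rel'] by metis
qed

end

section \<open>Relations of gentle algebras lie on 3-cycles\<close>

text \<open>Modulo the relations, \<open>near rel a\<close> describes the right ideal generated by the arrow \<open>a\<close>.\<close>

definition near :: "('b \<Rightarrow> 'b \<Rightarrow> bool) \<Rightarrow> 'b \<Rightarrow> ('a \<times> 'b list \<Rightarrow> 'k::zero) \<Rightarrow> bool" where
  "near rel a f \<longleftrightarrow> (\<forall>x. f x \<noteq> 0 \<longrightarrow>
    \<not> avoids rel (snd x) \<or> (snd x \<noteq> [] \<and> hd (snd x) = a))"

definition positive_paths_from :: "('a, 'b) pre_digraph \<Rightarrow> 'a \<Rightarrow> ('a \<times> 'b list \<Rightarrow> 'k::field) set" where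
  "positive_paths_from Q w = {f \<in> carrier (path_algebra Q). \<forall>x. f x \<noteq> 0 \<longrightarrow> fst x = w \<and> snd x \<noteq> []}"

text \<open>This is the data of \<open>extension_obstruction\<close> on representatives in the path algebra, where
  \<open>positive_paths_from Q (head Q b)\<close> represents the radical.\<close>

definition obstruction_cocycle ::
    "('a, 'b) pre_digraph \<Rightarrow> ('b \<Rightarrow> 'b \<Rightarrow> bool) \<Rightarrow> 'b \<Rightarrow> 'b \<Rightarrow>
      (('a \<times> 'b list \<Rightarrow> 'k::field) \<Rightarrow> 'a \<times> 'b list \<Rightarrow> 'k) \<Rightarrow> bool" where
  "obstruction_cocycle Q rel a b \<rho> \<longleftrightarrow>
    (\<forall>f\<in>positive_paths_from Q (head Q b). \<rho> f \<in> carrier (path_algebra Q)) \<and>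
    (\<forall>f\<in>positive_paths_from Q (head Q b). \<forall>g\<in>positive_paths_from Q (head Q b).
      bad_support rel (\<lambda>x. f x - g x) \<longrightarrow> \<rho> f = \<rho> g) \<and>
    (\<forall>f\<in>positive_paths_from Q (head Q b). \<forall>x\<in>carrier (path_algebra Q).
      near rel a (\<lambda>z. \<rho> (f \<otimes>\<^bsub>complete_path_algebra Q\<^esub> x) z - (\<rho> f \<otimes>\<^bsub>complete_path_algebra Q\<^esub> x) z)) \<and>
    (\<forall>x\<in>carrier (path_algebra Q). \<exists>f\<in>positive_paths_from Q (head Q b).
      bad_support rel (path_elem (tail Q b, [b]) \<otimes>\<^bsub>complete_path_algebra Q\<^esub> f) \<and>
      \<not> near rel a (\<lambda>z. \<rho> f z - (x \<otimes>\<^bsub>complete_path_algebra Q\<^esub> f) z))"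

text \<open>Strips a leading \<open>c\<close>: for \<open>f\<close> in the path algebra, c times
  this function is the part of \<open>f\<close> whose paths begin with \<open>c\<close>.\<close>

definition left_quotient :: "('a, 'b) pre_digraph \<Rightarrow> 'b \<Rightarrow> ('a \<times> 'b list \<Rightarrow> 'k::zero) \<Rightarrow> 'a \<times> 'b list \<Rightarrow> 'k" where
  "left_quotient Q c f = (\<lambda>(w, r). if w = head Q c then f (tail Q c, c # r) else 0)"

lemma near_add: "near rel a f \<Longrightarrow> near rel a g \<Longrightarrow> near rel a (\<lambda>x. f x + (g x :: 'k::field))"
  unfolding near_def by (metis add.right_neutral add.left_neutral)

lemma bad_support_near: "bad_support rel f \<Longrightarrow> near rel a f"
  unfolding near_def bad_support_def by blast

lemma mult_path_diff_left:
  "(\<lambda>x. f x - (g x :: 'k::field)) \<otimes>\<^bsub>complete_path_algebra Q\<^esub> h =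
    (\<lambda>x. (f \<otimes>\<^bsub>complete_path_algebra Q\<^esub> h) x - (g \<otimes>\<^bsub>complete_path_algebra Q\<^esub> h) x)"
proof
  fix x show "((\<lambda>x. f x - g x) \<otimes>\<^bsub>complete_path_algebra Q\<^esub> h) x =
      (f \<otimes>\<^bsub>complete_path_algebra Q\<^esub> h) x - (g \<otimes>\<^bsub>complete_path_algebra Q\<^esub> h) x"
    by (cases x) (simp add: mult_path left_diff_distrib sum_subtractf)
qed

lemma mult_path_diff_right:
  "h \<otimes>\<^bsub>complete_path_algebra Q\<^esub> (\<lambda>x. f x - (g x :: 'k::field)) =
    (\<lambda>x. (h \<otimes>\<^bsub>complete_path_algebra Q\<^esub> f) x - (h \<otimes>\<^bsub>complete_path_algebra Q\<^esub> g) x)"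
proof
  fix x show "(h \<otimes>\<^bsub>complete_path_algebra Q\<^esub> (\<lambda>x. f x - g x)) x =
      (h \<otimes>\<^bsub>complete_path_algebra Q\<^esub> f) x - (h \<otimes>\<^bsub>complete_path_algebra Q\<^esub> g) x"
    by (cases x) (simp add: mult_path right_diff_distrib sum_subtractf)
qed

lemma mult_path_zero:
  "(\<lambda>x. 0) \<otimes>\<^bsub>complete_path_algebra Q\<^esub> f = (\<lambda>x. 0 :: 'k::field)"
  "f \<otimes>\<^bsub>complete_path_algebra Q\<^esub> (\<lambda>x. 0) = (\<lambda>x. 0 :: 'k::field)"
proof -
  show "(\<lambda>x. 0) \<otimes>\<^bsub>complete_path_algebra Q\<^esub> f = (\<lambda>x. 0 :: 'k)"
  proof
    fix x show "((\<lambda>x. 0) \<otimes>\<^bsub>complete_path_algebra Q\<^esub> f) x = (0 :: 'k)" by (cases x) (simp add: mult_path)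
  qed
  show "f \<otimes>\<^bsub>complete_path_algebra Q\<^esub> (\<lambda>x. 0) = (\<lambda>x. 0 :: 'k)"
  proof
    fix x show "(f \<otimes>\<^bsub>complete_path_algebra Q\<^esub> (\<lambda>x. 0)) x = (0 :: 'k)" by (cases x) (simp add: mult_path)
  qed
qed

context fin_digraph
begin

text \<open>Multiplication from the right changes neither the first arrow nor a relation already
  present in the left factor.\<close>

lemma near_mult:
  assumes f: "near rel a f"
  shows "near rel a (f \<otimes>\<^bsub>complete_path_algebra G\<^esub> g)"
  unfolding near_def
proof (intro allI impI)
  fix x assume nz: "(f \<otimes>\<^bsub>complete_path_algebra G\<^esub> g) x \<noteq> 0"
  obtain u p where x: "x = (u, p)" by fastforce
  obtain i where "f (u, take i p) * g (awlast u (take i p), drop i p) \<noteq> 0"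
    using nz unfolding x mult_path by (meson sum.not_neutral_contains_not_neutral)
  then have "f (u, take i p) \<noteq> 0" by auto
  then have "\<not> avoids rel (take i p) \<or> (take i p \<noteq> [] \<and> hd (take i p) = a)"
    using f unfolding near_def by (metis snd_conv)
  then show "\<not> avoids rel (snd x) \<or> (snd x \<noteq> [] \<and> hd (snd x) = a)"
    using successively_append_D[of _ "take i p" "drop i p"] x by (auto simp: hd_take)
qed

lemma left_quotient_closed:
  fixes f :: "'a \<times> 'b list \<Rightarrow> 'k::field"
  assumes f: "f \<in> carrier (path_algebra G)"
  shows "left_quotient G c f \<in> carrier (path_algebra G)" (is "?y \<in> _")
proof -
  note y = left_quotient_def
  have "{x. ?y x \<noteq> 0} \<subseteq> (\<lambda>x. (head G c, tl (snd x))) ` {x. f x \<noteq> 0}"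
  proof
    fix x assume "x \<in> {x. ?y x \<noteq> 0}"
    then have "x = (head G c, tl (snd (tail G c, c # snd x)))" "f (tail G c, c # snd x) \<noteq> 0"
      by (auto simp: y split: prod.splits if_splits)
    then show "x \<in> (\<lambda>x. (head G c, tl (snd x))) ` {x. f x \<noteq> 0}" by blast
  qed
  then have "finite {x. ?y x \<noteq> 0}" by (rule finite_subset) (use f in \<open>simp add: path_algebra_simps\<close>)
  moreover have "x \<in> quiver_paths G" if "?y x \<noteq> 0" for x
  proof -
    obtain w r where x: "x = (w, r)" by fastforce
    with that have "w = head G c" "f (tail G c, c # r) \<noteq> 0" by (auto simp: y split: if_splits)
    then show ?thesis using f quiver_paths_Cons[of "tail G c" c r] unfolding path_algebra_simps(1) x by blast
  qed
  ultimately show ?thesis unfolding path_algebra_simps(1) by blast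
qed

lemma right_quotient_closed:
  fixes f :: "'a \<times> 'b list \<Rightarrow> 'k::field"
  assumes f: "f \<in> carrier (path_algebra G)"
  shows "(\<lambda>(w, r). f (w, r @ [c])) \<in> carrier (path_algebra G)" (is "?y \<in> _")
proof -
  have "{x. ?y x \<noteq> 0} \<subseteq> (\<lambda>x. (fst x, butlast (snd x))) ` {x. f x \<noteq> 0}"
  proof
    fix x assume "x \<in> {x. ?y x \<noteq> 0}"
    then have "x = (fst (fst x, snd x @ [c]), butlast (snd (fst x, snd x @ [c])))" "f (fst x, snd x @ [c]) \<noteq> 0"
      by (auto split: prod.splits)
    then show "x \<in> (\<lambda>x. (fst x, butlast (snd x))) ` {x. f x \<noteq> 0}" by blast
  qed
  then have "finite {x. ?y x \<noteq> 0}" by (rule finite_subset) (use f in \<open>simp add: path_algebra_simps\<close>)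
  moreover have "x \<in> quiver_paths G" if "?y x \<noteq> 0" for x
  proof -
    obtain w r where x: "x = (w, r)" by fastforce
    with that have "f (w, r @ [c]) \<noteq> 0" by simp
    then show ?thesis using f quiver_paths_append[of w r "[c]"] unfolding path_algebra_simps(1) x by blast
  qed
  ultimately show ?thesis unfolding path_algebra_simps(1) by blast
qed

lemma left_quotient_mult:
  fixes f :: "'a \<times> 'b list \<Rightarrow> 'k::field"
  assumes f: "f \<in> carrier (path_algebra G)"
  shows "(path_elem (tail G c, [c]) \<otimes>\<^bsub>complete_path_algebra G\<^esub> left_quotient G c f) x =
    (if snd x \<noteq> [] \<and> hd (snd x) = c then f x else 0)"
proof -
  obtain w r where x: "x = (w, r)" by fastforce
  show ?thesis
  proof (cases r)
    case Nil
    then show ?thesis unfolding x path_elem_mult by simp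
  next
    case (Cons c' r')
    have "w = tail G c" if "f (w, c # r') \<noteq> 0"
      using that f quiver_paths_Cons[of w c r'] unfolding path_algebra_simps(1) by blast
    then show ?thesis unfolding x path_elem_mult by (auto simp: Cons left_quotient_def)
  qed
qed

lemma near_decompose:
  fixes f :: "'a \<times> 'b list \<Rightarrow> 'k::field"
  assumes f: "f \<in> carrier (path_algebra G)" and n: "near rel a f"
  shows "bad_support rel (\<lambda>x. f x - (path_elem (tail G a, [a]) \<otimes>\<^bsub>complete_path_algebra G\<^esub> left_quotient G a f) x)"
  using n unfolding bad_support_def near_def left_quotient_mult[OF f] by auto

text \<open>Putting \<open>b\<close> in front of \<open>r\<close> creates one new junction, so a
  relation in the product lies in \<open>r\<close> or at that junction. With uniqueness of relations
  this computes kernels of left multiplication by an arrow.\<close>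

lemma arrow_mult_bad:
  assumes bad: "bad_support rel (path_elem (tail G b, [b]) \<otimes>\<^bsub>complete_path_algebra G\<^esub> f)"
    and r: "f (head G b, r) \<noteq> 0"
  shows "\<not> avoids rel r \<or> (r \<noteq> [] \<and> rel b (hd r))"
proof -
  have "(path_elem (tail G b, [b]) \<otimes>\<^bsub>complete_path_algebra G\<^esub> f) (tail G b, b # r) = f (head G b, r)"
    by (simp add: path_elem_mult)
  then have "\<not> avoids rel (b # r)"
    using bad r unfolding bad_support_def by (metis snd_conv)
  then show ?thesis by (auto simp: successively_Cons)
qed

lemma zero_positive: "(\<lambda>x. 0) \<in> positive_paths_from G w"
  unfolding positive_paths_from_def path_algebra_simps by simp

context
  fixes rel :: "'b \<Rightarrow> 'b \<Rightarrow> bool"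
  assumes rel: "\<And>a b. rel a b \<Longrightarrow> a \<in> arcs G \<and> b \<in> arcs G \<and> head G a = tail G b"
    and rel_right: "\<And>a b b'. rel a b \<Longrightarrow> rel a b' \<Longrightarrow> b = b'"
    and rel_left: "\<And>a a' b. rel a b \<Longrightarrow> rel a' b \<Longrightarrow> a = a'"
begin

context
  fixes \<rho> :: "('a \<times> 'b list \<Rightarrow> 'k::field) \<Rightarrow> 'a \<times> 'b list \<Rightarrow> 'k" and a b
  assumes ab: "rel a b" and \<rho>: "obstruction_cocycle G rel a b \<rho>"
begin

lemma cocycle_closed: "f \<in> positive_paths_from G (head G b) \<Longrightarrow> \<rho> f \<in> carrier (path_algebra G)"
  using \<rho> unfolding obstruction_cocycle_def by blast

lemma cocycle_cong:
  "\<lbrakk>f \<in> positive_paths_from G (head G b); g \<in> positive_paths_from G (head G b); bad_support rel (\<lambda>x. f x - g x)\<rbrakk>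
    \<Longrightarrow> \<rho> f = \<rho> g"
  using \<rho> unfolding obstruction_cocycle_def by blast

lemma cocycle_mult:
  "\<lbrakk>f \<in> positive_paths_from G (head G b); x \<in> carrier (path_algebra G)\<rbrakk> \<Longrightarrow>
    near rel a (\<lambda>z. \<rho> (f \<otimes>\<^bsub>complete_path_algebra G\<^esub> x) z - (\<rho> f \<otimes>\<^bsub>complete_path_algebra G\<^esub> x) z)"
  using \<rho> unfolding obstruction_cocycle_def by blast

lemma cocycle_nontrivial:
  assumes "x \<in> carrier (path_algebra G)"
  obtains f where "f \<in> positive_paths_from G (head G b)"
    "bad_support rel (path_elem (tail G b, [b]) \<otimes>\<^bsub>complete_path_algebra G\<^esub> f)"
    "\<not> near rel a (\<lambda>z. \<rho> f z - (x \<otimes>\<^bsub>complete_path_algebra G\<^esub> f) z)"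
  using \<rho> assms unfolding obstruction_cocycle_def by blast

text \<open>\<rho> takes values in representatives, so its value at 0 need not be 0; the product 0
  times 0 shows that it is 0 modulo a\<Lambda>.\<close>

lemma cocycle_zero: "near rel a (\<rho> (\<lambda>x. 0))"
proof -
  have "(\<lambda>x. 0) \<in> carrier (path_algebra G :: ('k, _) module)" by (simp add: path_algebra_simps)
  from cocycle_mult[OF zero_positive this] show ?thesis by (simp add: mult_path_zero)
qed

text \<open>Otherwise every \<open>f\<close> starting at the head of \<open>b\<close> and killed by
  \<open>b\<close> is congruent to 0, so that \<rho> f = \<rho> 0 is near \<open>a\<close>. This
  contradicts nontriviality against multiplication by 0.\<close>

lemma relation_continues: "\<exists>c. rel b c"
proof (rule ccontr)
  assume no: "\<not> (\<exists>c. rel b c)"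
  have "(\<lambda>x. 0) \<in> carrier (path_algebra G :: ('k, _) module)" by (simp add: path_algebra_simps)
  from cocycle_nontrivial[OF this] obtain f where f: "f \<in> positive_paths_from G (head G b)"
    "bad_support rel (path_elem (tail G b, [b]) \<otimes>\<^bsub>complete_path_algebra G\<^esub> f)" "\<not> near rel a (\<rho> f)"
    by (auto simp: mult_path_zero)
  have "bad_support rel (\<lambda>x. f x - 0)"
    unfolding bad_support_def
  proof (intro allI impI)
    fix x assume "f x - 0 \<noteq> 0"
    then have "f (head G b, snd x) \<noteq> 0" using f(1) unfolding positive_paths_from_def by (cases x) auto
    from arrow_mult_bad[OF f(2) this] show "\<not> avoids rel (snd x)" using no by blast
  qed
  from cocycle_cong[OF f(1) zero_positive this] show False using f(3) cocycle_zero by simp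
qed

text \<open>Suppose \<open>d\<close> differs from \<open>a\<close>. As c d is a relation, \<rho>(c)
  d is near \<open>a\<close>. So a term of \<rho>(c) ending where \<open>d\<close> starts contains a
  relation, begins with \<open>a\<close>, or forms a relation with \<open>d\<close>, and then
  \<open>rel_left\<close> makes its last arrow \<open>c\<close>. Hence \<rho>(c) is x c modulo
  a\<Lambda>. Elements killed by \<open>b\<close> are of the form c y, so \<rho> acts on them as
  multiplication by \<open>x\<close>.\<close>

lemma relation_cycle:
  assumes bc: "rel b c" and cd: "rel c d"
  shows "d = a"
proof (rule ccontr)
  assume da: "d \<noteq> a"
  let ?pb = "path_elem (tail G b, [b]) :: 'a \<times> 'b list \<Rightarrow> 'k"
  let ?pc = "path_elem (tail G c, [c]) :: 'a \<times> 'b list \<Rightarrow> 'k"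
  let ?pd = "path_elem (tail G d, [d]) :: 'a \<times> 'b list \<Rightarrow> 'k"
  let ?ez = "path_elem (head G c, []) :: 'a \<times> 'b list \<Rightarrow> 'k"
  note rb = rel[OF bc] and rc = rel[OF cd]
  have paths: "(tail G c, [c]) \<in> quiver_paths G" "(tail G d, [d]) \<in> quiver_paths G" "(head G c, []) \<in> quiver_paths G"
    using rb rc by (simp_all add: quiver_paths_Cons quiver_paths_Nil)
  note pP = paths[THEN path_elem_closed]
  have pc: "?pc \<in> positive_paths_from G (head G b)"
    using pP(1) rb unfolding positive_paths_from_def by (auto simp: path_elem_def)
  have pcd: "?pc \<otimes>\<^bsub>complete_path_algebra G\<^esub> ?pd = path_elem (tail G c, [c, d])"
    using path_elem_append[of "tail G c" "[c]" "[d]"] rc by simp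
  have pcz: "?pc \<otimes>\<^bsub>complete_path_algebra G\<^esub> ?ez = ?pc"
    using path_elem_append[of "tail G c" "[c]" "[]"] by simp
  define g where "g = \<rho> ?pc"
  have g: "g \<in> carrier (path_algebra G)" unfolding g_def by (rule cocycle_closed[OF pc])
  \<comment> \<open>Terms of \<open>g\<close> that do not end at the head of \<open>c\<close> are
    invisible to \<open>d\<close>. They lie in a\<Lambda> anyway: c is unchanged by the idempotent
    \<open>?ez\<close>, so \<rho>(c) is congruent to \<rho>(c) times \<open>?ez\<close>.\<close>
  define g' where "g' = g \<otimes>\<^bsub>complete_path_algebra G\<^esub> ?ez"
  have g': "g' \<in> carrier (path_algebra G)" unfolding g'_def by (rule mult_closed_path_algebra[OF g pP(3)])
  have gg': "near rel a (\<lambda>z. g z - g' z)"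
    using cocycle_mult[OF pc pP(3)] unfolding pcz g_def g'_def .
  have g'_eq: "g' (w, r) = (if awlast w r = head G c then g (w, r) else 0)" for w r
    unfolding g'_def mult_path_elem by simp
  have gd: "near rel a (g \<otimes>\<^bsub>complete_path_algebra G\<^esub> ?pd)"
  proof -
    have cd_path: "(tail G c, [c, d]) \<in> quiver_paths G" using rc by (simp add: quiver_paths_Cons quiver_paths_Nil)
    have p: "path_elem (tail G c, [c, d]) \<in> positive_paths_from G (head G b)"
      using path_elem_closed[OF cd_path] rb unfolding positive_paths_from_def by (auto simp: path_elem_def)
    have "bad_support rel (\<lambda>x. path_elem (tail G c, [c, d]) x - (0 :: 'k))"
      using cd unfolding bad_support_def path_elem_def by auto
    then have "\<rho> (path_elem (tail G c, [c, d])) = \<rho> (\<lambda>x. 0)" by (rule cocycle_cong[OF p zero_positive])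
    then have 1: "near rel a (\<rho> (path_elem (tail G c, [c, d])))" using cocycle_zero by simp
    have 2: "near rel a (\<lambda>z. \<rho> (path_elem (tail G c, [c, d])) z - (g \<otimes>\<^bsub>complete_path_algebra G\<^esub> ?pd) z)"
      using cocycle_mult[OF pc pP(2)] unfolding pcd g_def .
    show ?thesis unfolding near_def
    proof (intro allI impI)
      fix x assume "(g \<otimes>\<^bsub>complete_path_algebra G\<^esub> ?pd) x \<noteq> 0"
      then have "\<rho> (path_elem (tail G c, [c, d])) x \<noteq> 0 \<or>
        \<rho> (path_elem (tail G c, [c, d])) x - (g \<otimes>\<^bsub>complete_path_algebra G\<^esub> ?pd) x \<noteq> 0" by auto
      then show "\<not> avoids rel (snd x) \<or> (snd x \<noteq> [] \<and> hd (snd x) = a)"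
        using 1 2 unfolding near_def by blast
    qed
  qed
  \<comment> \<open>The multiplier: the terms of \<open>g'\<close> that end in \<open>c\<close>,
    with this last arrow removed.\<close>
  define x where "x = (\<lambda>(w, r). g' (w, r @ [c]))"
  have x: "x \<in> carrier (path_algebra G)" unfolding x_def by (rule right_quotient_closed[OF g'])
  have xc_eq: "(x \<otimes>\<^bsub>complete_path_algebra G\<^esub> ?pc) (w, r) = (if r \<noteq> [] \<and> last r = c then g' (w, r) else 0)" for w r
  proof (cases "r \<noteq> [] \<and> last r = c")
    case False
    then have "\<not> (length [c] \<le> length r \<and> drop (length r - length [c]) r = [c])"
      by (cases r rule: rev_cases) auto
    then show ?thesis unfolding mult_path_elem using False by auto
  next
    case True
    then obtain r' where r': "r = r' @ [c]" by (cases r rule: rev_cases) auto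
    have "awlast w r' = tail G c" if "g' (w, r' @ [c]) \<noteq> 0"
    proof -
      have "(w, r' @ [c]) \<in> quiver_paths G" using that g' unfolding path_algebra_simps(1) by blast
      then show ?thesis using quiver_paths_append[of w r' "[c]"] by (simp add: quiver_paths_Cons)
    qed
    then show ?thesis unfolding mult_path_elem by (auto simp: r' x_def)
  qed
  have gx: "near rel a (\<lambda>z. g' z - (x \<otimes>\<^bsub>complete_path_algebra G\<^esub> ?pc) z)"
    unfolding near_def
  proof (intro allI impI)
    fix y assume nz: "g' y - (x \<otimes>\<^bsub>complete_path_algebra G\<^esub> ?pc) y \<noteq> 0"
    obtain w r where y: "y = (w, r)" by fastforce
    from nz have nz': "g' (w, r) \<noteq> 0" "\<not> (r \<noteq> [] \<and> last r = c)"
      unfolding y xc_eq by (auto split: if_splits)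
    then have gr: "g (w, r) \<noteq> 0" "awlast w r = tail G d" using rc unfolding g'_eq by (auto split: if_splits)
    then have "(g \<otimes>\<^bsub>complete_path_algebra G\<^esub> ?pd) (w, r @ [d]) \<noteq> 0" unfolding mult_path_elem by simp
    then have "\<not> avoids rel (r @ [d]) \<or> hd (r @ [d]) = a"
      using gd unfolding near_def by (metis snd_conv)
    \<comment> \<open>For an empty \<open>r\<close> the first arrow of r d is \<open>d\<close>
      itself, and \<open>da\<close> excludes this case.\<close>
    then show "\<not> avoids rel (snd y) \<or> (snd y \<noteq> [] \<and> hd (snd y) = a)"
      using nz'(2) da rel_left[OF cd] unfolding y by (auto simp: successively_append_iff hd_append split: if_splits)
  qed
  have gxc: "near rel a (\<lambda>z. g z - (x \<otimes>\<^bsub>complete_path_algebra G\<^esub> ?pc) z)"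
    using near_add[OF gg' gx] by simp
  obtain f where f: "f \<in> positive_paths_from G (head G b)"
    and bf: "bad_support rel (?pb \<otimes>\<^bsub>complete_path_algebra G\<^esub> f)"
    and nf: "\<not> near rel a (\<lambda>z. \<rho> f z - (x \<otimes>\<^bsub>complete_path_algebra G\<^esub> f) z)"
    using cocycle_nontrivial[OF x] by blast
  have fP: "f \<in> carrier (path_algebra G)" using f unfolding positive_paths_from_def by blast
  define y where "y = left_quotient G c f"
  have y: "y \<in> carrier (path_algebra G)" unfolding y_def by (rule left_quotient_closed[OF fP])
  have cy_eq: "(?pc \<otimes>\<^bsub>complete_path_algebra G\<^esub> y) (w, r) = (if r \<noteq> [] \<and> hd r = c then f (w, r) else 0)" for w r
    unfolding y_def left_quotient_mult[OF fP] by simp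
  have cyP: "?pc \<otimes>\<^bsub>complete_path_algebra G\<^esub> y \<in> carrier (path_algebra G)"
    by (rule mult_closed_path_algebra[OF pP(1) y])
  have cy: "?pc \<otimes>\<^bsub>complete_path_algebra G\<^esub> y \<in> positive_paths_from G (head G b)"
    unfolding positive_paths_from_def
  proof (intro CollectI conjI allI impI cyP)
    fix z assume "(?pc \<otimes>\<^bsub>complete_path_algebra G\<^esub> y) z \<noteq> 0"
    then have "f z \<noteq> 0" using cy_eq[of "fst z" "snd z"] by (auto split: if_splits)
    then show "fst z = head G b" "snd z \<noteq> []" using f unfolding positive_paths_from_def by blast+
  qed
  have fcy: "bad_support rel (\<lambda>z. f z - (?pc \<otimes>\<^bsub>complete_path_algebra G\<^esub> y) z)"
    unfolding bad_support_def
  proof (intro allI impI)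
    fix z assume nz: "f z - (?pc \<otimes>\<^bsub>complete_path_algebra G\<^esub> y) z \<noteq> 0"
    then have z: "f z \<noteq> 0" "\<not> (snd z \<noteq> [] \<and> hd (snd z) = c)" using cy_eq[of "fst z" "snd z"] by (auto split: if_splits)
    then have "f (head G b, snd z) \<noteq> 0" using f unfolding positive_paths_from_def by (cases z) auto
    from arrow_mult_bad[OF bf this] show "\<not> avoids rel (snd z)"
      using z(2) rel_right[OF bc] by blast
  qed
  have "near rel a (\<lambda>z. \<rho> f z - (g \<otimes>\<^bsub>complete_path_algebra G\<^esub> y) z)"
    using cocycle_mult[OF pc y] cocycle_cong[OF f cy fcy] unfolding g_def by simp
  moreover have "near rel a (\<lambda>z. (g \<otimes>\<^bsub>complete_path_algebra G\<^esub> y) z -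
      (x \<otimes>\<^bsub>complete_path_algebra G\<^esub> (?pc \<otimes>\<^bsub>complete_path_algebra G\<^esub> y)) z)"
    using near_mult[OF gxc, of y] unfolding mult_path_diff_left mult_assoc_complete .
  moreover have "near rel a (\<lambda>z. (x \<otimes>\<^bsub>complete_path_algebra G\<^esub> (?pc \<otimes>\<^bsub>complete_path_algebra G\<^esub> y)) z -
      (x \<otimes>\<^bsub>complete_path_algebra G\<^esub> f) z)"
  proof -
    have "bad_support rel (\<lambda>z. (?pc \<otimes>\<^bsub>complete_path_algebra G\<^esub> y) z - f z)"
      using fcy unfolding bad_support_def by (metis right_minus_eq)
    then have "bad_support rel (x \<otimes>\<^bsub>complete_path_algebra G\<^esub> (\<lambda>z. (?pc \<otimes>\<^bsub>complete_path_algebra G\<^esub> y) z - f z))"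
      by (intro bad_support_mult) blast
    then show ?thesis unfolding mult_path_diff_right by (rule bad_support_near)
  qed
  ultimately have "near rel a (\<lambda>z. \<rho> f z - (x \<otimes>\<^bsub>complete_path_algebra G\<^esub> f) z)"
    using near_add[OF near_add] by fastforce
  with nf show False by contradiction
qed

end

text \<open>Two cocycles are involved: that of (a, b) yields \<open>c\<close>, that of (b, c) yields
  a continuation \<open>d\<close>, and the first one then forces d = a.\<close>

lemma relation_triangle:
  assumes cocycles: "\<And>a b. rel a b \<Longrightarrow>
      \<exists>\<rho> :: ('a \<times> 'b list \<Rightarrow> 'k::field) \<Rightarrow> 'a \<times> 'b list \<Rightarrow> 'k. obstruction_cocycle G rel a b \<rho>"
    and ab: "rel a b"
  shows "\<exists>c. rel b c \<and> rel c a"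
proof -
  obtain \<rho> :: "('a \<times> 'b list \<Rightarrow> 'k) \<Rightarrow> 'a \<times> 'b list \<Rightarrow> 'k" where \<rho>: "obstruction_cocycle G rel a b \<rho>"
    using cocycles[OF ab] by blast
  obtain c where c: "rel b c" using relation_continues[OF ab \<rho>] by blast
  obtain \<rho>' :: "('a \<times> 'b list \<Rightarrow> 'k) \<Rightarrow> 'a \<times> 'b list \<Rightarrow> 'k" where \<rho>': "obstruction_cocycle G rel b c \<rho>'"
    using cocycles[OF c] by blast
  obtain d where d: "rel c d" using relation_continues[OF c \<rho>'] by blast
  from relation_cycle[OF ab \<rho> c d] c d show ?thesis by blast
qed

end

end

section \<open>Gentle algebras as monomial quotients\<close>

definition gentle_rel :: "('a, 'b) pre_digraph \<Rightarrow> ('a \<times> 'b list \<Rightarrow> 'k::field) set \<Rightarrow> 'b \<Rightarrow> 'b \<Rightarrow> bool" where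
  "gentle_rel Q I a b \<longleftrightarrow> a \<in> arcs Q \<and> b \<in> arcs Q \<and> head Q a = tail Q b \<and> arrow_prod Q a b \<in> I"

lemma gentle_relD: "gentle_rel Q I a b \<Longrightarrow> a \<in> arcs Q \<and> b \<in> arcs Q \<and> head Q a = tail Q b"
  unfolding gentle_rel_def by blast

lemma gentle_rel_unique:
  assumes "gentle Q I"
  shows "gentle_rel Q I a b \<Longrightarrow> gentle_rel Q I a b' \<Longrightarrow> b = b'"
    and "gentle_rel Q I a b \<Longrightarrow> gentle_rel Q I a' b \<Longrightarrow> a = a'"
proof -
  have u: "\<exists>\<^sub>\<le>\<^sub>1 a. a \<in> arcs Q \<and> head Q a = tail Q b \<and> arrow_prod Q a b \<in> I"
    "\<exists>\<^sub>\<le>\<^sub>1 c. c \<in> arcs Q \<and> head Q b = tail Q c \<and> arrow_prod Q b c \<in> I" if "b \<in> arcs Q" for b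
    using assms that unfolding gentle_def by blast+
  show "b = b'" if "gentle_rel Q I a b" "gentle_rel Q I a b'"
    using Uniq_D[OF u(2)[of a], of b b'] that unfolding gentle_rel_def by blast
  show "a = a'" if "gentle_rel Q I a b" "gentle_rel Q I a' b"
    using Uniq_D[OF u(1)[of b], of a a'] that unfolding gentle_rel_def by blast
qed

context fin_digraph
begin

lemma path_algebra_smult_closed:
  assumes "f \<in> carrier (path_algebra G)"
  shows "(\<lambda>x. c * f x) \<in> carrier (path_algebra G)"
proof -
  have "{x. c * f x \<noteq> 0} \<subseteq> {x. f x \<noteq> 0}" by auto
  then have "finite {x. c * f x \<noteq> 0}" by (rule finite_subset) (use assms in \<open>simp add: path_algebra_simps\<close>)
  then show ?thesis using assms by (simp add: path_algebra_simps)
qed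

lemma path_algebra_diff_closed:
  assumes f: "f \<in> carrier (path_algebra G)" and g: "g \<in> carrier (path_algebra G)"
  shows "(\<lambda>x. f x - g x) \<in> carrier (path_algebra G)"
  using path_algebra_add_closed[OF f path_algebra_smult_closed[OF g, of "- 1"]] by simp

text \<open>\<open>gentle_rel\<close> is read off from membership in \<open>I\<close>, not from the
  generators \<open>R\<close>, so bad paths lie in \<open>I\<close> at once. Conversely each
  generator is a related pair, and minimality of the generated ideal does the rest.\<close>

lemma gentle_ideal:
  fixes I :: "('a \<times> 'b list \<Rightarrow> 'k::field) set"
  assumes gentle: "gentle G I"
  shows "I = {f \<in> carrier (path_algebra G). bad_support (gentle_rel G I) f}"
proof
  interpret P: ring "path_algebra G :: ('k, 'a \<times> 'b list \<Rightarrow> 'k) module" by (rule ring_path_algebra)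
  have I: "ideal I (path_algebra G)" using gentle unfolding gentle_def admissible_ideal_def by blast
  obtain R where R: "R \<subseteq> {x \<in> quiver_paths G. length (snd x) = 2}" "I = Idl\<^bsub>path_algebra G\<^esub> (path_elem ` R)"
    using gentle unfolding gentle_def by blast
  have RP: "path_elem ` R \<subseteq> carrier (path_algebra G :: ('k, 'a \<times> 'b list \<Rightarrow> 'k) module)"
    using R(1) path_elem_closed by blast
  have "(path_elem ` R :: ('a \<times> 'b list \<Rightarrow> 'k) set) \<subseteq> {f \<in> carrier (path_algebra G). bad_support (gentle_rel G I) f}"
  proof
    fix f :: "'a \<times> 'b list \<Rightarrow> 'k"
    assume f: "f \<in> path_elem ` R"
    then obtain x where x: "x \<in> R" "f = path_elem x" by blast
    obtain u p where up: "x = (u, p)" by fastforce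
    have xp: "(u, p) \<in> quiver_paths G" "length p = 2" using x(1) R(1) up by auto
    then obtain a b where p: "p = [a, b]" by (auto simp: length_Suc_conv numeral_2_eq_2)
    have ab: "a \<in> arcs G" "u = tail G a" "b \<in> arcs G" "head G a = tail G b"
      using xp(1) unfolding p quiver_paths_Cons by auto
    have "f \<in> I" using P.genideal_self[OF RP] f R(2) by blast
    then have "gentle_rel G I a b" using ab unfolding gentle_rel_def arrow_prod_def x(2) up p by simp
    then have "bad_support (gentle_rel G I) f" unfolding bad_support_def x(2) up p path_elem_def by auto
    then show "f \<in> {f \<in> carrier (path_algebra G). bad_support (gentle_rel G I) f}" using f RP by blast
  qed
  from P.genideal_minimal[OF bad_support_ideal_path_algebra this]
  show "I \<subseteq> {f \<in> carrier (path_algebra G). bad_support (gentle_rel G I) f}"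
    by (rule ord_eq_le_trans[OF R(2)])
  show "{f \<in> carrier (path_algebra G). bad_support (gentle_rel G I) f} \<subseteq> I"
  proof
    fix f :: "'a \<times> 'b list \<Rightarrow> 'k"
    assume "f \<in> {f \<in> carrier (path_algebra G). bad_support (gentle_rel G I) f}"
    then have f: "f \<in> carrier (path_algebra G)" "bad_support (gentle_rel G I) f" by blast+
    show "f \<in> I"
      by (rule bad_support_in_ideal[OF I _ f]) (simp add: gentle_rel_def arrow_prod_def)
  qed
qed

text \<open>Admissibility puts all sufficiently long paths into \<open>I\<close>, and a path in a
  monomial ideal contains a generator.\<close>

lemma gentle_long_paths_bad:
  fixes I :: "('a \<times> 'b list \<Rightarrow> 'k::field) set"
  assumes gentle: "gentle G I"
  obtains m where "\<And>x. \<lbrakk>x \<in> quiver_paths G; length (snd x) = m\<rbrakk> \<Longrightarrow>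
    \<not> avoids (gentle_rel G I) (snd x)"
proof -
  obtain m where m: "arrow_ideal_power G m \<subseteq> I"
    using gentle unfolding gentle_def admissible_ideal_def by blast
  have "\<not> avoids (gentle_rel G I) (snd x)" if x: "x \<in> quiver_paths G" "length (snd x) = m" for x
  proof -
    have "path_elem x \<in> arrow_ideal_power G m"
      using path_elem_closed[OF x(1)] x(2) unfolding arrow_ideal_power_def by (auto simp: path_elem_def)
    then have "path_elem x \<in> I" using m by blast
    then have "bad_support (gentle_rel G I) (path_elem x :: _ \<Rightarrow> 'k)" using gentle_ideal[OF gentle] by blast
    then show ?thesis unfolding bad_support_def path_elem_def by (metis zero_neq_one)
  qed
  with that show thesis by blast
qed

end

text \<open>\<open>B\<close> is a mere record here, not assumed to be a ring. \<open>idem0\<close>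
  is the one group law asked of it: it shows that 0 is mapped to 0.\<close>

lemma quotient_iso_lift:
  fixes A :: "('k, 'a) module" and B :: "('k, 'b) module"
  assumes I: "ideal I A" and iso: "h \<in> ring_iso (quotient_algebra A I) B"
    and lin: "h \<in> linear_maps (quotient_algebra A I) B"
    and sI: "\<And>c i. i \<in> I \<Longrightarrow> c \<odot>\<^bsub>A\<^esub> i \<in> I"
    and scA: "\<And>c y. y \<in> carrier A \<Longrightarrow> c \<odot>\<^bsub>A\<^esub> y \<in> carrier A"
    and addA: "\<And>c y z. \<lbrakk>y \<in> carrier A; z \<in> carrier A\<rbrakk> \<Longrightarrow> c \<odot>\<^bsub>A\<^esub> (y \<oplus>\<^bsub>A\<^esub> z) = c \<odot>\<^bsub>A\<^esub> y \<oplus>\<^bsub>A\<^esub> c \<odot>\<^bsub>A\<^esub> z"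
    and idem0: "\<And>z. \<lbrakk>z \<in> carrier B; z \<oplus>\<^bsub>B\<^esub> z = z\<rbrakk> \<Longrightarrow> z = \<zero>\<^bsub>B\<^esub>"
    and \<eta>_def: "\<eta> = (\<lambda>x. h (I +>\<^bsub>A\<^esub> x))"
  shows "\<eta> \<in> ring_hom A B"
    and "\<eta> ` carrier A = carrier B"
    and "x \<in> carrier A \<Longrightarrow> \<eta> (c \<odot>\<^bsub>A\<^esub> x) = c \<odot>\<^bsub>B\<^esub> \<eta> x"
    and "x \<in> carrier A \<Longrightarrow> \<eta> x = \<zero>\<^bsub>B\<^esub> \<longleftrightarrow> x \<in> I"
proof -
  interpret I: ideal I A by fact
  have hom: "h \<in> ring_hom (quotient_algebra A I) B" and bij: "bij_betw h (carrier (quotient_algebra A I)) (carrier B)"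
    using iso unfolding ring_iso_def by blast+
  have q: "I +>\<^bsub>A\<^esub> x \<in> carrier (quotient_algebra A I)" if "x \<in> carrier A" for x
    using that unfolding quotient_algebra_simps quotient_carrier by blast
  show hom\<eta>: "\<eta> \<in> ring_hom A B"
  proof (rule ring_hom_memI)
    fix x y assume x: "x \<in> carrier A" and y: "y \<in> carrier A"
    show "\<eta> x \<in> carrier B" unfolding \<eta>_def by (rule ring_hom_closed[OF hom q[OF x]])
    show "\<eta> (x \<otimes>\<^bsub>A\<^esub> y) = \<eta> x \<otimes>\<^bsub>B\<^esub> \<eta> y"
      unfolding \<eta>_def using ring_hom_mult[OF hom q[OF x] q[OF y]] I.rcoset_mult_add[OF x y]
      by (simp add: quotient_algebra_simps FactRing_def)
    show "\<eta> (x \<oplus>\<^bsub>A\<^esub> y) = \<eta> x \<oplus>\<^bsub>B\<^esub> \<eta> y"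
      unfolding \<eta>_def using ring_hom_add[OF hom q[OF x] q[OF y]] I.a_rcos_sum[OF x y]
      by (simp add: quotient_algebra_simps FactRing_def)
  next
    show "\<eta> \<one>\<^bsub>A\<^esub> = \<one>\<^bsub>B\<^esub>"
      unfolding \<eta>_def using ring_hom_one[OF hom] by (simp add: quotient_algebra_simps FactRing_def)
  qed
  have "h ` carrier (quotient_algebra A I) = carrier B" using bij unfolding bij_betw_def by blast
  then show "\<eta> ` carrier A = carrier B"
    unfolding \<eta>_def quotient_algebra_simps quotient_carrier by (simp add: image_image)
  show "\<eta> (c \<odot>\<^bsub>A\<^esub> x) = c \<odot>\<^bsub>B\<^esub> \<eta> x" if x: "x \<in> carrier A"
  proof -
    have "h (c \<odot>\<^bsub>quotient_algebra A I\<^esub> (I +>\<^bsub>A\<^esub> x)) = c \<odot>\<^bsub>B\<^esub> h (I +>\<^bsub>A\<^esub> x)"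
      using lin q[OF x] unfolding linear_maps_def by blast
    moreover have "c \<odot>\<^bsub>quotient_algebra A I\<^esub> (I +>\<^bsub>A\<^esub> x) = I +>\<^bsub>A\<^esub> (c \<odot>\<^bsub>A\<^esub> x)"
      by (rule smult_coset[OF I x]) (use sI scA addA in blast)+
    ultimately show ?thesis unfolding \<eta>_def by simp
  qed
  show "\<eta> x = \<zero>\<^bsub>B\<^esub> \<longleftrightarrow> x \<in> I" if x: "x \<in> carrier A"
  proof -
    have 0: "\<eta> \<zero>\<^bsub>A\<^esub> = \<zero>\<^bsub>B\<^esub>"
      using idem0[of "\<eta> \<zero>\<^bsub>A\<^esub>"] ring_hom_add[OF hom\<eta> I.zero_closed I.zero_closed] ring_hom_closed[OF hom\<eta> I.zero_closed]
      by simp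
    have "\<eta> x = \<eta> \<zero>\<^bsub>A\<^esub> \<longleftrightarrow> I +>\<^bsub>A\<^esub> x = I +>\<^bsub>A\<^esub> \<zero>\<^bsub>A\<^esub>"
      unfolding \<eta>_def using inj_on_eq_iff[OF bij_betw_imp_inj_on[OF bij] q[OF x] q[OF I.zero_closed]] .
    also have "\<dots> \<longleftrightarrow> x \<ominus>\<^bsub>A\<^esub> \<zero>\<^bsub>A\<^esub> \<in> I" using I.quotient_eq_iff_same_a_r_cos[OF I x I.zero_closed] by (rule sym)
    also have "x \<ominus>\<^bsub>A\<^esub> \<zero>\<^bsub>A\<^esub> = x" using x by (simp add: a_minus_def)
    finally show ?thesis using 0 by simp
  qed
qed

text \<open>Applies \<open>extension_obstruction\<close> to the images of the arrows, with the
  trivial paths at the start and the end of \<open>b\<close> as idempotents, and lifts the outcome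
  along \<open>\<eta>\<close> to representatives. Equality in \<Lambda> becomes congruence modulo
  bad paths, and a\<Lambda> becomes \<open>near rel a\<close>.\<close>

lemma (in two_calabi_yau) obstruction_cocycle_exists:
  fixes \<eta> :: "('a \<times> 'b list \<Rightarrow> 'k) \<Rightarrow> 'm"
  assumes Q: "fin_digraph Q" and T: "cluster_tilting C T"
    and rel: "\<And>a b. rel a b \<Longrightarrow> a \<in> arcs Q \<and> b \<in> arcs Q \<and> head Q a = tail Q b"
    and rel_right: "\<And>a b b'. rel a b \<Longrightarrow> rel a b' \<Longrightarrow> b = b'"
    and \<eta>c: "\<And>f. f \<in> carrier (path_algebra Q) \<Longrightarrow> \<eta> f \<in> mor C T T"
    and \<eta>s: "\<And>x. x \<in> mor C T T \<Longrightarrow> \<exists>f\<in>carrier (path_algebra Q). \<eta> f = x"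
    and \<eta>m: "\<And>f g. \<lbrakk>f \<in> carrier (path_algebra Q); g \<in> carrier (path_algebra Q)\<rbrakk> \<Longrightarrow>
      \<eta> (f \<otimes>\<^bsub>complete_path_algebra Q\<^esub> g) = \<eta> f \<cdot> \<eta> g"
    and \<eta>a: "\<And>f g. \<lbrakk>f \<in> carrier (path_algebra Q); g \<in> carrier (path_algebra Q)\<rbrakk> \<Longrightarrow>
      \<eta> (\<lambda>x. f x + g x) = \<eta> f \<oplus>\<^bsub>Hom C T T\<^esub> \<eta> g"
    and \<eta>sm: "\<And>f c. f \<in> carrier (path_algebra Q) \<Longrightarrow> \<eta> (\<lambda>x. c * f x) = c \<odot>\<^bsub>Hom C T T\<^esub> \<eta> f"
    and \<eta>1: "\<eta> \<one>\<^bsub>path_algebra Q\<^esub> = Ident C T"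
    and \<eta>0: "\<And>f. f \<in> carrier (path_algebra Q) \<Longrightarrow> \<eta> f = zero_mor C T T \<longleftrightarrow> bad_support rel f"
    and ab: "rel a b"
  shows "\<exists>\<rho> :: ('a \<times> 'b list \<Rightarrow> 'k) \<Rightarrow> 'a \<times> 'b list \<Rightarrow> 'k. obstruction_cocycle Q rel a b \<rho>"
proof -
  interpret Q: fin_digraph Q by fact
  have TO: "T \<in> Ob C" using T unfolding cluster_tilting_def by blast
  interpret A: abelian_group "Hom C T T" using Hom_group TO by blast
  let ?P = "carrier (path_algebra Q) :: ('a \<times> 'b list \<Rightarrow> 'k) set"
  let ?A = "mor C T T"
  define star where "star = (monoid.mult (complete_path_algebra Q) :: ('a \<times> 'b list \<Rightarrow> 'k) \<Rightarrow> _)"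
  have mc: "star f g \<in> ?P" if "f \<in> ?P" "g \<in> ?P" for f g
    unfolding star_def by (rule Q.mult_closed_path_algebra[OF that])
  have ms: "\<eta> (star f g) = \<eta> f \<cdot> \<eta> g" if "f \<in> ?P" "g \<in> ?P" for f g unfolding star_def by (rule \<eta>m[OF that])
  have massoc: "star (star f g) h = star f (star g h)" for f g h unfolding star_def by (rule Q.mult_assoc_complete)
  have \<eta>eq: "\<eta> f = \<eta> g \<longleftrightarrow> bad_support rel (\<lambda>x. f x - g x)" if f: "f \<in> ?P" and g: "g \<in> ?P" for f g
  proof -
    note d = Q.path_algebra_diff_closed[OF f g]
    have "\<eta> f = \<eta> (\<lambda>x. f x - g x) \<oplus>\<^bsub>Hom C T T\<^esub> \<eta> g" using \<eta>a[OF d g] by simp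
    then have "\<eta> f = \<eta> g \<longleftrightarrow> \<eta> (\<lambda>x. f x - g x) = zero_mor C T T"
      using A.add.r_cancel_one[OF \<eta>c[OF g] \<eta>c[OF d]] by simp
    then show ?thesis using \<eta>0[OF d] by simp
  qed
  define v where "v = head Q a"
  define w where "w = head Q b"
  note r = rel[OF ab]
  have verts: "v \<in> verts Q" "w \<in> verts Q" "tail Q b = v" using r unfolding v_def w_def by auto
  define pa where "pa = (path_elem (tail Q a, [a]) :: 'a \<times> 'b list \<Rightarrow> 'k)"
  define pb where "pb = (path_elem (v, [b]) :: 'a \<times> 'b list \<Rightarrow> 'k)"
  define ev where "ev = (path_elem (v, []) :: 'a \<times> 'b list \<Rightarrow> 'k)"
  define ew where "ew = (path_elem (w, []) :: 'a \<times> 'b list \<Rightarrow> 'k)"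
  have pP: "pa \<in> ?P" "pb \<in> ?P" "ev \<in> ?P" "ew \<in> ?P"
    unfolding pa_def pb_def ev_def ew_def
    using r verts by (auto intro!: Q.path_elem_closed simp: Q.quiver_paths_Cons Q.quiver_paths_Nil)
  have ev_star: "star ev f = (\<lambda>x. if fst x = v then f x else 0)" for f
  proof
    fix x show "star ev f x = (if fst x = v then f x else 0)"
      by (cases x) (simp add: star_def ev_def Q.path_elem_mult)
  qed
  have ew_star: "star ew f = (\<lambda>x. if fst x = w then f x else 0)" for f
  proof
    fix x show "star ew f x = (if fst x = w then f x else 0)"
      by (cases x) (simp add: star_def ew_def Q.path_elem_mult)
  qed
  have pev: "star pa ev = pa" "star pb ew = pb" "star pa pb = path_elem (tail Q a, [a, b])"
    using Q.path_elem_append[of "tail Q a" "[a]" "[]"] Q.path_elem_append[of v "[b]" "[]"]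
      Q.path_elem_append[of "tail Q a" "[a]" "[b]"]
    by (simp_all add: star_def pa_def pb_def ev_def ew_def v_def w_def)
  have eb: "star ev pb = pb" "star ev ev = ev" "star ew ew = ew"
    unfolding ev_star ew_star by (auto simp: pb_def ev_def ew_def path_elem_def)
  have pab: "star pa pb \<in> ?P" by (rule mc[OF pP(1,2)])
  have bab: "bad_support rel (star pa pb)"
    unfolding pev(3) using ab unfolding bad_support_def path_elem_def by auto
  \<comment> \<open>Independent of the representative: two of them differ by bad paths, and a
    trivial path is never bad.\<close>
  define lam where "lam x = (SOME f. f \<in> ?P \<and> \<eta> f = x) (w, [])" for x
  have lam: "lam (\<eta> f) = f (w, [])" if f: "f \<in> ?P" for f
  proof -
    let ?f = "SOME g. g \<in> ?P \<and> \<eta> g = \<eta> f"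
    have g: "?f \<in> ?P \<and> \<eta> ?f = \<eta> f" 
      using someI[of "\<lambda>g. g \<in> ?P \<and> \<eta> g = \<eta> f" f] f by simp
    then have "bad_support rel (\<lambda>x. ?f x - f x)" using \<eta>eq[OF _ f] by blast
    from bad_support_zero[OF this, of "(w, [])"] have "?f (w, []) - f (w, []) = 0" by simp
    then show ?thesis unfolding lam_def by simp
  qed
  have lam_add: "lam (x \<oplus>\<^bsub>Hom C T T\<^esub> y) = lam x + lam y" if x: "x \<in> ?A" and y: "y \<in> ?A" for x y
  proof -
    obtain f where f: "f \<in> ?P" "\<eta> f = x" using \<eta>s[OF x] by blast
    obtain g where g: "g \<in> ?P" "\<eta> g = y" using \<eta>s[OF y] by blast
    show ?thesis using lam[OF Q.path_algebra_add_closed[OF f(1) g(1)]] \<eta>a[OF f(1) g(1)] f(2) g(2) lam[OF f(1)] lam[OF g(1)] by simp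
  qed
  have lam_smult: "lam (c \<odot>\<^bsub>Hom C T T\<^esub> x) = c * lam x" if x: "x \<in> ?A" for x c
  proof -
    obtain f where f: "f \<in> ?P" "\<eta> f = x" using \<eta>s[OF x] by blast
    show ?thesis using lam[OF Q.path_algebra_smult_closed[OF f(1)]] \<eta>sm[OF f(1)] f(2) lam[OF f(1)] by simp
  qed
  have lam_b: "lam (x \<cdot> \<eta> pb) = 0" if x: "x \<in> ?A" for x
  proof -
    obtain f where f: "f \<in> ?P" "\<eta> f = x" using \<eta>s[OF x] by blast
    have "star f pb (w, []) = 0" unfolding star_def pb_def Q.mult_path_elem by simp
    then show ?thesis using lam[OF mc[OF f(1) pP(2)]] ms[OF f(1) pP(2)] f(2) by simp
  qed
  have lam_d: "lam (\<eta> ew \<cdot> x) = lam x" if x: "x \<in> ?A" for x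
  proof -
    obtain f where f: "f \<in> ?P" "\<eta> f = x" using \<eta>s[OF x] by blast
    have "star ew f (w, []) = f (w, [])" unfolding ew_star by simp
    then show ?thesis using lam[OF mc[OF pP(4) f(1)]] ms[OF pP(4) f(1)] lam[OF f(1)] f(2) by simp
  qed
  have "\<one>\<^bsub>path_algebra Q\<^esub> \<in> ?P" using ring.ring_simprules(6)[OF Q.ring_path_algebra] .
  then have lam_1: "lam (Ident C T) \<noteq> 0" using lam[of "\<one>\<^bsub>path_algebra Q\<^esub>"] \<eta>1 verts by (simp add: path_algebra_simps(5))
  \<comment> \<open>The coefficient of the trivial path in \<open>f\<close> reappears at the path
    \<open>b\<close> in b f, and a single arrow contains no relation.\<close>
  have lam_ker: "lam x = 0" if x: "x \<in> ?A" and "\<eta> ew \<cdot> x = x" and 0: "\<eta> pb \<cdot> x = zero_mor C T T" for x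
  proof -
    obtain f where f: "f \<in> ?P" "\<eta> f = x" using \<eta>s[OF x] by blast
    have "bad_support rel (star pb f)" using \<eta>0[OF mc[OF pP(2) f(1)]] ms[OF pP(2) f(1)] f(2) 0 by simp
    from bad_support_zero[OF this, of "(v, [b])"] have "star pb f (v, [b]) = 0" by simp
    moreover have "star pb f (v, [b]) = f (w, [])" unfolding star_def pb_def Q.path_elem_mult by (simp add: w_def)
    ultimately show ?thesis using lam[OF f(1)] f(2) by simp
  qed
  \<comment> \<open>All terms of \<open>f\<close> start at \<open>v\<close>. A term without a
    relation that is killed by \<open>a\<close> begins with an arrow related to \<open>a\<close>,
    which is \<open>b\<close> by \<open>rel_right\<close>. So \<open>f\<close> is congruent to b
    times its left quotient.\<close>
  have exact: "\<exists>q\<in>?A. x = \<eta> pb \<cdot> q" if x: "x \<in> ?A" and ex: "\<eta> ev \<cdot> x = x" and ax: "\<eta> pa \<cdot> x = zero_mor C T T" for x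
  proof -
    obtain f0 where f0: "f0 \<in> ?P" "\<eta> f0 = x" using \<eta>s[OF x] by blast
    define f where "f = star ev f0"
    have f: "f \<in> ?P" "\<eta> f = x" unfolding f_def using mc[OF pP(3) f0(1)] ms[OF pP(3) f0(1)] f0(2) ex by simp_all
    have fv: "fst y = v" if "f y \<noteq> 0" for y using that unfolding f_def ev_star by (auto split: if_splits)
    have "bad_support rel (star pa f)" using \<eta>0[OF mc[OF pP(1) f(1)]] ms[OF pP(1) f(1)] f(2) ax by simp
    then have bad: "bad_support rel (path_elem (tail Q a, [a]) \<otimes>\<^bsub>complete_path_algebra Q\<^esub> f)"
      unfolding star_def pa_def .
    let ?q = "left_quotient Q b f"
    have q: "?q \<in> ?P" by (rule Q.left_quotient_closed[OF f(1)])
    have pbq: "star pb ?q y = (if snd y \<noteq> [] \<and> hd (snd y) = b then f y else 0)" for y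
      using Q.left_quotient_mult[OF f(1), of b y] unfolding star_def pb_def verts(3) .
    have "bad_support rel (\<lambda>y. f y - star pb ?q y)"
      unfolding bad_support_def
    proof (intro allI impI)
      fix y assume "f y - star pb ?q y \<noteq> 0"
      then have y: "f y \<noteq> 0" "\<not> (snd y \<noteq> [] \<and> hd (snd y) = b)" unfolding pbq by (auto split: if_splits)
      then have "f (head Q a, snd y) \<noteq> 0" using fv[of y] unfolding v_def by (cases y) auto
      from Q.arrow_mult_bad[OF bad this] show "\<not> avoids rel (snd y)"
        using y(2) rel_right[OF ab] by blast
    qed
    then have "x = \<eta> pb \<cdot> \<eta> ?q" using \<eta>eq[OF f(1) mc[OF pP(2) q]] ms[OF pP(2) q] f(2) by simp
    then show ?thesis using \<eta>c[OF q] by blast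
  qed
  let ?R = "{r \<in> ?A. \<eta> ew \<cdot> r = r \<and> (\<forall>f\<in>?A. lam (r \<cdot> f) = 0)}"
  have PR: "\<eta> f \<in> ?R" if f: "f \<in> positive_paths_from Q w" for f
  proof -
    have fP: "f \<in> ?P" and fs: "\<And>x. f x \<noteq> 0 \<Longrightarrow> fst x = w \<and> snd x \<noteq> []"
      using f unfolding positive_paths_from_def by blast+
    have "(if fst x = w then f x else 0) = f x" for x using fs[of x] by auto
    then have "star ew f = f" unfolding ew_star by (rule ext)
    then have "\<eta> ew \<cdot> \<eta> f = \<eta> f" using ms[OF pP(4) fP] by simp
    moreover have "lam (\<eta> f \<cdot> x) = 0" if x: "x \<in> ?A" for x
    proof -
      obtain g where g: "g \<in> ?P" "\<eta> g = x" using \<eta>s[OF x] by blast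
      have "f (w, []) = 0" using fs[of "(w, [])"] by auto
      then have "star f g (w, []) = 0" unfolding star_def mult_path by simp
      then show ?thesis using lam[OF mc[OF fP g(1)]] ms[OF fP g(1)] g(2) by simp
    qed
    ultimately show ?thesis using \<eta>c[OF fP] by blast
  qed
  have idem: "\<eta> ev \<cdot> \<eta> ev = \<eta> ev" "\<eta> pa \<cdot> \<eta> ev = \<eta> pa" "\<eta> ev \<cdot> \<eta> pb = \<eta> pb" "\<eta> pb \<cdot> \<eta> ew = \<eta> pb" "\<eta> ew \<cdot> \<eta> ew = \<eta> ew"
    using ms[OF pP(3,3)] ms[OF pP(1,3)] ms[OF pP(3,2)] ms[OF pP(2,4)] ms[OF pP(4,4)] pev eb by simp_all
  have ab0: "\<eta> pa \<cdot> \<eta> pb = zero_mor C T T" using \<eta>0[OF pab] bab ms[OF pP(1,2)] by simp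
  show ?thesis
  proof (rule extension_obstruction[OF T pP[THEN \<eta>c] idem ab0 exact lam_add lam_smult lam_b lam_d lam_1 lam_ker refl])
    fix \<rho>0
    assume \<rho>c: "\<And>r. r \<in> ?R \<Longrightarrow> \<rho>0 r \<in> ?A"
      and \<rho>m: "\<And>r x. \<lbrakk>r \<in> ?R; x \<in> ?A\<rbrakk> \<Longrightarrow> \<exists>q\<in>?A. \<rho>0 (r \<cdot> x) = \<rho>0 r \<cdot> x \<oplus>\<^bsub>Hom C T T\<^esub> \<eta> pa \<cdot> q"
      and \<rho>n: "\<And>x. x \<in> ?A \<Longrightarrow> \<exists>r\<in>?R. \<eta> pb \<cdot> r = zero_mor C T T \<and>
        \<not> (\<exists>q\<in>?A. \<rho>0 r = x \<cdot> r \<oplus>\<^bsub>Hom C T T\<^esub> \<eta> pa \<cdot> q)"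
    \<comment> \<open>The choice depends on \<open>\<eta> f\<close> only, so congruent arguments get
      equal values and not merely congruent ones, as \<open>obstruction_cocycle\<close>
      requires.\<close>
    define \<rho> where "\<rho> f = (SOME g. g \<in> ?P \<and> \<eta> g = \<rho>0 (\<eta> f))" for f
    have \<rho>: "\<rho> f \<in> ?P" "\<eta> (\<rho> f) = \<rho>0 (\<eta> f)" if f: "f \<in> positive_paths_from Q w" for f
    proof -
      have "\<exists>g. g \<in> ?P \<and> \<eta> g = \<rho>0 (\<eta> f)" using \<eta>s[OF \<rho>c[OF PR[OF f]]] by blast
      from someI_ex[OF this] show "\<rho> f \<in> ?P" "\<eta> (\<rho> f) = \<rho>0 (\<eta> f)" unfolding \<rho>_def by blast+
    qed
    have RP: "f \<in> ?P" if "f \<in> positive_paths_from Q w" for f using that unfolding positive_paths_from_def by blast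
    have Rmult: "star f x \<in> positive_paths_from Q w" if f: "f \<in> positive_paths_from Q w" and x: "x \<in> ?P" for f x
      unfolding positive_paths_from_def
    proof (intro CollectI conjI allI impI mc[OF RP[OF f] x])
      fix y assume nz: "star f x y \<noteq> 0"
      obtain u p where y: "y = (u, p)" by fastforce
      obtain i where "f (u, take i p) * x (pre_digraph.awlast Q u (take i p), drop i p) \<noteq> 0"
        using nz unfolding y star_def mult_path by (meson sum.not_neutral_contains_not_neutral)
      then have "f (u, take i p) \<noteq> 0" by auto
      then have "u = w" "take i p \<noteq> []" using f unfolding positive_paths_from_def by fastforce+
      then show "fst y = w" "snd y \<noteq> []" unfolding y by auto
    qed
    have pa_near: "near rel a (star pa g)" for g
      unfolding near_def
    proof (intro allI impI)
      fix x assume "star pa g x \<noteq> 0"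
      then have "take 1 (snd x) = [a]"
        unfolding star_def pa_def by (cases x) (auto simp: Q.path_elem_mult split: if_splits)
      then show "\<not> avoids rel (snd x) \<or> (snd x \<noteq> [] \<and> hd (snd x) = a)"
        by (cases "snd x") auto
    qed
    have "obstruction_cocycle Q rel a b \<rho>"
      unfolding obstruction_cocycle_def w_def[symmetric] verts(3) pb_def[symmetric] star_def[symmetric]
    proof (intro conjI ballI impI)
      fix f :: "'a \<times> 'b list \<Rightarrow> 'k"
      assume f: "f \<in> positive_paths_from Q w"
      show "\<rho> f \<in> ?P" by (rule \<rho>(1)[OF f])
      show "\<rho> f = \<rho> g" if g: "g \<in> positive_paths_from Q w" and bad: "bad_support rel (\<lambda>x. f x - g x)" for g
        using bad \<eta>eq[OF RP[OF f] RP[OF g]] unfolding \<rho>_def by simp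
      fix x :: "'a \<times> 'b list \<Rightarrow> 'k"
      assume x: "x \<in> ?P"
      obtain q0 where q0: "q0 \<in> ?A" "\<rho>0 (\<eta> f \<cdot> \<eta> x) = \<rho>0 (\<eta> f) \<cdot> \<eta> x \<oplus>\<^bsub>Hom C T T\<^esub> \<eta> pa \<cdot> q0"
        using \<rho>m[OF PR[OF f] \<eta>c[OF x]] by blast
      obtain q where q: "q \<in> ?P" "\<eta> q = q0" using \<eta>s[OF q0(1)] by blast
      note c = mc[OF \<rho>(1)[OF f] x] mc[OF pP(1) q(1)]
      have "\<eta> (\<rho> (star f x)) = \<eta> (\<lambda>z. star (\<rho> f) x z + star pa q z)"
        using \<rho>(2)[OF Rmult[OF f x]] ms[OF RP[OF f] x] q0(2) \<eta>a[OF c] ms[OF \<rho>(1)[OF f] x] ms[OF pP(1) q(1)]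
          \<rho>(2)[OF f] q(2) by simp
      then have "bad_support rel (\<lambda>z. \<rho> (star f x) z - (star (\<rho> f) x z + star pa q z))"
        using \<eta>eq[OF \<rho>(1)[OF Rmult[OF f x]] Q.path_algebra_add_closed[OF c]] by simp
      from near_add[OF bad_support_near[OF this] pa_near[of q]]
      show "near rel a (\<lambda>z. \<rho> (star f x) z - star (\<rho> f) x z)" by (simp add: algebra_simps)
    next
      fix x :: "'a \<times> 'b list \<Rightarrow> 'k"
      assume x: "x \<in> ?P"
      obtain r where r: "r \<in> ?R" "\<eta> pb \<cdot> r = zero_mor C T T"
        "\<not> (\<exists>q\<in>?A. \<rho>0 r = \<eta> x \<cdot> r \<oplus>\<^bsub>Hom C T T\<^esub> \<eta> pa \<cdot> q)" using \<rho>n[OF \<eta>c[OF x]] by blast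
      have rA: "r \<in> ?A" "\<eta> ew \<cdot> r = r" "lam (r \<cdot> Ident C T) = 0" using r(1) Ident_closed[OF TO] by blast+
      obtain f0 where f0: "f0 \<in> ?P" "\<eta> f0 = r" using \<eta>s[OF rA(1)] by blast
      define f where "f = star ew f0"
      have fP: "f \<in> ?P" unfolding f_def by (rule mc[OF pP(4) f0(1)])
      have fr: "\<eta> f = r" unfolding f_def using ms[OF pP(4) f0(1)] f0(2) rA(2) by simp
      have "f (w, []) = 0" using lam[OF fP] rA(3) fr Comp_Ident_right[OF TO TO rA(1)] by simp
      then have f: "f \<in> positive_paths_from Q w"
        using fP unfolding positive_paths_from_def by (force simp: f_def ew_star split: if_splits)
      have "bad_support rel (star pb f)" using \<eta>0[OF mc[OF pP(2) fP]] ms[OF pP(2) fP] fr r(2) by simp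
      moreover have "\<not> near rel a (\<lambda>z. \<rho> f z - star x f z)"
      proof
        assume n: "near rel a (\<lambda>z. \<rho> f z - star x f z)"
        note xf = mc[OF x fP]
        note nP = Q.path_algebra_diff_closed[OF \<rho>(1)[OF f] xf]
        define q where "q = left_quotient Q a (\<lambda>z. \<rho> f z - star x f z)"
        have q: "q \<in> ?P" unfolding q_def by (rule Q.left_quotient_closed[OF nP])
        have "bad_support rel (\<lambda>z. \<rho> f z - star x f z - star pa q z)"
          using Q.near_decompose[OF nP n] unfolding star_def pa_def q_def .
        then have "bad_support rel (\<lambda>z. \<rho> f z - (star x f z + star pa q z))" by (simp add: algebra_simps)
        then have "\<eta> (\<rho> f) = \<eta> (\<lambda>z. star x f z + star pa q z)"
          using \<eta>eq[OF \<rho>(1)[OF f] Q.path_algebra_add_closed[OF xf mc[OF pP(1) q]]] by simp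
        then have "\<rho>0 r = \<eta> x \<cdot> r \<oplus>\<^bsub>Hom C T T\<^esub> \<eta> pa \<cdot> \<eta> q"
          using \<rho>(2)[OF f] fr \<eta>a[OF xf mc[OF pP(1) q]] ms[OF x fP] ms[OF pP(1) q] by simp
        then show False using r(3) \<eta>c[OF q] by blast
      qed
      ultimately show "\<exists>f\<in>positive_paths_from Q w. bad_support rel (star pb f) \<and> \<not> near rel a (\<lambda>z. \<rho> f z - star x f z)"
        using f by blast
    qed
    then show ?thesis by blast
  qed
qed

theorem corollary1:
  fixes Q :: "('v, 'a) pre_digraph"
    and I :: "('v \<times> 'a list \<Rightarrow> 'k::alg_closed_field) set"
    and C :: "('o, 'm, 'k) triangulated_cat"
    and T :: 'o
  assumes "CHAR('k) \<noteq> 3"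
    and "gentle Q I"
    and "two_calabi_yau C"
    and "cluster_tilting C T"
    and "algebra_isomorphic (quotient_algebra (path_algebra Q) I) (End_algebra C T)"
  shows "\<exists>(Q' :: (nat, nat) pre_digraph) (W :: nat \<times> nat list \<Rightarrow> 'k).
    fin_digraph Q' \<and> potential Q' W \<and>
    algebra_isomorphic (jacobian_algebra Q' W) (quotient_algebra (path_algebra Q) I)"
proof -
  have fin: "fin_digraph Q" using assms(2) unfolding gentle_def by blast
  interpret Q: fin_digraph Q by (rule fin)
  interpret C: two_calabi_yau C by fact
  have TO: "T \<in> Ob C" using assms(4) unfolding cluster_tilting_def by blast
  interpret A: abelian_group "Hom C T T" using C.Hom_group TO by blast
  let ?rel = "gentle_rel Q I"
  let ?P = "path_algebra Q :: ('k, 'v \<times> 'a list \<Rightarrow> 'k) module"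
  have I: "ideal I ?P" using assms(2) unfolding gentle_def admissible_ideal_def by blast
  note I_eq = Q.gentle_ideal[OF assms(2)]
  obtain h where h: "h \<in> ring_iso (quotient_algebra ?P I) (End_algebra C T)"
    "h \<in> linear_maps (quotient_algebra ?P I) (End_algebra C T)"
    using assms(5) unfolding algebra_isomorphic_def by blast
  define \<eta> where "\<eta> = (\<lambda>x. h (I +>\<^bsub>?P\<^esub> x))"
  have E: "carrier (End_algebra C T) = mor C T T" "add (End_algebra C T) = add (Hom C T T)"
    "zero (End_algebra C T) = zero_mor C T T" "smult (End_algebra C T) = smult (Hom C T T)"
    "monoid.mult (End_algebra C T) = Comp C" "one (End_algebra C T) = Ident C T"
    by (simp_all add: End_algebra_def)
  have 1: "c \<odot>\<^bsub>?P\<^esub> i \<in> I" if "i \<in> I" for c i using Q.ideal_smult[OF I that] by (simp add: path_algebra_simps(4))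
  have 2: "c \<odot>\<^bsub>?P\<^esub> y \<in> carrier ?P" if "y \<in> carrier ?P" for c y
    using Q.path_algebra_smult_closed[OF that] by (simp add: path_algebra_simps(4))
  have 3: "c \<odot>\<^bsub>?P\<^esub> (y \<oplus>\<^bsub>?P\<^esub> z) = c \<odot>\<^bsub>?P\<^esub> y \<oplus>\<^bsub>?P\<^esub> c \<odot>\<^bsub>?P\<^esub> z" for c y z
    by (simp add: path_algebra_simps distrib_left)
  have 4: "z = \<zero>\<^bsub>End_algebra C T\<^esub>" if "z \<in> carrier (End_algebra C T)" "z \<oplus>\<^bsub>End_algebra C T\<^esub> z = z" for z
    using that A.add.l_cancel_one unfolding E by blast
  note q = quotient_iso_lift[OF I h _ _ _ _ \<eta>_def]
  have lift1: "\<eta> \<in> ring_hom ?P (End_algebra C T)" by (rule q(1)) (rule 1 2 3 4; assumption)+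
  have lift2: "\<eta> ` carrier ?P = carrier (End_algebra C T)" by (rule q(2)) (rule 1 2 3 4; assumption)+
  have lift3: "\<eta> (c \<odot>\<^bsub>?P\<^esub> x) = c \<odot>\<^bsub>End_algebra C T\<^esub> \<eta> x" if "x \<in> carrier ?P" for c x
    by (rule q(3)[OF _ _ _ _ that]) (rule 1 2 3 4; assumption)+
  have lift4: "\<eta> x = \<zero>\<^bsub>End_algebra C T\<^esub> \<longleftrightarrow> x \<in> I" if "x \<in> carrier ?P" for x
    by (rule q(4)[OF _ _ _ _ that]) (rule 1 2 3 4; assumption)+
  have relD: "a \<in> arcs Q \<and> b \<in> arcs Q \<and> head Q a = tail Q b" if "?rel a b" for a b
    by (rule gentle_relD[OF that])
  have rel_right: "b = b'" if "?rel a b" "?rel a b'" for a b b'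
    by (rule gentle_rel_unique(1)[OF assms(2) that])
  have rel_left: "a = a'" if "?rel a b" "?rel a' b" for a a' b
    by (rule gentle_rel_unique(2)[OF assms(2) that])
  have cocycles: "\<exists>\<rho> :: ('v \<times> 'a list \<Rightarrow> 'k) \<Rightarrow> 'v \<times> 'a list \<Rightarrow> 'k. obstruction_cocycle Q ?rel a b \<rho>"
    if ab: "?rel a b" for a b
  proof (rule C.obstruction_cocycle_exists[where rel = ?rel and \<eta> = \<eta> and a = a and b = b, OF fin assms(4)])
    show "\<eta> f \<in> mor C T T" if "f \<in> carrier ?P" for f using ring_hom_closed[OF lift1 that] unfolding E .
    show "\<exists>f\<in>carrier ?P. \<eta> f = x" if "x \<in> mor C T T" for x
      using lift2 that unfolding E by (metis imageE)
    show "\<eta> (f \<otimes>\<^bsub>complete_path_algebra Q\<^esub> g) = \<eta> f \<cdot>\<^bsub>C\<^esub> \<eta> g" if "f \<in> carrier ?P" "g \<in> carrier ?P" for f g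
      using ring_hom_mult[OF lift1 that] unfolding E path_algebra_simps .
    show "\<eta> (\<lambda>x. f x + g x) = \<eta> f \<oplus>\<^bsub>Hom C T T\<^esub> \<eta> g" if "f \<in> carrier ?P" "g \<in> carrier ?P" for f g
      using ring_hom_add[OF lift1 that] unfolding E path_algebra_simps(3) .
    show "\<eta> (\<lambda>x. c * f x) = c \<odot>\<^bsub>Hom C T T\<^esub> \<eta> f" if "f \<in> carrier ?P" for f c
      using lift3[OF that, of c] unfolding E path_algebra_simps(4) .
    show "\<eta> \<one>\<^bsub>?P\<^esub> = Ident C T" using ring_hom_one[OF lift1] unfolding E .
    show "\<eta> f = zero_mor C T T \<longleftrightarrow> bad_support ?rel f" if f: "f \<in> carrier ?P" for f
    proof -
      have "f \<in> I \<longleftrightarrow> bad_support ?rel f" using I_eq f by blast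
      then show ?thesis using lift4[OF f] unfolding E by simp
    qed
  qed (fact relD rel_right ab)+
  have tri: "\<exists>c. ?rel b c \<and> ?rel c a" if ab: "?rel a b" for a b
    by (rule Q.relation_triangle[where rel = ?rel and a = a and b = b]) (fact relD rel_right rel_left cocycles ab)+
  have char: "(3::'k) \<noteq> 0"
  proof
    assume "(3::'k) = 0"
    then have "of_nat 3 = (0::'k)" by simp
    then have "CHAR('k) dvd 3" by (simp only: of_nat_eq_0_iff_char_dvd)
    \<comment> \<open>The value 1 is impossible in a field, and 3 is excluded by assumption.\<close>
    then have "CHAR('k) = 1 \<or> CHAR('k) = 3"
      using prime_nat_iff[of 3] by auto
    then show False using assms(1) by simp
  qed
  obtain m where m: "\<And>x. \<lbrakk>x \<in> quiver_paths Q; length (snd x) = m\<rbrakk> \<Longrightarrow> \<not> avoids ?rel (snd x)"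
    by (rule Q.gentle_long_paths_bad[OF assms(2)]) blast
  show ?thesis
    by (rule Q.monomial_quotient_is_jacobian[where rel = ?rel and m = m]) (fact relD rel_right tri m char I_eq)+
qed

end
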